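(* Let $\Delta$ be an $s\times r$ matrix of holomorphic functions on an open set $E\subset\mathbb{C}^d$ such that $B_\Delta$ is connected and has more than one point. Let $T$ be a diagonalizable commuting $d$-tuple of operators acting on $\mathbb{C}^2$ with $\sigma(T)=\{z,w\}\subset B_\Delta$. If $\|\Delta(T)\|\le 1$ and $d_\Delta(z,w)=d_{B_\Delta}(z,w)$, then $B_\Delta$ is a complete spectral domain for $T$.
   Context: $B_\Delta:=\{z\in E : \|\Delta(z)\|<1\}$, with the operator norm on $B(\mathbb{C}^r,\mathbb{C}^s)$. For $z,w\in B_\Delta$, $$d_\Delta(z,w):=\left\|(I-\Delta(w)\Delta(w)^* )^{-1/2}(\Delta(z)-\Delta(w))(I-\Delta(w)^*\Delta(z))^{-1}(I-\Delta(w)^*\Delta(w))^{1/2}\right\|.$$ Let $\mathbb{D}$ be the open unit disk and $d_{\mathbb{D}}(\alpha,\beta)=\left|\frac{\alpha-\beta}{1-\overline{\beta}\alpha}\right|$ for $\alpha,\beta\in\mathbb{D}$. For a domain $\Omega\subset\mathbb{C}^d$ the Möbius pseudo-distance is $d_\Omega(z,w)=\sup\{d_{\mathbb{D}}(f(z),f(w)) : f:\Omega\to\mathbb{D}\text{ holomorphic}\}$. A commuting $d$-tuple $T=(T^1,\dots,T^d)$ of operators on $\mathbb{C}^2$ is diagonalizable if there are linearly independent $v_1,v_2\in\mathbb{C}^2$ and points $z_1,z_2\in\mathbb{C}^d$ (possibly equal), $z_j=(z_j^1,\dots,z_j^d)$, with $T^k v_j=z_j^k v_j$ for all $1\le k\le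 d$, $j=1,2$; its joint spectrum is $\sigma(T)=\{z_1,z_2\}$. For a matrix-valued function $G$ (of size $m\times n$) defined on $\sigma(T)$, $G(T)\in B(\mathbb{C}^n\otimes\mathbb{C}^2,\mathbb{C}^m\otimes\mathbb{C}^2)$ is the linear map with $G(T)(e\otimes v_j)=G(z_j)e\otimes v_j$ for $e\in\mathbb{C}^n$, $j=1,2$; this defines $\Delta(T)$ and $f(T)$. A domain $\Omega\subset\mathbb{C}^d$ is a complete spectral domain for $T$ if $\sigma(T)\subset\Omega$ and, for every positive integer $n$ and every holomorphic $n\times n$-matrix-valued function $f$ on $\Omega$, $\|f(T)\|\le\sup_{z\in\Omega}\|f(z)\|$. *)

theory Defs
  imports
    "HOL-Analysis.Analysis"
    "Jordan_Normal_Form.Schur_Decomposition"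
    "Jordan_Normal_Form.Gauss_Jordan_Elimination"
begin

text \<open>
  Points of \<open>\<complex>\<^sup>d\<close> are of type \<open>complex ^ 'd\<close>, where the topology and the derivative live. All other
  vectors and matrices are those of \<open>Jordan_Normal_Form\<close>, whose sizes are natural numbers, because the
  notion of complete spectral domain quantifies over the size \<open>n\<close>. Both libraries use the
  dollar sign for components; here it is the one of \<open>Jordan_Normal_Form\<close>.
\<close>

unbundle no vec_syntax

section \<open>Matrices as operators between finite-dimensional Hilbert spaces\<close>

definition l2_norm :: "complex Matrix.vec \<Rightarrow> real" where
  "l2_norm v = L2_set (\<lambda>i. cmod (v $ i)) {..<dim_vec v}"

definition op_norm :: "complex mat \<Rightarrow> real" where
  "op_norm A = Sup {l2_norm (A *\<^sub>v x) | x. x \<in> carrier_vec (dim_col A) \<and> l2_norm x \<le> 1}"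

text \<open>\<open>u \<bullet>c v\<close> conjugates the second argument.\<close>

definition positive_semidefinite :: "complex mat \<Rightarrow> bool" where
  "positive_semidefinite A \<longleftrightarrow>
     square_mat A \<and> mat_adjoint A = A \<and>
     (\<forall>x \<in> carrier_vec (dim_row A). 0 \<le> Re ((A *\<^sub>v x) \<bullet>c x))"

text \<open>The positive square root; meaningful for positive semidefinite \<open>A\<close>.\<close>

definition mat_sqrt :: "complex mat \<Rightarrow> complex mat" where
  "mat_sqrt A = (THE R. R \<in> carrier_mat (dim_row A) (dim_row A) \<and> positive_semidefinite R \<and> R * R = A)"

text \<open>\<open>mat_inverse\<close> is \<open>None\<close> exactly on singular square matrices and on non-square ones.\<close>

definition mat_inv :: "complex mat \<Rightarrow> complex mat" where
  "mat_inv A = the (mat_inverse A)"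

section \<open>Holomorphic functions of several variables\<close>

text \<open>Complex Frechet differentiability at every point of \<open>S\<close>; used for open \<open>S\<close> only.\<close>

definition holomorphic_several :: "(complex ^ 'd \<Rightarrow> complex) \<Rightarrow> (complex ^ 'd) set \<Rightarrow> bool" where
  "holomorphic_several f S \<longleftrightarrow>
     (\<forall>z\<in>S. \<exists>f'. (f has_derivative f') (at z) \<and> (\<forall>c h. f' (c *s h) = c * f' h))"

definition holomorphic_mat ::
    "nat \<Rightarrow> nat \<Rightarrow> (complex ^ 'd \<Rightarrow> complex mat) \<Rightarrow> (complex ^ 'd) set \<Rightarrow> bool" where
  "holomorphic_mat m n F S \<longleftrightarrow>
     (\<forall>z\<in>S. F z \<in> carrier_mat m n) \<and>
     (\<forall>i<m. \<forall>j<n. holomorphic_several (\<lambda>z. F z $$ (i, j)) S)"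

definition is_domain :: "(complex ^ 'd) set \<Rightarrow> bool" where
  "is_domain \<Omega> \<longleftrightarrow> open \<Omega> \<and> connected \<Omega> \<and> \<Omega> \<noteq> {}"

section \<open>The pseudo-distances\<close>

definition disk_dist :: "complex \<Rightarrow> complex \<Rightarrow> real" where
  "disk_dist \<alpha> \<beta> = cmod ((\<alpha> - \<beta>) / (1 - cnj \<beta> * \<alpha>))"

definition mobius_dist :: "(complex ^ 'd) set \<Rightarrow> complex ^ 'd \<Rightarrow> complex ^ 'd \<Rightarrow> real" where
  "mobius_dist \<Omega> z w =
     Sup {disk_dist (f z) (f w) | f. holomorphic_several f \<Omega> \<and> f ` \<Omega> \<subseteq> ball 0 1}"

definition B_Delta :: "(complex ^ 'd) set \<Rightarrow> (complex ^ 'd \<Rightarrow> complex mat) \<Rightarrow> (complex ^ 'd) set" where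
  "B_Delta E \<Delta> = {z \<in> E. op_norm (\<Delta> z) < 1}"

definition delta_dist ::
    "nat \<Rightarrow> nat \<Rightarrow> (complex ^ 'd \<Rightarrow> complex mat) \<Rightarrow> complex ^ 'd \<Rightarrow> complex ^ 'd \<Rightarrow> real" where
  "delta_dist s r \<Delta> z w =
     op_norm (mat_inv (mat_sqrt (1\<^sub>m s - \<Delta> w * mat_adjoint (\<Delta> w)))
              * (\<Delta> z - \<Delta> w)
              * mat_inv (1\<^sub>m r - mat_adjoint (\<Delta> w) * \<Delta> z)
              * mat_sqrt (1\<^sub>m r - mat_adjoint (\<Delta> w) * \<Delta> w))"

section \<open>Diagonalizable tuples on \<open>\<complex>\<^sup>2\<close> and their functional calculus\<close>

definition joint_eigenvector ::
    "('d::finite \<Rightarrow> complex mat) \<Rightarrow> complex Matrix.vec \<Rightarrow> complex ^ 'd \<Rightarrow> bool" where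
  "joint_eigenvector T v z \<longleftrightarrow> v \<in> carrier_vec 2 \<and> (\<forall>k. T k *\<^sub>v v = vec_nth z k \<cdot>\<^sub>v v)"

definition joint_eigenbasis ::
    "('d::finite \<Rightarrow> complex mat) \<Rightarrow> complex Matrix.vec \<Rightarrow> complex Matrix.vec
     \<Rightarrow> complex ^ 'd \<Rightarrow> complex ^ 'd \<Rightarrow> bool" where
  "joint_eigenbasis T v\<^sub>1 v\<^sub>2 z\<^sub>1 z\<^sub>2 \<longleftrightarrow>
     joint_eigenvector T v\<^sub>1 z\<^sub>1 \<and> joint_eigenvector T v\<^sub>2 z\<^sub>2 \<and>
     (\<forall>a b. a \<cdot>\<^sub>v v\<^sub>1 + b \<cdot>\<^sub>v v\<^sub>2 = 0\<^sub>v 2 \<longrightarrow> a = 0 \<and> b = 0)"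

definition commuting_tuple :: "('d::finite \<Rightarrow> complex mat) \<Rightarrow> bool" where
  "commuting_tuple T \<longleftrightarrow> (\<forall>k. T k \<in> carrier_mat 2 2) \<and> (\<forall>j k. T j * T k = T k * T j)"

definition diagonalizable_tuple :: "('d::finite \<Rightarrow> complex mat) \<Rightarrow> bool" where
  "diagonalizable_tuple T \<longleftrightarrow>
     commuting_tuple T \<and> (\<exists>v\<^sub>1 v\<^sub>2 z\<^sub>1 z\<^sub>2. joint_eigenbasis T v\<^sub>1 v\<^sub>2 z\<^sub>1 z\<^sub>2)"

text \<open>The set \<open>{z\<^sub>1, z\<^sub>2}\<close> does not depend on the chosen eigenbasis.\<close>

definition joint_spectrum :: "('d::finite \<Rightarrow> complex mat) \<Rightarrow> (complex ^ 'd) set" where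
  "joint_spectrum T = (THE S. \<exists>v\<^sub>1 v\<^sub>2 z\<^sub>1 z\<^sub>2. joint_eigenbasis T v\<^sub>1 v\<^sub>2 z\<^sub>1 z\<^sub>2 \<and> S = {z\<^sub>1, z\<^sub>2})"

text \<open>
  \<open>\<complex>\<^sup>n \<otimes> \<complex>\<^sup>2\<close> is identified isometrically with \<open>\<complex>\<^sup>2\<^sup>n\<close>: the basis vector \<open>e\<^sub>i \<otimes> e\<^sub>j\<close> (\<open>i < n\<close>, \<open>j < 2\<close>)
  becomes the basis vector number \<open>2 i + j\<close>.
\<close>

definition tensor_vec :: "complex Matrix.vec \<Rightarrow> complex Matrix.vec \<Rightarrow> complex Matrix.vec" where
  "tensor_vec e v =
     Matrix.vec (dim_vec e * dim_vec v) (\<lambda>i. e $ (i div dim_vec v) * v $ (i mod dim_vec v))"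

text \<open>\<open>G(T)\<close> for an \<open>m \<times> n\<close> matrix-valued \<open>G\<close>; the operator does not depend on the chosen eigenbasis.\<close>

definition mat_fun_calc ::
    "nat \<Rightarrow> nat \<Rightarrow> (complex ^ 'd \<Rightarrow> complex mat) \<Rightarrow> ('d::finite \<Rightarrow> complex mat) \<Rightarrow> complex mat" where
  "mat_fun_calc m n G T =
     (THE M. M \<in> carrier_mat (m * 2) (n * 2) \<and>
        (\<exists>v\<^sub>1 v\<^sub>2 z\<^sub>1 z\<^sub>2. joint_eigenbasis T v\<^sub>1 v\<^sub>2 z\<^sub>1 z\<^sub>2 \<and>
           (\<forall>e \<in> carrier_vec n.
              M *\<^sub>v tensor_vec e v\<^sub>1 = tensor_vec (G z\<^sub>1 *\<^sub>v e) v\<^sub>1 \<and>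
              M *\<^sub>v tensor_vec e v\<^sub>2 = tensor_vec (G z\<^sub>2 *\<^sub>v e) v\<^sub>2)))"

text \<open>The supremum is taken in the extended reals because \<open>f\<close> may be unbounded.\<close>

definition complete_spectral_domain :: "(complex ^ 'd::finite) set \<Rightarrow> ('d::finite \<Rightarrow> complex mat) \<Rightarrow> bool" where
  "complete_spectral_domain \<Omega> T \<longleftrightarrow>
     is_domain \<Omega> \<and> joint_spectrum T \<subseteq> \<Omega> \<and>
     (\<forall>n f. 0 < n \<and> holomorphic_mat n n f \<Omega> \<longrightarrow>
        ereal (op_norm (mat_fun_calc n n f T)) \<le> (SUP z\<in>\<Omega>. ereal (op_norm (f z))))"

end

theory Submission
  imports Defs
begin

text \<open>
  Let \<open>v\<^sub>1, v\<^sub>2\<close> be unit joint eigenvectors of \<open>T\<close> for \<open>z, w\<close>, and let \<open>g\<close> be their inner product. For a matrix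
  function \<open>G\<close> with strictly contractive values \<open>A = G z\<close> and \<open>B = G w\<close>, the inequality \<open>\<parallel>G(T)\<parallel> \<le> 1\<close> is the
  positivity of a quadratic form in two vectors. The automorphism of the matrix ball that moves \<open>B\<close> to \<open>0\<close>
  transforms this form into one involving only \<open>g\<close> and the image \<open>C\<close> of \<open>A\<close>, and it is positive iff
  \<open>\<parallel>C\<parallel>\<^sup>2 \<le> 1 - |g|\<^sup>2\<close>. For \<open>G = \<Delta>\<close> the norm of \<open>C\<close> is \<open>d\<^sub>\<Delta>(z, w)\<close>; for an arbitrary \<open>G\<close> it is at most the
  Moebius distance of \<open>z\<close> and \<open>w\<close>, by pairing \<open>C\<close> with unit vectors. Since the two distances agree, the bound
  passes from \<open>\<Delta>\<close> to every \<open>G\<close>.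
\<close>

section \<open>Norms and adjoints\<close>

text \<open>Besides the two points, \<open>T\<close> contributes only the angle of its eigenvectors:
  every vector of the tensor space has the form
  \<open>e \<otimes> v\<^sub>1 + e' \<otimes> v\<^sub>2\<close>, and its norm sees the unit
  eigenvectors only through \<open>g\<close>. The constant \<open>1 - |g|\<^sup>2\<close> comes from
  a minimization. After an invertible substitution the form reads
  \<open>|y|\<^sup>2 - |C y|\<^sup>2 + |x|\<^sup>2 + 2 Re (g <y, x>)\<close>, with \<open>y\<close>
  and \<open>x\<close> independent; its minimum over \<open>x\<close> is at
  \<open>x = - g y\<close>. The obstacle is strictness: the square roots and inverses in
  \<open>C\<close> call for values of norm less than 1, while a function may attain its supremum.
  Hence each function is divided by a number strictly above its supremum, and the extra margin tends
  to 0 at the end. The square root, the joint spectrum and the functional calculus are definite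
  descriptions, so each is usable only after existence and uniqueness have been established.\<close>

lemma l2_norm_nonneg [simp]: "0 \<le> l2_norm v"
  by (simp add: l2_norm_def)

section \<open>The Hermitian inner product and the Euclidean norm\<close>

lemma cinner_sum:
  "u \<in> carrier_vec n \<Longrightarrow> v \<in> carrier_vec n \<Longrightarrow> u \<bullet>c v = (\<Sum>i<n. u $ i * cnj (v $ i))"
  by (auto simp: scalar_prod_def atLeast0LessThan)

lemma cinner_self: "u \<bullet>c u = complex_of_real ((l2_norm u)\<^sup>2)"
proof -
  have "u \<bullet>c u = (\<Sum>i<dim_vec u. u $ i * cnj (u $ i))" by (rule cinner_sum) auto
  also have "\<dots> = complex_of_real ((l2_norm u)\<^sup>2)"
    by (simp add: l2_norm_def L2_set_def sum_nonneg complex_norm_square del: of_real_power)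
  finally show ?thesis .
qed

lemma l2_norm_sq_Re: "(l2_norm u)\<^sup>2 = Re (u \<bullet>c u)"
  by (simp add: cinner_self)

lemma cnj_cinner:
  "u \<in> carrier_vec n \<Longrightarrow> v \<in> carrier_vec n \<Longrightarrow> cnj (u \<bullet>c v) = v \<bullet>c u"
  by (simp add: cinner_sum mult.commute)

lemma cinner_add_left:
  fixes u :: "complex Matrix.vec"
  shows "u \<in> carrier_vec n \<Longrightarrow> v \<in> carrier_vec n \<Longrightarrow> x \<in> carrier_vec n \<Longrightarrow> (u + v) \<bullet>c x = u \<bullet>c x + v \<bullet>c x"
  by (rule add_scalar_prod_distrib) auto

lemma cinner_minus_left:
  fixes u :: "complex Matrix.vec"
  shows "u \<in> carrier_vec n \<Longrightarrow> v \<in> carrier_vec n \<Longrightarrow> x \<in> carrier_vec n \<Longrightarrow> (u - v) \<bullet>c x = u \<bullet>c x - v \<bullet>c x"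
  by (rule minus_scalar_prod_distrib) auto

lemma cinner_add_right:
  fixes u :: "complex Matrix.vec"
  shows "u \<in> carrier_vec n \<Longrightarrow> v \<in> carrier_vec n \<Longrightarrow> x \<in> carrier_vec n \<Longrightarrow> x \<bullet>c (u + v) = x \<bullet>c u + x \<bullet>c v"
  by (simp add: cinner_sum[of _ n] algebra_simps sum.distrib)

lemma cinner_minus_right:
  fixes u :: "complex Matrix.vec"
  shows "u \<in> carrier_vec n \<Longrightarrow> v \<in> carrier_vec n \<Longrightarrow> x \<in> carrier_vec n \<Longrightarrow> x \<bullet>c (u - v) = x \<bullet>c u - x \<bullet>c v"
  by (simp add: cinner_sum[of _ n] algebra_simps sum_subtractf)

lemma cinner_smult_left:
  fixes u :: "complex Matrix.vec"
  shows "u \<in> carrier_vec n \<Longrightarrow> x \<in> carrier_vec n \<Longrightarrow> (c \<cdot>\<^sub>v u) \<bullet>c x = c * (u \<bullet>c x)"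
  by (simp add: cinner_sum[of _ n] algebra_simps sum_distrib_left)

lemma cinner_smult_right:
  fixes u :: "complex Matrix.vec"
  shows "u \<in> carrier_vec n \<Longrightarrow> x \<in> carrier_vec n \<Longrightarrow> x \<bullet>c (c \<cdot>\<^sub>v u) = cnj c * (x \<bullet>c u)"
  by (simp add: cinner_sum[of _ n] algebra_simps sum_distrib_left)

lemma l2_norm_smult: "l2_norm (c \<cdot>\<^sub>v u) = cmod c * l2_norm u"
proof -
  have "l2_norm (c \<cdot>\<^sub>v u) = L2_set (\<lambda>i. cmod c * cmod (u $ i)) {..<dim_vec u}"
    unfolding l2_norm_def by (rule L2_set_cong) (auto simp: norm_mult)
  also have "\<dots> = cmod c * l2_norm u"
    by (simp add: l2_norm_def L2_set_right_distrib)
  finally show ?thesis .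
qed

lemma l2_norm_triangle:
  "u \<in> carrier_vec n \<Longrightarrow> v \<in> carrier_vec n \<Longrightarrow> l2_norm (u + v) \<le> l2_norm u + l2_norm v"
proof -
  assume c: "u \<in> carrier_vec n" "v \<in> carrier_vec n"
  have "l2_norm (u + v) \<le> L2_set (\<lambda>i. cmod (u $ i) + cmod (v $ i)) {..<n}"
    unfolding l2_norm_def using c by (auto intro!: L2_set_mono norm_triangle_ineq)
  also have "\<dots> \<le> l2_norm u + l2_norm v"
    unfolding l2_norm_def using c by (auto intro: L2_set_triangle_ineq)
  finally show ?thesis .
qed

lemma l2_norm_eq_0: "u \<in> carrier_vec n \<Longrightarrow> l2_norm u = 0 \<longleftrightarrow> u = 0\<^sub>v n"
  by (auto simp: l2_norm_def L2_set_eq_0_iff)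

lemma l2_norm_zero [simp]: "l2_norm (0\<^sub>v n) = 0"
  by (simp add: l2_norm_eq_0[of _ n])

lemma cinner_Cauchy_Schwarz:
  assumes "u \<in> carrier_vec n" "v \<in> carrier_vec n"
  shows "cmod (u \<bullet>c v) \<le> l2_norm u * l2_norm v"
proof -
  have "cmod (u \<bullet>c v) \<le> (\<Sum>i<n. \<bar>cmod (u $ i)\<bar> * \<bar>cmod (v $ i)\<bar>)"
    unfolding cinner_sum[OF assms] by (rule order_trans[OF norm_sum]) (simp add: norm_mult)
  also have "\<dots> \<le> l2_norm u * l2_norm v"
    using L2_set_mult_ineq[of "\<lambda>i. cmod (u $ i)" "\<lambda>i. cmod (v $ i)" "{..<n}"] assms by (auto simp: l2_norm_def)
  finally show ?thesis .
qed

lemma entry_le_l2_norm: "i < dim_vec v \<Longrightarrow> cmod (v $ i) \<le> l2_norm v"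
  unfolding l2_norm_def by (rule member_le_L2_set) auto

lemma l2_norm_unit [simp]: "i < n \<Longrightarrow> l2_norm (unit_vec n i) = 1"
proof -
  assume i: "i < n"
  have "(unit_vec n i :: complex Matrix.vec) \<bullet>c unit_vec n i = 1"
    using i by (subst cinner_sum[of _ n]) (auto simp: unit_vec_def if_distrib[of cnj] if_distrib[of "\<lambda>x. x * _"] cong: if_cong)
  then have "(l2_norm (unit_vec n i))\<^sup>2 = 1" by (simp add: l2_norm_sq_Re)
  then show ?thesis by (metis l2_norm_nonneg power2_eq_1_iff le_minus_one_simps(3))
qed

section \<open>Adjoint matrices\<close>

lemma dim_mat_adjoint [simp]: "dim_row (mat_adjoint A) = dim_col A" "dim_col (mat_adjoint A) = dim_row A"
  by (simp_all add: mat_adjoint_def)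

lemma mat_adjoint_carrier [simp]: "A \<in> carrier_mat m n \<Longrightarrow> mat_adjoint A \<in> carrier_mat n m"
  by (intro carrier_matI) auto

lemma mat_adjoint_index [simp]:
  "i < dim_col A \<Longrightarrow> j < dim_row A \<Longrightarrow> mat_adjoint A $$ (i, j) = cnj (A $$ (j, i))"
  by (simp add: mat_adjoint_def mat_of_rows_index)

lemma mat_adjoint_adjoint [simp]: "mat_adjoint (mat_adjoint A) = (A :: complex mat)"
  by (rule eq_matI) auto

lemma mult_mat_vec_sum:
  "A \<in> carrier_mat m n \<Longrightarrow> x \<in> carrier_vec n \<Longrightarrow> i < m \<Longrightarrow> (A *\<^sub>v x) $ i = (\<Sum>j<n. A $$ (i, j) * x $ j)"
  by (auto simp: scalar_prod_def atLeast0LessThan)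

lemma mult_mat_index_sum:
  "A \<in> carrier_mat m n \<Longrightarrow> B \<in> carrier_mat n p \<Longrightarrow> i < m \<Longrightarrow> j < p \<Longrightarrow>
    (A * B) $$ (i, j) = (\<Sum>k<n. A $$ (i, k) * B $$ (k, j))"
  by (auto simp: scalar_prod_def atLeast0LessThan)

lemma cinner_adjoint:
  fixes A :: "complex mat"
  assumes A: "A \<in> carrier_mat m n" and x: "x \<in> carrier_vec n" and y: "y \<in> carrier_vec m"
  shows "(A *\<^sub>v x) \<bullet>c y = x \<bullet>c (mat_adjoint A *\<^sub>v y)"
proof -
  have "(A *\<^sub>v x) \<bullet>c y = (\<Sum>i<m. \<Sum>j<n. A $$ (i, j) * x $ j * cnj (y $ i))"
    using assms by (subst cinner_sum[of _ m]) (auto simp: mult_mat_vec_sum sum_distrib_right simp del: index_mult_mat_vec)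
  also have "\<dots> = (\<Sum>j<n. \<Sum>i<m. A $$ (i, j) * x $ j * cnj (y $ i))"
    by (rule sum.swap)
  also have "\<dots> = (\<Sum>j<n. x $ j * cnj ((mat_adjoint A *\<^sub>v y) $ j))"
  proof (rule sum.cong[OF refl])
    fix j assume "j \<in> {..<n}"
    then have "(mat_adjoint A *\<^sub>v y) $ j = (\<Sum>i<m. cnj (A $$ (i, j)) * y $ i)"
      using A y by (subst mult_mat_vec_sum[of _ n m]) auto
    then show "(\<Sum>i<m. A $$ (i, j) * x $ j * cnj (y $ i)) = x $ j * cnj ((mat_adjoint A *\<^sub>v y) $ j)"
      by (simp add: sum_distrib_left mult_ac del: index_mult_mat_vec)
  qed
  also have "\<dots> = x \<bullet>c (mat_adjoint A *\<^sub>v y)"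
    using assms by (subst cinner_sum[of _ n]) (auto intro!: mult_mat_vec_carrier)
  finally show ?thesis .
qed

lemma cinner_adjoint2:
  fixes A :: "complex mat"
  assumes A: "A \<in> carrier_mat m n" and x: "x \<in> carrier_vec n" and y: "y \<in> carrier_vec m"
  shows "(mat_adjoint A *\<^sub>v y) \<bullet>c x = y \<bullet>c (A *\<^sub>v x)"
  using cinner_adjoint[of "mat_adjoint A" n m y x] assms by simp

lemma mat_adjoint_minus:
  "A \<in> carrier_mat m n \<Longrightarrow> B \<in> carrier_mat m n \<Longrightarrow> mat_adjoint (A - B) = mat_adjoint A - mat_adjoint (B :: complex mat)"
  by (rule eq_matI) auto

lemma mat_adjoint_one [simp]: "mat_adjoint (1\<^sub>m n) = (1\<^sub>m n :: complex mat)"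
  by (rule eq_matI) auto

lemma mat_adjoint_mult:
  "A \<in> carrier_mat m n \<Longrightarrow> B \<in> carrier_mat n p \<Longrightarrow> mat_adjoint (A * B) = mat_adjoint B * mat_adjoint (A :: complex mat)"
  by (rule eq_matI) (auto simp: scalar_prod_def mult.commute)

lemma mat_eqI_vec:
  assumes "A \<in> carrier_mat m n" "B \<in> carrier_mat m n"
    and "\<And>x. x \<in> carrier_vec n \<Longrightarrow> A *\<^sub>v x = B *\<^sub>v (x :: complex Matrix.vec)"
  shows "A = B"
proof (rule eq_matI)
  fix i j assume ij: "i < dim_row B" "j < dim_col B"
  have "A *\<^sub>v unit_vec n j = B *\<^sub>v unit_vec n j" by (rule assms) auto
  then have "(A *\<^sub>v unit_vec n j) $ i = (B *\<^sub>v unit_vec n j) $ i" by simp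
  then show "A $$ (i, j) = B $$ (i, j)"
    using ij assms(1,2) by (auto simp: row_def)
qed (use assms in auto)

text \<open>\<open>op_norm\<close> is a real supremum, so its value carries information only once
  this set is bounded; the sum of the moduli of all entries is a crude bound.\<close>

lemma op_norm_bdd_above:
  "bdd_above {l2_norm (A *\<^sub>v x) | x. x \<in> carrier_vec (dim_col A) \<and> l2_norm x \<le> 1}"
proof (rule bdd_aboveI)
  fix t assume "t \<in> {l2_norm (A *\<^sub>v x) | x. x \<in> carrier_vec (dim_col A) \<and> l2_norm x \<le> 1}"
  then obtain x where x: "x \<in> carrier_vec (dim_col A)" "l2_norm x \<le> 1" "t = l2_norm (A *\<^sub>v x)" by auto
  have "t \<le> (\<Sum>i<dim_row A. cmod ((A *\<^sub>v x) $ i))"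
    unfolding x l2_norm_def by (rule order_trans[OF L2_set_le_sum]) auto
  also have "\<dots> \<le> (\<Sum>i<dim_row A. \<Sum>j<dim_col A. cmod (A $$ (i, j)))"
  proof (rule sum_mono)
    fix i assume i: "i \<in> {..<dim_row A}"
    have "cmod ((A *\<^sub>v x) $ i) \<le> (\<Sum>j<dim_col A. cmod (A $$ (i, j)) * cmod (x $ j))"
      using i x by (subst mult_mat_vec_sum[of _ "dim_row A" "dim_col A"])
         (auto intro!: sum_norm_le simp: norm_mult)
    also have "\<dots> \<le> (\<Sum>j<dim_col A. cmod (A $$ (i, j)) * 1)"
      using x by (intro sum_mono mult_left_mono) (auto intro!: order_trans[OF entry_le_l2_norm])
    finally show "cmod ((A *\<^sub>v x) $ i) \<le> (\<Sum>j<dim_col A. cmod (A $$ (i, j)))" by simp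
  qed
  finally show "t \<le> (\<Sum>i<dim_row A. \<Sum>j<dim_col A. cmod (A $$ (i, j)))" .
qed

lemma op_norm_nonneg [simp]: "0 \<le> op_norm A"
  unfolding op_norm_def
proof (rule cSup_upper2[OF _ l2_norm_nonneg op_norm_bdd_above])
  show "l2_norm (A *\<^sub>v 0\<^sub>v (dim_col A)) \<in> {l2_norm (A *\<^sub>v x) | x. x \<in> carrier_vec (dim_col A) \<and> l2_norm x \<le> 1}"
    by (auto intro!: exI[of _ "0\<^sub>v (dim_col A)"])
qed

lemma op_norm_bound:
  assumes "A \<in> carrier_mat m n" "x \<in> carrier_vec n"
  shows "l2_norm (A *\<^sub>v x) \<le> op_norm A * l2_norm x"
proof (cases "l2_norm x = 0")
  case True
  then have "x = 0\<^sub>v n" using assms l2_norm_eq_0 by blast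
  moreover have "A *\<^sub>v 0\<^sub>v n = 0\<^sub>v m" using assms by (intro eq_vecI) auto
  ultimately show ?thesis by simp
next
  case False
  define c where "c = complex_of_real (1 / l2_norm x)"
  have pos: "0 < l2_norm x" using False l2_norm_nonneg[of x] by linarith
  have c: "cmod c = 1 / l2_norm x" using pos by (simp add: c_def norm_divide)
  have "l2_norm (A *\<^sub>v (c \<cdot>\<^sub>v x)) \<le> op_norm A"
    unfolding op_norm_def
    by (rule cSup_upper[OF _ op_norm_bdd_above])
       (use assms c pos in \<open>auto intro!: exI[of _ "c \<cdot>\<^sub>v x"] simp: l2_norm_smult\<close>)
  also have "A *\<^sub>v (c \<cdot>\<^sub>v x) = c \<cdot>\<^sub>v (A *\<^sub>v x)" by (rule mult_mat_vec[OF assms])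
  finally show ?thesis using pos by (simp add: l2_norm_smult c divide_le_eq)
qed

lemma op_norm_leI:
  assumes "A \<in> carrier_mat m n" "0 \<le> c"
    and "\<And>x. x \<in> carrier_vec n \<Longrightarrow> l2_norm (A *\<^sub>v x) \<le> c * l2_norm x"
  shows "op_norm A \<le> c"
  unfolding op_norm_def
proof (rule cSup_least)
  show "{l2_norm (A *\<^sub>v x) |x. x \<in> carrier_vec (dim_col A) \<and> l2_norm x \<le> 1} \<noteq> {}"
    by (auto intro!: exI[of _ "0\<^sub>v (dim_col A)"])
  fix t assume "t \<in> {l2_norm (A *\<^sub>v x) |x. x \<in> carrier_vec (dim_col A) \<and> l2_norm x \<le> 1}"
  then obtain x where x: "x \<in> carrier_vec n" "l2_norm x \<le> 1" "t = l2_norm (A *\<^sub>v x)" using assms by auto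
  then have "t \<le> c * l2_norm x" using assms by auto
  also have "\<dots> \<le> c * 1" using x assms by (intro mult_left_mono) auto
  finally show "t \<le> c" by simp
qed

text \<open>With \<open>A'\<close> for the adjoint,
  \<open>|A' y|\<^sup>2 = <y, A A' y> \<le> |y| |A| |A' y|\<close>, and one factor
  \<open>|A' y|\<close> cancels. It makes \<open>mat_adjoint B\<close> a strict contraction whenever
  \<open>B\<close> is one.\<close>

lemma op_norm_adjoint_le: "op_norm (mat_adjoint A) \<le> op_norm (A :: complex mat)"
proof (rule op_norm_leI[of _ "dim_col A" "dim_row A"])
  fix y :: "complex Matrix.vec" assume y: "y \<in> carrier_vec (dim_row A)"
  let ?z = "mat_adjoint A *\<^sub>v y"
  have z: "?z \<in> carrier_vec (dim_col A)" by (rule carrier_vecI) simp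
  have Az: "A *\<^sub>v ?z \<in> carrier_vec (dim_row A)" by (rule carrier_vecI) simp
  have "(l2_norm ?z)\<^sup>2 = Re (y \<bullet>c (A *\<^sub>v ?z))"
    unfolding l2_norm_sq_Re
    by (rule arg_cong[of _ _ Re], rule cinner_adjoint2[OF _ z y]) auto
  also have "\<dots> \<le> l2_norm y * l2_norm (A *\<^sub>v ?z)"
    by (rule order_trans[OF complex_Re_le_cmod cinner_Cauchy_Schwarz[OF y Az]])
  also have "\<dots> \<le> l2_norm y * (op_norm A * l2_norm ?z)"
    by (intro mult_left_mono op_norm_bound[OF _ z]) auto
  finally have "l2_norm ?z * l2_norm ?z \<le> (op_norm A * l2_norm y) * l2_norm ?z"
    by (simp add: power2_eq_square mult_ac)
  then show "l2_norm ?z \<le> op_norm A * l2_norm y"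
    by (smt (verit) l2_norm_nonneg mult_le_cancel_right mult_nonneg_nonneg op_norm_nonneg)
qed auto

lemma op_norm_mult_le:
  assumes "A \<in> carrier_mat m n" "B \<in> carrier_mat n p"
  shows "op_norm (A * B) \<le> op_norm A * op_norm B"
proof (rule op_norm_leI[of _ m p])
  fix x :: "complex Matrix.vec" assume x: "x \<in> carrier_vec p"
  have "l2_norm (A *\<^sub>v (B *\<^sub>v x)) \<le> op_norm A * (op_norm B * l2_norm x)"
    using op_norm_bound[OF assms(1), of "B *\<^sub>v x"] op_norm_bound[OF assms(2) x] assms x
    by (smt (verit) mult_left_mono mult_mat_vec_carrier op_norm_nonneg)
  then show "l2_norm (A * B *\<^sub>v x) \<le> op_norm A * op_norm B * l2_norm x"
    using assms x by (simp add: mult.assoc)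
qed (use assms in auto)

lemma op_norm_triangle:
  assumes "A \<in> carrier_mat m n" "B \<in> carrier_mat m n"
  shows "op_norm (A + B) \<le> op_norm A + op_norm B"
proof (rule op_norm_leI[of _ m n])
  fix x :: "complex Matrix.vec" assume x: "x \<in> carrier_vec n"
  have "l2_norm (A *\<^sub>v x + B *\<^sub>v x) \<le> op_norm A * l2_norm x + op_norm B * l2_norm x"
    by (rule order_trans[OF l2_norm_triangle[of _ m]])
       (use assms x in \<open>auto intro!: add_mono op_norm_bound mult_mat_vec_carrier\<close>)
  then show "l2_norm ((A + B) *\<^sub>v x) \<le> (op_norm A + op_norm B) * l2_norm x"
    using assms x by (simp add: add_mult_distrib_mat_vec distrib_right)
qed (use assms in auto)

lemma op_norm_smult_le: "op_norm (c \<cdot>\<^sub>m A) \<le> cmod c * op_norm A"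
proof (rule op_norm_leI[of _ "dim_row A" "dim_col A"])
  fix x :: "complex Matrix.vec" assume x: "x \<in> carrier_vec (dim_col A)"
  have "(c \<cdot>\<^sub>m A) *\<^sub>v x = c \<cdot>\<^sub>v (A *\<^sub>v x)"
    using x by (intro eq_vecI) auto
  then show "l2_norm ((c \<cdot>\<^sub>m A) *\<^sub>v x) \<le> cmod c * op_norm A * l2_norm x"
    using op_norm_bound[OF _ x, of A "dim_row A"] by (simp add: l2_norm_smult mult.assoc mult_left_mono)
qed auto

text \<open>Lets geometric decay in norm of the square root iteration be read off as convergence of
  each entry.\<close>

lemma entry_le_op_norm:
  assumes "i < dim_row A" "j < dim_col A"
  shows "cmod (A $$ (i, j)) \<le> op_norm A"
proof -
  have "A $$ (i, j) = (A *\<^sub>v unit_vec (dim_col A) j) $ i" using assms by (simp add: row_def)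
  also have "cmod \<dots> \<le> l2_norm (A *\<^sub>v unit_vec (dim_col A) j)" using assms by (intro entry_le_l2_norm) auto
  also have "\<dots> \<le> op_norm A * l2_norm (unit_vec (dim_col A) j)" by (rule op_norm_bound) auto
  finally show ?thesis using assms by simp
qed

lemma op_norm_le_sum_entries: "op_norm A \<le> (\<Sum>i<dim_row A. \<Sum>j<dim_col A. cmod (A $$ (i, j)))"
proof (rule op_norm_leI[of _ "dim_row A" "dim_col A"])
  fix x :: "complex Matrix.vec" assume x: "x \<in> carrier_vec (dim_col A)"
  have "l2_norm (A *\<^sub>v x) \<le> (\<Sum>i<dim_row A. cmod ((A *\<^sub>v x) $ i))"
    unfolding l2_norm_def by (rule order_trans[OF L2_set_le_sum]) auto
  also have "\<dots> \<le> (\<Sum>i<dim_row A. \<Sum>j<dim_col A. cmod (A $$ (i, j)) * l2_norm x)"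
  proof (rule sum_mono)
    fix i assume i: "i \<in> {..<dim_row A}"
    have "cmod ((A *\<^sub>v x) $ i) \<le> (\<Sum>j<dim_col A. cmod (A $$ (i, j)) * cmod (x $ j))"
      using i x by (subst mult_mat_vec_sum[of _ "dim_row A" "dim_col A"])
         (auto intro!: sum_norm_le simp: norm_mult)
    also have "\<dots> \<le> (\<Sum>j<dim_col A. cmod (A $$ (i, j)) * l2_norm x)"
      using x by (intro sum_mono mult_left_mono) (auto intro!: entry_le_l2_norm)
    finally show "cmod ((A *\<^sub>v x) $ i) \<le> (\<Sum>j<dim_col A. cmod (A $$ (i, j)) * l2_norm x)" .
  qed
  finally show "l2_norm (A *\<^sub>v x) \<le> (\<Sum>i<dim_row A. \<Sum>j<dim_col A. cmod (A $$ (i, j))) * l2_norm x"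
    by (simp add: sum_distrib_right)
qed (auto intro!: sum_nonneg)

section \<open>Square roots of positive definite matrices\<close>

text \<open>A trivial kernel forces a nonzero determinant, so \<open>mat_inverse\<close> returns
  \<open>Some\<close> and the \<open>the\<close> in \<open>mat_inv\<close> selects a genuine
  inverse.\<close>

lemma mat_inv_of_injective:
  assumes A: "A \<in> carrier_mat n n" and inj: "\<And>x. x \<in> carrier_vec n \<Longrightarrow> A *\<^sub>v x = 0\<^sub>v n \<Longrightarrow> x = 0\<^sub>v n"
  shows "mat_inv A \<in> carrier_mat n n" "A * mat_inv A = 1\<^sub>m n" "mat_inv A * A = 1\<^sub>m n"
proof -
  have "det A \<noteq> 0" using det_0_iff_vec_prod_zero_field[OF A] inj by auto
  then have "A \<in> Units (ring_mat TYPE(complex) n undefined)" by (rule det_non_zero_imp_unit[OF A])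
  then obtain B where B: "mat_inverse A = Some B" using mat_inverse(1)[OF A] by fastforce
  with mat_inverse(2)[OF A B] show "mat_inv A \<in> carrier_mat n n" "A * mat_inv A = 1\<^sub>m n" "mat_inv A * A = 1\<^sub>m n"
    by (auto simp: mat_inv_def)
qed

text \<open>A kernel vector satisfies \<open>x = X x\<close>, hence \<open>|x| \<le> |X| |x|\<close>
  with \<open>|X| < 1\<close>. Injectivity suffices for invertibility here, in place of a Neumann
  series.\<close>

lemma one_minus_injective:
  assumes X: "X \<in> carrier_mat n n" and n: "op_norm X < 1"
    and x: "x \<in> carrier_vec n" and 0: "(1\<^sub>m n - X) *\<^sub>v x = 0\<^sub>v n"
  shows "x = 0\<^sub>v n"
proof -
  have 1: "x - X *\<^sub>v x = 0\<^sub>v n" using 0 X x by (simp add: minus_mult_distrib_mat_vec[of "1\<^sub>m n" n n])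
  have "x = X *\<^sub>v x"
  proof (rule eq_vecI)
    fix i assume "i < dim_vec (X *\<^sub>v x)"
    then have "i < n" using X by simp
    moreover from this have "(x - X *\<^sub>v x) $ i = 0" unfolding 1 by simp
    ultimately show "x $ i = (X *\<^sub>v x) $ i" using X x by (simp del: index_mult_mat_vec)
  qed (use X x in auto)
  then have "l2_norm x \<le> op_norm X * l2_norm x" using op_norm_bound[OF X x] by metis
  then have "(1 - op_norm X) * l2_norm x \<le> 0" by (simp add: left_diff_distrib)
  then have "l2_norm x = 0"
    using n l2_norm_nonneg[of x] by (simp add: mult_le_0_iff)
  then show ?thesis using x l2_norm_eq_0 by blast
qed

lemma tendsto_mult_mat_entry:
  assumes "\<And>k. Y k \<in> carrier_mat m n" "\<And>k. Z k \<in> carrier_mat n p" "L \<in> carrier_mat m n" "M \<in> carrier_mat n p"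
    and "\<And>i j. i < m \<Longrightarrow> j < n \<Longrightarrow> (\<lambda>k. Y k $$ (i, j)) \<longlonglongrightarrow> L $$ (i, j)"
    and "\<And>i j. i < n \<Longrightarrow> j < p \<Longrightarrow> (\<lambda>k. Z k $$ (i, j)) \<longlonglongrightarrow> M $$ (i, j)"
    and ij: "i < m" "j < p"
  shows "(\<lambda>k. (Y k * Z k) $$ (i, j)) \<longlonglongrightarrow> ((L * M) $$ (i, j) :: complex)"
  unfolding mult_mat_index_sum[OF assms(1,2) ij] mult_mat_index_sum[OF assms(3,4) ij]
  using ij by (auto intro!: tendsto_sum tendsto_mult assms)

text \<open>For a fixed vector \<open>x\<close> the norm of \<open>Y k *\<^sub>v x\<close> is a
  continuous function of the entries, so the bound \<open>b * l2_norm x\<close> passes to the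
  limit.\<close>

lemma op_norm_le_limit:
  assumes Y: "\<And>k. Y k \<in> carrier_mat m n" and L: "L \<in> carrier_mat m n"
    and lim: "\<And>i j. i < m \<Longrightarrow> j < n \<Longrightarrow> (\<lambda>k. Y k $$ (i, j)) \<longlonglongrightarrow> L $$ (i, j)"
    and b: "\<And>k. op_norm (Y k) \<le> b"
  shows "op_norm L \<le> b"
proof (rule op_norm_leI[OF L])
  show "0 \<le> b" using b[of 0] op_norm_nonneg[of "Y 0"] by linarith
  fix x :: "complex Matrix.vec" assume x: "x \<in> carrier_vec n"
  have "(\<lambda>k. (Y k *\<^sub>v x) $ i) \<longlonglongrightarrow> (L *\<^sub>v x) $ i" if "i < m" for i
    unfolding mult_mat_vec_sum[OF Y x that] mult_mat_vec_sum[OF L x that]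
    using that by (auto intro!: tendsto_sum tendsto_mult lim)
  then have "(\<lambda>k. L2_set (\<lambda>i. cmod ((Y k *\<^sub>v x) $ i)) {..<m}) \<longlonglongrightarrow> L2_set (\<lambda>i. cmod ((L *\<^sub>v x) $ i)) {..<m}"
    unfolding L2_set_def by (intro tendsto_real_sqrt tendsto_sum tendsto_power tendsto_norm) auto
  moreover have "dim_row (Y k) = m" "dim_row L = m" for k using Y[of k] L by auto
  ultimately have "(\<lambda>k. l2_norm (Y k *\<^sub>v x)) \<longlonglongrightarrow> l2_norm (L *\<^sub>v x)"
    unfolding l2_norm_def by simp
  moreover have "l2_norm (Y k *\<^sub>v x) \<le> b * l2_norm x" for k
    by (rule order_trans[OF op_norm_bound[OF Y x] mult_right_mono[OF b]]) simp
  ultimately show "l2_norm (L *\<^sub>v x) \<le> b * l2_norm x"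
    by (intro LIMSEQ_le_const2) auto
qed

text \<open>If \<open>L = (X + L\<^sup>2) / 2\<close> then \<open>(1 - L)\<^sup>2 = 1 - X\<close>; the fixed point is found by iteration.\<close>

lemma sqrt_fixed_point:
  assumes X: "X \<in> carrier_mat n n" and herm: "mat_adjoint X = X"
    and b: "op_norm X \<le> b\<^sup>2" "0 \<le> b" "b < 1"
  obtains L where "L \<in> carrier_mat n n" "mat_adjoint L = L" "op_norm L \<le> b"
    "L = (1 / 2) \<cdot>\<^sub>m (X + L * L)"
proof -
  define \<Phi> where "\<Phi> Y = (1 / 2) \<cdot>\<^sub>m (X + Y * Y)" for Y :: "complex mat"
  define Y where "Y k = (\<Phi> ^^ k) (0\<^sub>m n n)" for k
  have Y0: "Y 0 = 0\<^sub>m n n" and YS: "Y (Suc k) = (1 / 2) \<cdot>\<^sub>m (X + Y k * Y k)" for k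
    by (simp_all add: Y_def \<Phi>_def)
  have Yc: "Y k \<in> carrier_mat n n" for k
    by (induction k) (use X in \<open>auto simp: Y0 YS\<close>)
  have [simp]: "dim_row (Y k) = n" "dim_col (Y k) = n" "dim_row X = n" "dim_col X = n" for k
    using Yc[of k] X by auto
  have Yh: "mat_adjoint (Y k) = Y k" for k
  proof (induction k)
    case 0 show ?case by (rule eq_matI) (auto simp: Y0)
  next
    case (Suc k)
    have YY: "mat_adjoint (Y k * Y k) = Y k * Y k" by (simp add: mat_adjoint_mult[OF Yc Yc] Suc)
    show ?case
    proof (rule eq_matI)
      fix i j assume ij: "i < dim_row (Y (Suc k))" "j < dim_col (Y (Suc k))"
      have "cnj (X $$ (j, i)) = X $$ (i, j)"
        using arg_cong[OF herm, of "\<lambda>A. A $$ (i, j)"] ij by simp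
      moreover have "cnj ((Y k * Y k) $$ (j, i)) = (Y k * Y k) $$ (i, j)"
        using arg_cong[OF YY, of "\<lambda>A. A $$ (i, j)"] ij by (simp del: index_mult_mat(1))
      ultimately show "mat_adjoint (Y (Suc k)) $$ (i, j) = Y (Suc k) $$ (i, j)"
        using ij by (simp add: YS del: index_mult_mat(1))
    qed auto
  qed
  \<comment> \<open>The iteration stays in the ball of radius \<open>b\<close> because
    \<open>(b\<^sup>2 + b\<^sup>2) / 2 = b\<^sup>2 \<le> b\<close>. On that ball it contracts by the
    factor \<open>b\<close>, which is the next estimate.\<close>
  have Yb: "op_norm (Y k) \<le> b" for k
  proof (induction k)
    case 0
    have "op_norm (0\<^sub>m n n :: complex mat) \<le> b"
      by (rule order_trans[OF op_norm_le_sum_entries]) (use b in simp)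
    then show ?case by (simp add: Y0)
  next
    case (Suc k)
    have "op_norm (Y (Suc k)) \<le> 1 / 2 * op_norm (X + Y k * Y k)"
      using op_norm_smult_le[of "1 / 2" "X + Y k * Y k"] by (simp add: YS)
    also have "op_norm (X + Y k * Y k) \<le> op_norm X + op_norm (Y k) * op_norm (Y k)"
      using op_norm_triangle[OF X mult_carrier_mat[OF Yc Yc], of k k] op_norm_mult_le[OF Yc Yc, of k k]
      by linarith
    also have "op_norm (Y k) * op_norm (Y k) \<le> b * b" using Suc b by (intro mult_mono) auto
    also have "1 / 2 * (op_norm X + b * b) \<le> b * b" using b by (simp add: power2_eq_square)
    also have "b * b \<le> b" using b by (simp add: mult_left_le)
    finally show ?case by simp
  qed
  have diff: "op_norm (Y (Suc k) - Y k) \<le> b ^ k * b" for k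
  proof (induction k)
    case 0
    have "Y (Suc 0) - Y 0 = Y (Suc 0)"
      unfolding Y0 by (rule eq_matI) simp_all
    then have "op_norm (Y (Suc 0) - Y 0) \<le> b" using Yb[of "Suc 0"] by (simp only:)
    then show ?case by (simp only: power_0 mult_1)
  next
    case (Suc k)
    let ?Z = "Y (Suc k)" and ?Y = "Y k"
    have Dc: "?Z - ?Y \<in> carrier_mat n n" by (rule minus_carrier_mat[OF Yc])
    have 1: "?Z * (?Z - ?Y) = ?Z * ?Z - ?Z * ?Y" "(?Z - ?Y) * ?Y = ?Z * ?Y - ?Y * ?Y"
      by (rule mult_minus_distrib_mat[OF Yc Yc Yc], rule minus_mult_distrib_mat[OF Yc Yc Yc])
    \<comment> \<open>The difference of squares is split as \<open>Z (Z - Y) + (Z - Y) Y\<close>, an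
      identity that holds without commutativity.\<close>
    have "Y (Suc (Suc k)) - ?Z = (1 / 2) \<cdot>\<^sub>m (?Z * (?Z - ?Y) + (?Z - ?Y) * ?Y)"
      unfolding 1 unfolding YS[of "Suc k"]
    proof (rule eq_matI)
      fix i j
      assume "i < dim_row ((1 / 2) \<cdot>\<^sub>m (?Z * ?Z - ?Z * ?Y + (?Z * ?Y - ?Y * ?Y)))"
        "j < dim_col ((1 / 2) \<cdot>\<^sub>m (?Z * ?Z - ?Z * ?Y + (?Z * ?Y - ?Y * ?Y)))"
      then have ij: "i < n" "j < n" by auto
      have "?Z $$ (i, j) = 1 / 2 * (X $$ (i, j) + (?Y * ?Y) $$ (i, j))"
        unfolding YS using ij by (simp del: index_mult_mat(1))
      moreover have "((1 / 2) \<cdot>\<^sub>m (X + ?Z * ?Z)) $$ (i, j) = 1 / 2 * (X $$ (i, j) + (?Z * ?Z) $$ (i, j))"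
        using ij by (simp del: index_mult_mat(1))
      moreover have "((1 / 2) \<cdot>\<^sub>m (?Z * ?Z - ?Z * ?Y + (?Z * ?Y - ?Y * ?Y))) $$ (i, j) =
          1 / 2 * ((?Z * ?Z) $$ (i, j) - (?Y * ?Y) $$ (i, j))"
        using ij by (simp del: index_mult_mat(1))
      moreover have "((1 / 2) \<cdot>\<^sub>m (X + ?Z * ?Z) - ?Z) $$ (i, j) =
          ((1 / 2) \<cdot>\<^sub>m (X + ?Z * ?Z)) $$ (i, j) - ?Z $$ (i, j)"
        using ij by (intro index_minus_mat) auto
      ultimately show "((1 / 2) \<cdot>\<^sub>m (X + ?Z * ?Z) - ?Z) $$ (i, j) =
          ((1 / 2) \<cdot>\<^sub>m (?Z * ?Z - ?Z * ?Y + (?Z * ?Y - ?Y * ?Y))) $$ (i, j)"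
        by (simp only: right_diff_distrib distrib_left) simp
    qed auto
    then have "op_norm (Y (Suc (Suc k)) - ?Z) \<le> 1 / 2 * op_norm (?Z * (?Z - ?Y) + (?Z - ?Y) * ?Y)"
      using op_norm_smult_le[of "1 / 2" "?Z * (?Z - ?Y) + (?Z - ?Y) * ?Y"] by simp
    also have "\<dots> \<le> 1 / 2 * (op_norm ?Z * op_norm (?Z - ?Y) + op_norm (?Z - ?Y) * op_norm ?Y)"
      using op_norm_triangle[OF mult_carrier_mat[OF Yc Dc] mult_carrier_mat[OF Dc Yc], of "Suc k" k]
        op_norm_mult_le[OF Yc Dc, of "Suc k"] op_norm_mult_le[OF Dc Yc, of k]
      by (intro mult_left_mono) auto
    also have "op_norm ?Z * op_norm (?Z - ?Y) + op_norm (?Z - ?Y) * op_norm ?Y \<le>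
        b * op_norm (?Z - ?Y) + op_norm (?Z - ?Y) * b"
      by (intro add_mono mult_left_mono mult_right_mono Yb) auto
    also have "1 / 2 * (b * op_norm (?Z - ?Y) + op_norm (?Z - ?Y) * b) = b * op_norm (?Z - ?Y)" by simp
    also have "\<dots> \<le> b * (b ^ k * b)" using Suc b by (intro mult_left_mono) auto
    finally show ?case by (simp add: mult_ac)
  qed
  have conv: "convergent (\<lambda>k. Y k $$ (i, j))" if ij: "i < n" "j < n" for i j
  proof -
    \<comment> \<open>The increments are dominated by a geometric series, and their partial sums
      telescope to \<open>Y m - Y 0\<close>.\<close>
    have "summable (\<lambda>k. Y (Suc k) $$ (i, j) - Y k $$ (i, j))"
    proof (rule summable_comparison_test')
      show "summable (\<lambda>k. b ^ k * b)" using b by (intro summable_mult2 summable_geometric) auto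
      fix k :: nat
      have "cmod ((Y (Suc k) - Y k) $$ (i, j)) \<le> op_norm (Y (Suc k) - Y k)"
        using ij by (intro entry_le_op_norm) auto
      then show "cmod (Y (Suc k) $$ (i, j) - Y k $$ (i, j)) \<le> b ^ k * b"
        using diff[of k] ij by simp
    qed
    then have "convergent (\<lambda>m. \<Sum>k<m. Y (Suc k) $$ (i, j) - Y k $$ (i, j))"
      by (simp add: summable_iff_convergent)
    moreover have "(\<lambda>m. \<Sum>k<m. Y (Suc k) $$ (i, j) - Y k $$ (i, j)) = (\<lambda>m. Y m $$ (i, j) - Y 0 $$ (i, j))"
      by (rule ext) (rule sum_lessThan_telescope)
    ultimately have "convergent (\<lambda>m. (Y m $$ (i, j) - Y 0 $$ (i, j)) + Y 0 $$ (i, j))"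
      by (intro convergent_add convergent_const) (simp only:)
    then show ?thesis by simp
  qed
  define L where "L = mat n n (\<lambda>(i, j). lim (\<lambda>k. Y k $$ (i, j)))"
  have Lc: "L \<in> carrier_mat n n" by (simp add: L_def)
  have [simp]: "dim_row L = n" "dim_col L = n" by (simp_all add: L_def)
  have lim: "(\<lambda>k. Y k $$ (i, j)) \<longlonglongrightarrow> L $$ (i, j)" if "i < n" "j < n" for i j
    using conv[OF that] that by (simp add: L_def convergent_LIMSEQ_iff)
  have Lh: "mat_adjoint L = L"
  proof (rule eq_matI)
    fix i j assume "i < dim_row L" "j < dim_col L"
    then have ij: "i < n" "j < n" by auto
    have "cnj (Y k $$ (j, i)) = Y k $$ (i, j)" for k
      using arg_cong[OF Yh[of k], of "\<lambda>A. A $$ (i, j)"] ij by simp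
    then have "(\<lambda>k. Y k $$ (i, j)) \<longlonglongrightarrow> cnj (L $$ (j, i))"
      using tendsto_cnj[OF lim[OF ij(2,1)]] by simp
    then show "mat_adjoint L $$ (i, j) = L $$ (i, j)"
      using LIMSEQ_unique[OF lim[OF ij]] ij by simp
  qed auto
  have Lfix: "L = (1 / 2) \<cdot>\<^sub>m (X + L * L)"
  proof (rule eq_matI)
    fix i j assume "i < dim_row ((1 / 2) \<cdot>\<^sub>m (X + L * L))" "j < dim_col ((1 / 2) \<cdot>\<^sub>m (X + L * L))"
    then have ij: "i < n" "j < n" by auto
    have "(\<lambda>k. 1 / 2 * (X $$ (i, j) + (Y k * Y k) $$ (i, j))) \<longlonglongrightarrow> 1 / 2 * (X $$ (i, j) + (L * L) $$ (i, j))"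
      by (intro tendsto_mult tendsto_add tendsto_const tendsto_mult_mat_entry[OF Yc Yc Lc Lc lim lim ij])
    moreover have "Y (Suc k) $$ (i, j) = 1 / 2 * (X $$ (i, j) + (Y k * Y k) $$ (i, j))" for k
      unfolding YS using ij by (simp del: index_mult_mat(1))
    ultimately have "(\<lambda>k. Y (Suc k) $$ (i, j)) \<longlonglongrightarrow> 1 / 2 * (X $$ (i, j) + (L * L) $$ (i, j))"
      by (simp only:)
    moreover have "(\<lambda>k. Y (Suc k) $$ (i, j)) \<longlonglongrightarrow> L $$ (i, j)"
      using lim[OF ij] by (rule LIMSEQ_Suc)
    ultimately have "L $$ (i, j) = 1 / 2 * (X $$ (i, j) + (L * L) $$ (i, j))"
      using LIMSEQ_unique by blast
    then show "L $$ (i, j) = ((1 / 2) \<cdot>\<^sub>m (X + L * L)) $$ (i, j)"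
      using ij by (simp del: index_mult_mat(1))
  qed auto
  show thesis
    using that[OF Lc Lh op_norm_le_limit[OF Yc Lc lim Yb] Lfix] .
qed

text \<open>The diagonal sums are traces; this is the identity
  \<open>tr (P Q) = tr (Q P)\<close>.\<close>

lemma sum_diag_mult_commute:
  assumes "P \<in> carrier_mat m n" "Q \<in> carrier_mat n m"
  shows "(\<Sum>i<m. (P * Q) $$ (i, i)) = (\<Sum>i<n. (Q * P) $$ (i, i) :: complex)"
proof -
  have "(\<Sum>i<m. (P * Q) $$ (i, i)) = (\<Sum>i<m. \<Sum>k<n. P $$ (i, k) * Q $$ (k, i))"
    by (rule sum.cong[OF refl], subst mult_mat_index_sum[OF assms]) auto
  also have "\<dots> = (\<Sum>k<n. \<Sum>i<m. Q $$ (k, i) * P $$ (i, k))"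
    by (subst sum.swap) (simp add: mult.commute)
  also have "\<dots> = (\<Sum>i<n. (Q * P) $$ (i, i))"
    by (rule sum.cong[OF refl], subst mult_mat_index_sum[OF assms(2,1)]) auto
  finally show ?thesis .
qed

text \<open>Turns the trace of \<open>D S D\<close> into a sum of values of the quadratic form of
  \<open>S\<close> at the columns of \<open>D\<close>, whose sign semidefiniteness controls.\<close>

lemma diag_entry_congruence:
  fixes D :: "complex mat"
  assumes D: "D \<in> carrier_mat n n" "mat_adjoint D = D" and S: "S \<in> carrier_mat n n" and i: "i < n"
  shows "(D * (S * D)) $$ (i, i) = (S *\<^sub>v (D *\<^sub>v unit_vec n i)) \<bullet>c (D *\<^sub>v unit_vec n i)"
proof -
  let ?e = "unit_vec n i :: complex Matrix.vec"
  have e: "?e \<in> carrier_vec n" by simp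
  have De: "D *\<^sub>v ?e \<in> carrier_vec n" "S *\<^sub>v (D *\<^sub>v ?e) \<in> carrier_vec n" using D S by auto
  have "(D * (S * D)) $$ (i, i) = ((D * (S * D)) *\<^sub>v ?e) $ i"
    using D S i by (simp add: row_def del: assoc_mult_mat_vec)
  also have "(D * (S * D)) *\<^sub>v ?e = D *\<^sub>v (S *\<^sub>v (D *\<^sub>v ?e))"
    unfolding assoc_mult_mat_vec[OF D(1) mult_carrier_mat[OF S D(1)] e] assoc_mult_mat_vec[OF S D(1) e] ..
  also have "\<dots> $ i = (D *\<^sub>v (S *\<^sub>v (D *\<^sub>v ?e))) \<bullet>c ?e"
    using D S i by (subst cinner_sum[of _ n])
      (auto simp: unit_vec_def if_distrib[of cnj] if_distrib[of "\<lambda>x. _ * x"] simp del: index_mult_mat_vec intro!: mult_mat_vec_carrier cong: if_cong)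
  also have "\<dots> = (S *\<^sub>v (D *\<^sub>v ?e)) \<bullet>c (D *\<^sub>v ?e)"
    using cinner_adjoint[OF D(1) De(2) e] D(2) by simp
  finally show ?thesis .
qed

text \<open>With \<open>D = R - S\<close> one has \<open>R D = - D S\<close>, so the nonnegative traces of \<open>D R D\<close> and \<open>D S D\<close>
  add up to \<open>0\<close>.\<close>

lemma psd_sqrt_unique:
  assumes R: "R \<in> carrier_mat n n" "positive_semidefinite R"
    and pos: "\<And>x. x \<in> carrier_vec n \<Longrightarrow> Re ((R *\<^sub>v x) \<bullet>c x) = 0 \<Longrightarrow> x = 0\<^sub>v n"
    and S: "S \<in> carrier_mat n n" "positive_semidefinite S"
    and eq: "R * R = S * S"
  shows "R = S"
proof -
  define D where "D = R - S"
  have D: "D \<in> carrier_mat n n" using R S by (auto simp: D_def)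
  have Dh: "mat_adjoint D = D"
    using R S by (simp add: D_def mat_adjoint_minus[of _ n n] positive_semidefinite_def)
  have RD: "R * D = R * R - R * S" unfolding D_def by (rule mult_minus_distrib_mat[OF R(1) R(1) S(1)])
  have DS: "D * S = R * S - S * S" unfolding D_def by (rule minus_mult_distrib_mat[OF R(1) S(1) S(1)])
  have anti: "R * D = - (D * S)"
    unfolding RD DS eq using R(1) S(1) by (intro eq_matI) auto
  let ?q = "\<lambda>A i. Re ((A *\<^sub>v (D *\<^sub>v unit_vec n i)) \<bullet>c (D *\<^sub>v unit_vec n i))"
  have q: "(\<Sum>i<n. ?q A i) = Re (\<Sum>i<n. (D * (A * D)) $$ (i, i))" if "A \<in> carrier_mat n n" for A
    using that by (simp add: diag_entry_congruence[OF D Dh] del: index_mult_mat(1) index_mult_mat_vec)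
  have "(\<Sum>i<n. (D * (R * D)) $$ (i, i)) = - (\<Sum>i<n. (D * (D * S)) $$ (i, i))"
    unfolding anti using D S(1) by (subst sum_negf[symmetric], intro sum.cong) auto
  also have "(\<Sum>i<n. (D * (D * S)) $$ (i, i)) = (\<Sum>i<n. ((D * S) * D) $$ (i, i))"
    using D S(1) by (intro sum_diag_mult_commute) auto
  also have "(D * S) * D = D * (S * D)" by (rule assoc_mult_mat[OF D S(1) D])
  finally have "(\<Sum>i<n. ?q R i) + (\<Sum>i<n. ?q S i) = 0"
    unfolding q[OF R(1)] q[OF S(1)] by simp
  moreover have Dv: "D *\<^sub>v unit_vec n i \<in> carrier_vec n" for i using D by auto
  have nn: "0 \<le> ?q R i" "0 \<le> ?q S i" for i
    using R S Dv by (auto simp: positive_semidefinite_def)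
  moreover have "0 \<le> (\<Sum>i<n. ?q R i)" "0 \<le> (\<Sum>i<n. ?q S i)"
    by (intro sum_nonneg nn)+
  ultimately have "(\<Sum>i<n. ?q R i) = 0" by linarith
  then have z: "?q R i = 0" if "i < n" for i
    using sum_nonneg_eq_0_iff[of "{..<n}" "?q R"] nn that by auto
  \<comment> \<open>Definiteness of \<open>R\<close> turns each vanishing value of its form into a
    vanishing column of \<open>D\<close>.\<close>
  have Dz: "D *\<^sub>v unit_vec n i = 0\<^sub>v n" if "i < n" for i
    using pos[OF Dv z[OF that]] .
  show ?thesis
  proof (rule eq_matI)
    fix i j assume "i < dim_row S" "j < dim_col S"
    then have ij: "i < n" "j < n" using S by auto
    have "D $$ (i, j) = (D *\<^sub>v unit_vec n j) $ i" using D ij by (simp add: row_def)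
    also have "\<dots> = 0" using Dz ij by simp
    finally show "R $$ (i, j) = S $$ (i, j)" using ij R S by (simp add: D_def)
  qed (use R S in auto)
qed

text \<open>Evaluates the definite description in \<open>mat_sqrt\<close>: the root is
  \<open>1 - L\<close> for the fixed point \<open>L\<close>, and it is positive definite, so it is
  the only candidate.\<close>

lemma mat_sqrt_one_minus:
  assumes X: "X \<in> carrier_mat n n" and herm: "mat_adjoint X = X" and lt: "op_norm X < 1"
  shows "mat_sqrt (1\<^sub>m n - X) \<in> carrier_mat n n"
    and "mat_adjoint (mat_sqrt (1\<^sub>m n - X)) = mat_sqrt (1\<^sub>m n - X)"
    and "mat_sqrt (1\<^sub>m n - X) * mat_sqrt (1\<^sub>m n - X) = 1\<^sub>m n - X"
proof -
  define b where "b = sqrt (op_norm X)"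
  have b: "op_norm X \<le> b\<^sup>2" "0 \<le> b" "b < 1" using lt by (auto simp: b_def)
  obtain L where L: "L \<in> carrier_mat n n" "mat_adjoint L = L" "op_norm L \<le> b"
    "L = (1 / 2) \<cdot>\<^sub>m (X + L * L)" using sqrt_fixed_point[OF X herm b] by blast
  define R where "R = 1\<^sub>m n - L"
  have R: "R \<in> carrier_mat n n" using L(1-3) by (auto simp: R_def)
  have Rh: "mat_adjoint R = R" using L(1-3) by (simp add: R_def mat_adjoint_minus[of _ n n])
  \<comment> \<open>Since \<open>op_norm L \<le> b < 1\<close>, the form of \<open>1 - L\<close> is
    bounded below by \<open>1 - b\<close>. This yields both semidefiniteness and the definiteness
    asked for by \<open>psd_sqrt_unique\<close>.\<close>
  have form: "(1 - b) * (l2_norm x)\<^sup>2 \<le> Re ((R *\<^sub>v x) \<bullet>c x)" if x: "x \<in> carrier_vec n" for x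
  proof -
    have Lx: "L *\<^sub>v x \<in> carrier_vec n" using L(1) x by auto
    have "R *\<^sub>v x = x - L *\<^sub>v x" using L(1) x by (simp add: R_def minus_mult_distrib_mat_vec[of "1\<^sub>m n" n n])
    then have "Re ((R *\<^sub>v x) \<bullet>c x) = (l2_norm x)\<^sup>2 - Re ((L *\<^sub>v x) \<bullet>c x)"
      using cinner_minus_left[OF x Lx x] by (simp add: l2_norm_sq_Re)
    moreover have "Re ((L *\<^sub>v x) \<bullet>c x) \<le> l2_norm (L *\<^sub>v x) * l2_norm x"
      by (rule order_trans[OF complex_Re_le_cmod cinner_Cauchy_Schwarz[OF Lx x]])
    moreover have "l2_norm (L *\<^sub>v x) * l2_norm x \<le> (b * l2_norm x) * l2_norm x"
      using order_trans[OF op_norm_bound[OF L(1) x] mult_right_mono[OF L(3)]] by (intro mult_right_mono) auto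
    ultimately show ?thesis by (simp add: algebra_simps power2_eq_square)
  qed
  have Rpsd: "positive_semidefinite R"
    unfolding positive_semidefinite_def
  proof (intro conjI ballI Rh)
    show "square_mat R" using R by simp
    fix x :: "complex Matrix.vec" assume "x \<in> carrier_vec (dim_row R)"
    then have "x \<in> carrier_vec n" using R by simp
    then have "(1 - b) * (l2_norm x)\<^sup>2 \<le> Re ((R *\<^sub>v x) \<bullet>c x)" by (rule form)
    moreover have "0 \<le> (1 - b) * (l2_norm x)\<^sup>2" using b by simp
    ultimately show "0 \<le> Re ((R *\<^sub>v x) \<bullet>c x)" by (rule order_trans[rotated])
  qed
  have Rpos: "x = 0\<^sub>v n" if x: "x \<in> carrier_vec n" and 0: "Re ((R *\<^sub>v x) \<bullet>c x) = 0" for x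
  proof -
    have "(1 - b) * (l2_norm x)\<^sup>2 \<le> 0" using form[OF x] 0 by simp
    then have "l2_norm x = 0" using b by (simp add: mult_le_0_iff)
    then show ?thesis using x l2_norm_eq_0 by blast
  qed
  have RR: "R * R = 1\<^sub>m n - X"
  proof -
    have "R * R = (1\<^sub>m n - L) * 1\<^sub>m n - (1\<^sub>m n - L) * L"
      unfolding R_def by (rule mult_minus_distrib_mat[of _ n n]) (use L(1) in auto)
    also have "(1\<^sub>m n - L) * L = 1\<^sub>m n * L - L * L"
      by (rule minus_mult_distrib_mat[of _ n n]) (use L(1) in auto)
    finally have RR: "R * R = 1\<^sub>m n - L - (L - L * L)" using L(1) by simp
    show ?thesis unfolding RR
    proof (rule eq_matI)
      fix i j assume "i < dim_row (1\<^sub>m n - X)" "j < dim_col (1\<^sub>m n - X)"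
      then have ij: "i < n" "j < n" using X by auto
      \<comment> \<open>Read as \<open>2 L = X + L\<^sup>2\<close>, the fixed point equation turns
        \<open>1 - 2 L + L\<^sup>2\<close> into \<open>1 - X\<close>.\<close>
      have "L $$ (i, j) = 1 / 2 * (X $$ (i, j) + (L * L) $$ (i, j))"
        using arg_cong[OF L(4), of "\<lambda>A. A $$ (i, j)"] ij X L(1) by (simp del: index_mult_mat(1))
      then show "(1\<^sub>m n - L - (L - L * L)) $$ (i, j) = (1\<^sub>m n - X) $$ (i, j)"
        using ij X L(1) by (simp del: index_mult_mat(1) index_one_mat(1)) (simp add: field_simps)
    qed (use X L(1) in auto)
  qed
  have dim: "dim_row (1\<^sub>m n - X) = n" using X by simp
  have "mat_sqrt (1\<^sub>m n - X) = R"
    unfolding mat_sqrt_def dim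
  proof (rule the_equality)
    show "R \<in> carrier_mat n n \<and> positive_semidefinite R \<and> R * R = 1\<^sub>m n - X" using R Rpsd RR by blast
    show "S = R" if "S \<in> carrier_mat n n \<and> positive_semidefinite S \<and> S * S = 1\<^sub>m n - X" for S
      using psd_sqrt_unique[OF R Rpsd Rpos, of S] that RR by auto
  qed
  with R Rh RR show "mat_sqrt (1\<^sub>m n - X) \<in> carrier_mat n n"
    "mat_adjoint (mat_sqrt (1\<^sub>m n - X)) = mat_sqrt (1\<^sub>m n - X)"
    "mat_sqrt (1\<^sub>m n - X) * mat_sqrt (1\<^sub>m n - X) = 1\<^sub>m n - X" by auto
qed

section \<open>Moebius transforms of the matrix ball\<close>

text \<open>The analogue for the matrix ball of
  \<open>(\<alpha> - \<beta>) / (1 - cnj \<beta> * \<alpha>)\<close>. Its norm at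
  \<open>\<Delta> z\<close>, \<open>\<Delta> w\<close> is \<open>delta_dist\<close> by definition;
  taking matrices rather than points as arguments allows \<open>B\<close> to be frozen while
  \<open>A\<close> varies holomorphically, and \<open>\<Delta>\<close> to be replaced by any other
  function.\<close>

definition mobius_mat :: "nat \<Rightarrow> nat \<Rightarrow> complex mat \<Rightarrow> complex mat \<Rightarrow> complex mat" where
  "mobius_mat s r A B =
     mat_inv (mat_sqrt (1\<^sub>m s - B * mat_adjoint B)) * (A - B)
       * mat_inv (1\<^sub>m r - mat_adjoint B * A) * mat_sqrt (1\<^sub>m r - mat_adjoint B * B)"

lemma op_norm_mult_lt_1:
  assumes "A \<in> carrier_mat m n" "B \<in> carrier_mat n p" "op_norm A < 1" "op_norm B < 1"
  shows "op_norm (A * B) < 1"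
proof -
  have "op_norm A * op_norm B \<le> op_norm A * 1" using assms(4) by (intro mult_left_mono) auto
  then show ?thesis using op_norm_mult_le[OF assms(1,2)] assms(3) by linarith
qed

lemma op_norm_adjoint_lt_1: "op_norm A < 1 \<Longrightarrow> op_norm (mat_adjoint A) < 1"
  using op_norm_adjoint_le[of A] by linarith

lemma one_minus_inv:
  assumes "X \<in> carrier_mat n n" "op_norm X < 1"
  shows "mat_inv (1\<^sub>m n - X) \<in> carrier_mat n n" "(1\<^sub>m n - X) * mat_inv (1\<^sub>m n - X) = 1\<^sub>m n"
    "mat_inv (1\<^sub>m n - X) * (1\<^sub>m n - X) = 1\<^sub>m n"
  using mat_inv_of_injective[OF minus_carrier_mat[OF assms(1)] one_minus_injective[OF assms]] by auto

text \<open>A vector killed by \<open>R\<close> is killed by \<open>R * R = 1 - X\<close>, which is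
  injective.\<close>

lemma mat_sqrt_inv:
  assumes X: "X \<in> carrier_mat n n" and herm: "mat_adjoint X = X" and lt: "op_norm X < 1"
  defines "R \<equiv> mat_sqrt (1\<^sub>m n - X)"
  shows "mat_inv R \<in> carrier_mat n n" "R * mat_inv R = 1\<^sub>m n" "mat_inv R * R = 1\<^sub>m n"
proof -
  note R = mat_sqrt_one_minus[OF X herm lt, folded R_def]
  have "x = 0\<^sub>v n" if x: "x \<in> carrier_vec n" and 0: "R *\<^sub>v x = 0\<^sub>v n" for x
  proof (rule one_minus_injective[OF X lt x])
    have "(1\<^sub>m n - X) *\<^sub>v x = R *\<^sub>v (R *\<^sub>v x)" unfolding R(3)[symmetric] using R(1) x by simp
    also have "\<dots> = 0\<^sub>v n" unfolding 0 using R(1) by (intro eq_vecI) auto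
    finally show "(1\<^sub>m n - X) *\<^sub>v x = 0\<^sub>v n" .
  qed
  then show "mat_inv R \<in> carrier_mat n n" "R * mat_inv R = 1\<^sub>m n" "mat_inv R * R = 1\<^sub>m n"
    using mat_inv_of_injective[OF R(1)] by auto
qed

lemma mult_mat_vec_cancel:
  fixes P :: "complex mat"
  assumes "P \<in> carrier_mat n n" "Q \<in> carrier_mat n n" "P * Q = 1\<^sub>m n" "x \<in> carrier_vec n"
  shows "P *\<^sub>v (Q *\<^sub>v x) = x"
  using assms by (simp flip: assoc_mult_mat_vec)

lemma mult_mat_vec_zero: "A \<in> carrier_mat m n \<Longrightarrow> A *\<^sub>v 0\<^sub>v n = (0\<^sub>v m :: complex Matrix.vec)"
  by (rule eq_vecI) auto

lemma one_minus_mult_mat_vec: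
  fixes X :: "complex mat"
  assumes "X \<in> carrier_mat n n" "x \<in> carrier_vec n"
  shows "(1\<^sub>m n - X) *\<^sub>v x = x - X *\<^sub>v x"
  using assms by (simp add: minus_mult_distrib_mat_vec[of "1\<^sub>m n" n n])

section \<open>Identities for the Moebius image \<open>C\<close> of a strict contraction
  \<open>A\<close>, with centre \<open>B\<close>\<close>

context
  fixes s r :: nat and A B :: "complex mat"
  assumes A: "A \<in> carrier_mat s r" "op_norm A < 1" and B: "B \<in> carrier_mat s r" "op_norm B < 1"
begin

private abbreviation (input) "B' \<equiv> mat_adjoint B"
private abbreviation (input) "D \<equiv> mat_sqrt (1\<^sub>m r - B' * B)"
private abbreviation (input) "D' \<equiv> mat_sqrt (1\<^sub>m s - B * B')"
private abbreviation (input) "K \<equiv> mat_inv (1\<^sub>m r - B' * A)"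
private abbreviation (input) "C \<equiv> mobius_mat s r A B"

private lemma B': "B' \<in> carrier_mat r s" "op_norm B' < 1"
  using B op_norm_adjoint_lt_1 by auto

private lemma BB:
  "B' * B \<in> carrier_mat r r" "mat_adjoint (B' * B) = B' * B" "op_norm (B' * B) < 1"
  "B * B' \<in> carrier_mat s s" "mat_adjoint (B * B') = B * B'" "op_norm (B * B') < 1"
  "B' * A \<in> carrier_mat r r" "op_norm (B' * A) < 1"
  using A B B' op_norm_mult_lt_1[OF B'(1) B(1)] op_norm_mult_lt_1[OF B(1) B'(1)] op_norm_mult_lt_1[OF B'(1) A(1)]
  by (auto simp: mat_adjoint_mult[OF B'(1) B(1)] mat_adjoint_mult[OF B(1) B'(1)])

private lemmas D = mat_sqrt_one_minus[OF BB(1-3)] mat_sqrt_inv[OF BB(1-3)]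
private lemmas D' = mat_sqrt_one_minus[OF BB(4-6)] mat_sqrt_inv[OF BB(4-6)]
private lemmas K = one_minus_inv[OF BB(7,8)]

lemma mobius_mat_carrier: "C \<in> carrier_mat s r"
  using A B D D' K unfolding mobius_mat_def by auto

lemma mobius_mat_mult_vec:
  assumes y: "y \<in> carrier_vec r"
  shows "C *\<^sub>v y = mat_inv D' *\<^sub>v ((A - B) *\<^sub>v (K *\<^sub>v (D *\<^sub>v y)))"
proof -
  have 1: "A - B \<in> carrier_mat s r" using A B by auto
  have 2: "mat_inv D' * (A - B) \<in> carrier_mat s r" using D'(4) 1 by auto
  have 3: "mat_inv D' * (A - B) * K \<in> carrier_mat s r" using 2 K(1) by auto
  have 4: "D *\<^sub>v y \<in> carrier_vec r" using D(1) y by auto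
  have 5: "K *\<^sub>v (D *\<^sub>v y) \<in> carrier_vec r" using K(1) 4 by auto
  show ?thesis
    unfolding mobius_mat_def assoc_mult_mat_vec[OF 3 D(1) y] assoc_mult_mat_vec[OF 2 K(1) 4]
      assoc_mult_mat_vec[OF D'(4) 1 5] ..
qed

text \<open>
  With \<open>u = D\<^sup>-\<^sup>2 (e - B\<^sup>* a)\<close> and \<open>v = D'\<^sup>-\<^sup>2 (a - B e)\<close>, where \<open>a = A e\<close>, one has \<open>v + B u = a\<close> and
  \<open>u + B\<^sup>* v = e\<close>; both squared norms on the left are then inner products with \<open>u\<close> and \<open>v\<close>.
\<close>

lemma mobius_mat_defect:
  assumes e: "e \<in> carrier_vec r" and y: "y \<in> carrier_vec r"
    and Dy: "D *\<^sub>v y = (1\<^sub>m r - B' * A) *\<^sub>v e"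
  shows "(l2_norm y)\<^sup>2 - (l2_norm (C *\<^sub>v y))\<^sup>2 = (l2_norm e)\<^sup>2 - (l2_norm (A *\<^sub>v e))\<^sup>2"
proof -
  define a where "a = A *\<^sub>v e"
  define u where "u = mat_inv D *\<^sub>v y"
  define q where "q = (A - B) *\<^sub>v e"
  define z where "z = mat_inv D' *\<^sub>v q"
  define v where "v = mat_inv D' *\<^sub>v z"
  have a: "a \<in> carrier_vec s" using A e by (auto simp: a_def)
  have u: "u \<in> carrier_vec r" using D y by (auto simp: u_def)
  have q: "q \<in> carrier_vec s"
    unfolding q_def by (rule mult_mat_vec_carrier[OF minus_carrier_mat[OF B(1)] e])
  have z: "z \<in> carrier_vec s" using D' q by (auto simp: z_def)
  have v: "v \<in> carrier_vec s" using D' z by (auto simp: v_def)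
  have Bu: "B *\<^sub>v u \<in> carrier_vec s" using B u by auto
  have aBu: "a - B *\<^sub>v u \<in> carrier_vec s" using a Bu by auto
  have Be: "B *\<^sub>v e \<in> carrier_vec s" using B e by auto
  have Ba: "B' *\<^sub>v a \<in> carrier_vec r" using B' a by auto
  have Bv: "B' *\<^sub>v v \<in> carrier_vec r" using B' v by auto
  have BBu: "B' *\<^sub>v (B *\<^sub>v u) \<in> carrier_vec r" using B' Bu by auto
  have Cy: "C *\<^sub>v y = z"
  proof -
    have "K *\<^sub>v (D *\<^sub>v y) = e" unfolding Dy
      by (rule mult_mat_vec_cancel[OF K(1) minus_carrier_mat[OF BB(7)] K(3) e])
    then show ?thesis unfolding mobius_mat_mult_vec[OF y] z_def q_def by simp
  qed
  have q_eq: "q = a - B *\<^sub>v e" unfolding q_def a_def by (rule minus_mult_distrib_mat_vec[OF A(1) B(1) e])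
  have Du: "D *\<^sub>v u = y" unfolding u_def by (rule mult_mat_vec_cancel[OF D(1,4,5) y])
  have D'v: "D' *\<^sub>v v = z" unfolding v_def by (rule mult_mat_vec_cancel[OF D'(1,4,5) z])
  have D'z: "D' *\<^sub>v z = q" unfolding z_def by (rule mult_mat_vec_cancel[OF D'(1,4,5) q])
  have p_eq: "D *\<^sub>v y = e - B' *\<^sub>v a"
    unfolding Dy one_minus_mult_mat_vec[OF BB(7) e] a_def assoc_mult_mat_vec[OF B'(1) A(1) e] ..
  have u_eq: "u - B' *\<^sub>v (B *\<^sub>v u) = e - B' *\<^sub>v a"
  proof -
    have "u - B' *\<^sub>v (B *\<^sub>v u) = (D * D) *\<^sub>v u"
      unfolding D(3) one_minus_mult_mat_vec[OF BB(1) u] assoc_mult_mat_vec[OF B'(1) B(1) u] ..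
    also have "\<dots> = D *\<^sub>v y" unfolding assoc_mult_mat_vec[OF D(1) D(1) u] Du ..
    finally show ?thesis unfolding p_eq .
  qed
  have u_eq_i: "u $ i - (B' *\<^sub>v (B *\<^sub>v u)) $ i = e $ i - (B' *\<^sub>v a) $ i" if "i < r" for i
    using arg_cong[OF u_eq, of "\<lambda>v. v $ i"] carrier_vecD[OF BBu] carrier_vecD[OF Ba] that
    by (simp only: index_minus_vec)
  have diff_swap: "d - b = c - a" if "a - b = c - d" for a b c d :: complex
    using that by (simp add: algebra_simps)
  have diff_shift: "a = c - (d - b)" if "a - b = c - d" for a b c d :: complex
    using that by (simp add: algebra_simps)
  have v_eq: "(1\<^sub>m s - B * B') *\<^sub>v v = q"
  proof -
    have "(1\<^sub>m s - B * B') *\<^sub>v v = (D' * D') *\<^sub>v v" unfolding D'(3) ..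
    also have "\<dots> = q" unfolding assoc_mult_mat_vec[OF D'(1) D'(1) v] D'v D'z ..
    finally show ?thesis .
  qed
  \<comment> \<open>The claim \<open>v = a - B u\<close> is tested after applying the injective
    \<open>1 - B B'\<close>: both sides go to \<open>q\<close>, because \<open>u_eq\<close> replaces
    \<open>B' a - B' B u\<close> by \<open>e - u\<close>.\<close>
  have "(1\<^sub>m s - B * B') *\<^sub>v (a - B *\<^sub>v u) = (a - B *\<^sub>v u) - B *\<^sub>v (B' *\<^sub>v a - B' *\<^sub>v (B *\<^sub>v u))"
    unfolding one_minus_mult_mat_vec[OF BB(4) aBu] assoc_mult_mat_vec[OF B(1) B'(1) aBu]
      mult_minus_distrib_mat_vec[OF B'(1) a Bu] ..
  also have "B *\<^sub>v (B' *\<^sub>v a - B' *\<^sub>v (B *\<^sub>v u)) = B *\<^sub>v (e - u)"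
  proof (rule arg_cong[of _ _ "(*\<^sub>v) B"], rule eq_vecI)
    fix i assume "i < dim_vec (e - u)"
    then have i: "i < r" using u by simp
    then show "(B' *\<^sub>v a - B' *\<^sub>v (B *\<^sub>v u)) $ i = (e - u) $ i"
      using diff_swap[OF u_eq_i[OF i]] carrier_vecD[OF BBu] carrier_vecD[OF u]
      by (simp only: index_minus_vec)
  qed (use carrier_vecD[OF BBu] carrier_vecD[OF u] in \<open>simp only: index_minus_vec\<close>)
  also have "\<dots> = B *\<^sub>v e - B *\<^sub>v u" by (rule mult_minus_distrib_mat_vec[OF B(1) e u])
  also have "(a - B *\<^sub>v u) - (B *\<^sub>v e - B *\<^sub>v u) = q"
    unfolding q_eq using a Bu Be by (intro eq_vecI) (auto simp del: index_mult_mat_vec)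
  finally have "(1\<^sub>m s - B * B') *\<^sub>v (a - B *\<^sub>v u) = (1\<^sub>m s - B * B') *\<^sub>v v" unfolding v_eq .
  then have "mat_inv (1\<^sub>m s - B * B') *\<^sub>v ((1\<^sub>m s - B * B') *\<^sub>v (a - B *\<^sub>v u))
      = mat_inv (1\<^sub>m s - B * B') *\<^sub>v ((1\<^sub>m s - B * B') *\<^sub>v v)" by simp
  moreover have M: "1\<^sub>m s - B * B' \<in> carrier_mat s s" by (rule minus_carrier_mat[OF BB(4)])
  note can = mult_mat_vec_cancel[OF one_minus_inv(1)[OF BB(4,6)] M one_minus_inv(3)[OF BB(4,6)]]
  ultimately have v_alt: "v = a - B *\<^sub>v u"
    using can[of v] can[of "a - B *\<^sub>v u"] a v Bu by simp
  have u_alt: "u = e - B' *\<^sub>v v"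
  proof (rule eq_vecI)
    have Bv_eq: "B' *\<^sub>v v = B' *\<^sub>v a - B' *\<^sub>v (B *\<^sub>v u)"
      unfolding v_alt by (rule mult_minus_distrib_mat_vec[OF B'(1) a Bu])
    fix i assume "i < dim_vec (e - B' *\<^sub>v v)"
    then have i: "i < r" using carrier_vecD[OF Bv] by (simp only: index_minus_vec)
    then show "u $ i = (e - B' *\<^sub>v v) $ i" unfolding Bv_eq
      using diff_shift[OF u_eq_i[OF i]] carrier_vecD[OF BBu] carrier_vecD[OF Ba]
      by (simp only: index_minus_vec)
  qed (use carrier_vecD[OF Bv] carrier_vecD[OF u] in \<open>simp only: index_minus_vec\<close>)
  \<comment> \<open>Self-adjointness of \<open>D\<close> moves one factor \<open>D\<close> across.
    The expansions of \<open><y, y>\<close> and \<open><z, z>\<close> then contain the same two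
    mixed terms, which cancel in the difference.\<close>
  have "y \<bullet>c y = u \<bullet>c (e - B' *\<^sub>v a)"
    using cinner_adjoint[OF D(1) u y] unfolding Du D(2) p_eq .
  also have "\<dots> = u \<bullet>c e - u \<bullet>c (B' *\<^sub>v a)" by (rule cinner_minus_right[OF e Ba u])
  also have "u \<bullet>c (B' *\<^sub>v a) = (B *\<^sub>v u) \<bullet>c a" by (rule cinner_adjoint[OF B(1) u a, symmetric])
  also have "u \<bullet>c e = e \<bullet>c e - (B' *\<^sub>v v) \<bullet>c e"
    by (subst u_alt) (rule cinner_minus_left[OF e Bv e])
  finally have 1: "y \<bullet>c y = e \<bullet>c e - (B' *\<^sub>v v) \<bullet>c e - (B *\<^sub>v u) \<bullet>c a" .
  have "z \<bullet>c z = v \<bullet>c (a - B *\<^sub>v e)"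
    using cinner_adjoint[OF D'(1) v z] unfolding D'v D'(2) D'z q_eq .
  also have "\<dots> = v \<bullet>c a - v \<bullet>c (B *\<^sub>v e)" by (rule cinner_minus_right[OF a Be v])
  also have "v \<bullet>c (B *\<^sub>v e) = (B' *\<^sub>v v) \<bullet>c e" by (rule cinner_adjoint2[OF B(1) e v, symmetric])
  also have "v \<bullet>c a = a \<bullet>c a - (B *\<^sub>v u) \<bullet>c a"
    by (subst v_alt) (rule cinner_minus_left[OF a Bu a])
  finally have 2: "z \<bullet>c z = a \<bullet>c a - (B *\<^sub>v u) \<bullet>c a - (B' *\<^sub>v v) \<bullet>c e" .
  show ?thesis unfolding Cy l2_norm_sq_Re 1 2 a_def[symmetric] by simp
qed

text \<open>\<open>D\<close> is self-adjoint, so it moves onto \<open>y\<close>, where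
  \<open>Dy\<close> applies. The link between \<open>y\<close> and \<open>e\<close> is kept as an
  equation because \<open>two_point_iff\<close> solves it once for \<open>e\<close> and once for
  \<open>y\<close>.\<close>

lemma mobius_mat_cross:
  assumes e: "e \<in> carrier_vec r" and e': "e' \<in> carrier_vec r" and y: "y \<in> carrier_vec r"
    and Dy: "D *\<^sub>v y = (1\<^sub>m r - B' * A) *\<^sub>v e"
  shows "y \<bullet>c (D *\<^sub>v e') = e \<bullet>c e' - (A *\<^sub>v e) \<bullet>c (B *\<^sub>v e')"
proof -
  have Ae: "A *\<^sub>v e \<in> carrier_vec s" using A e by auto
  have BAe: "B' *\<^sub>v (A *\<^sub>v e) \<in> carrier_vec r" using B' Ae by auto
  have "y \<bullet>c (D *\<^sub>v e') = (D *\<^sub>v y) \<bullet>c e'"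
    using cinner_adjoint[OF D(1) y e'] unfolding D(2) by simp
  also have "D *\<^sub>v y = e - B' *\<^sub>v (A *\<^sub>v e)"
    unfolding Dy one_minus_mult_mat_vec[OF BB(7) e] assoc_mult_mat_vec[OF B'(1) A(1) e] ..
  also have "\<dots> \<bullet>c e' = e \<bullet>c e' - (B' *\<^sub>v (A *\<^sub>v e)) \<bullet>c e'"
    by (rule cinner_minus_left[OF e BAe e'])
  also have "(B' *\<^sub>v (A *\<^sub>v e)) \<bullet>c e' = (A *\<^sub>v e) \<bullet>c (B *\<^sub>v e')"
    by (rule cinner_adjoint2[OF B(1) e' Ae])
  finally show ?thesis .
qed

text \<open>The counterpart of \<open>mobius_mat_defect\<close> at the centre: there the Moebius
  image is \<open>0\<close>, and only the norm of \<open>D e\<close> survives. It holds because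
  \<open>D\<^sup>2 = 1 - B' B\<close>.\<close>

lemma mat_sqrt_defect:
  assumes e: "e \<in> carrier_vec r"
  shows "(l2_norm (D *\<^sub>v e))\<^sup>2 = (l2_norm e)\<^sup>2 - (l2_norm (B *\<^sub>v e))\<^sup>2"
proof -
  have De: "D *\<^sub>v e \<in> carrier_vec r" using D(1) e by auto
  have Be: "B *\<^sub>v e \<in> carrier_vec s" using B e by auto
  have BBe: "B' *\<^sub>v (B *\<^sub>v e) \<in> carrier_vec r" using B' Be by auto
  have "(D *\<^sub>v e) \<bullet>c (D *\<^sub>v e) = e \<bullet>c (D *\<^sub>v (D *\<^sub>v e))"
    using cinner_adjoint[OF D(1) e De] unfolding D(2) .
  also have "D *\<^sub>v (D *\<^sub>v e) = e - B' *\<^sub>v (B *\<^sub>v e)"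
    unfolding assoc_mult_mat_vec[OF D(1) D(1) e, symmetric] D(3) one_minus_mult_mat_vec[OF BB(1) e]
      assoc_mult_mat_vec[OF B'(1) B(1) e] ..
  also have "e \<bullet>c \<dots> = e \<bullet>c e - e \<bullet>c (B' *\<^sub>v (B *\<^sub>v e))" by (rule cinner_minus_right[OF e BBe e])
  also have "e \<bullet>c (B' *\<^sub>v (B *\<^sub>v e)) = (B *\<^sub>v e) \<bullet>c (B *\<^sub>v e)"
    by (rule cinner_adjoint[OF B(1) e Be, symmetric])
  finally show ?thesis by (simp add: l2_norm_sq_Re)
qed

text \<open>By \<open>mobius_mat_defect\<close> the gap \<open>|y|\<^sup>2 - |C y|\<^sup>2\<close>
  equals \<open>|e|\<^sup>2 - |A e|\<^sup>2\<close>, which is positive because \<open>e\<close> is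
  nonzero and \<open>A\<close> is a strict contraction. This keeps the scalar competitors for the
  Moebius distance inside the open disk.\<close>

lemma mobius_mat_contractive:
  assumes y: "y \<in> carrier_vec r" "l2_norm y = 1"
  shows "l2_norm (C *\<^sub>v y) < 1"
proof -
  define e where "e = K *\<^sub>v (D *\<^sub>v y)"
  have Dyc: "D *\<^sub>v y \<in> carrier_vec r" using D(1) y by auto
  have e: "e \<in> carrier_vec r" using K(1) Dyc by (auto simp: e_def)
  have M: "1\<^sub>m r - B' * A \<in> carrier_mat r r" by (rule minus_carrier_mat[OF BB(7)])
  have Dy: "D *\<^sub>v y = (1\<^sub>m r - B' * A) *\<^sub>v e"
    unfolding e_def by (rule mult_mat_vec_cancel[OF M K(1,2) Dyc, symmetric])
  have "e \<noteq> 0\<^sub>v r"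
  proof
    assume "e = 0\<^sub>v r"
    then have "D *\<^sub>v y = 0\<^sub>v r" unfolding Dy using mult_mat_vec_zero[OF M] by (simp only:)
    then have "y = mat_inv D *\<^sub>v 0\<^sub>v r" using mult_mat_vec_cancel[OF D(4,1,6) y(1)] by simp
    also have "\<dots> = 0\<^sub>v r" using D(4) by (intro eq_vecI) auto
    finally show False using y by simp
  qed
  then have pos: "0 < l2_norm e" using l2_norm_eq_0[OF e] l2_norm_nonneg[of e] by linarith
  have "l2_norm (A *\<^sub>v e) \<le> op_norm A * l2_norm e" by (rule op_norm_bound[OF A(1) e])
  also have "\<dots> < 1 * l2_norm e" using A pos by (intro mult_strict_right_mono)
  finally have "(l2_norm (A *\<^sub>v e))\<^sup>2 < (l2_norm e)\<^sup>2" by (simp add: power_strict_mono)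
  then have "(l2_norm (C *\<^sub>v y))\<^sup>2 < 1\<^sup>2" using mobius_mat_defect[OF e y(1) Dy] y(2) by simp
  then show ?thesis by (rule power_less_imp_less_base) simp
qed

text \<open>Put \<open>D y = (1 - B' A) e\<close> and \<open>x = D e'\<close>. The right side minus
  the left side of the first inequality becomes
  \<open>|y|\<^sup>2 - |C y|\<^sup>2 + |x|\<^sup>2 + 2 Re (g <y, x>)\<close>. Both substitutions are
  invertible, so \<open>x\<close> and \<open>y\<close> are arbitrary and the condition is the one at
  the minimizing \<open>x\<close>.\<close>

lemma two_point_iff:
  "(\<forall>e \<in> carrier_vec r. \<forall>e' \<in> carrier_vec r.
      (l2_norm (A *\<^sub>v e))\<^sup>2 + (l2_norm (B *\<^sub>v e'))\<^sup>2 + 2 * Re (g * ((A *\<^sub>v e) \<bullet>c (B *\<^sub>v e')))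
      \<le> (l2_norm e)\<^sup>2 + (l2_norm e')\<^sup>2 + 2 * Re (g * (e \<bullet>c e')))
   \<longleftrightarrow> (\<forall>y \<in> carrier_vec r. (l2_norm (C *\<^sub>v y))\<^sup>2 \<le> (1 - (cmod g)\<^sup>2) * (l2_norm y)\<^sup>2)"
  (is "?L \<longleftrightarrow> ?R")
proof
  have M: "1\<^sub>m r - B' * A \<in> carrier_mat r r" by (rule minus_carrier_mat[OF BB(7)])
  {
    assume L: ?L
    show ?R
    proof
      fix y :: "complex Matrix.vec" assume y: "y \<in> carrier_vec r"
      define e where "e = K *\<^sub>v (D *\<^sub>v y)"
      \<comment> \<open>Chosen so that \<open>D e' = - g y\<close>, the minimizer. The factor is
        \<open>- g\<close> and not its conjugate, because the inner product conjugates its second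
        argument.\<close>
      define e' where "e' = mat_inv D *\<^sub>v ((- g) \<cdot>\<^sub>v y)"
      have Dyc: "D *\<^sub>v y \<in> carrier_vec r" using D(1) y by auto
      have gy: "(- g) \<cdot>\<^sub>v y \<in> carrier_vec r" using y by simp
      have e: "e \<in> carrier_vec r" using K(1) Dyc by (auto simp: e_def)
      have e': "e' \<in> carrier_vec r" using D(4) gy by (auto simp: e'_def)
      have Dy: "D *\<^sub>v y = (1\<^sub>m r - B' * A) *\<^sub>v e"
        unfolding e_def by (rule mult_mat_vec_cancel[OF M K(1,2) Dyc, symmetric])
      have De': "D *\<^sub>v e' = (- g) \<cdot>\<^sub>v y"
        unfolding e'_def by (rule mult_mat_vec_cancel[OF D(1,4,5) gy])
      have 1: "(cmod g)\<^sup>2 * (l2_norm y)\<^sup>2 = (l2_norm e')\<^sup>2 - (l2_norm (B *\<^sub>v e'))\<^sup>2"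
        using mat_sqrt_defect[OF e'] unfolding De' l2_norm_smult by (simp add: power_mult_distrib)
      have "e \<bullet>c e' - (A *\<^sub>v e) \<bullet>c (B *\<^sub>v e') = - cnj g * (y \<bullet>c y)"
        using mobius_mat_cross[OF e e' y Dy] unfolding De' cinner_smult_right[OF y y] by simp
      then have "g * (e \<bullet>c e') - g * ((A *\<^sub>v e) \<bullet>c (B *\<^sub>v e')) = - (g * cnj g) * (y \<bullet>c y)"
        by (simp flip: right_diff_distrib)
      also have "\<dots> = complex_of_real (- ((cmod g)\<^sup>2 * (l2_norm y)\<^sup>2))"
        by (simp only: cinner_self complex_norm_square[symmetric] of_real_mult of_real_minus mult_minus_left)
      finally have "Re (g * (e \<bullet>c e')) - Re (g * ((A *\<^sub>v e) \<bullet>c (B *\<^sub>v e'))) = - ((cmod g)\<^sup>2 * (l2_norm y)\<^sup>2)"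
        by (metis Re_complex_of_real minus_complex.sel(1))
      with L[rule_format, OF e e'] mobius_mat_defect[OF e y Dy] 1
      show "(l2_norm (C *\<^sub>v y))\<^sup>2 \<le> (1 - (cmod g)\<^sup>2) * (l2_norm y)\<^sup>2"
        by (simp add: algebra_simps)
    qed
  }
  {
    assume R: ?R
    show ?L
    proof (intro ballI)
      fix e e' :: "complex Matrix.vec" assume e: "e \<in> carrier_vec r" and e': "e' \<in> carrier_vec r"
      define y where "y = mat_inv D *\<^sub>v ((1\<^sub>m r - B' * A) *\<^sub>v e)"
      define x where "x = D *\<^sub>v e'"
      have Me: "(1\<^sub>m r - B' * A) *\<^sub>v e \<in> carrier_vec r" using M e by auto
      have y: "y \<in> carrier_vec r" using D(4) Me by (auto simp: y_def)
      have x: "x \<in> carrier_vec r" using D(1) e' by (auto simp: x_def)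
      have Dy: "D *\<^sub>v y = (1\<^sub>m r - B' * A) *\<^sub>v e"
        unfolding y_def by (rule mult_mat_vec_cancel[OF D(1,4,5) Me])
      have 1: "(l2_norm x)\<^sup>2 = (l2_norm e')\<^sup>2 - (l2_norm (B *\<^sub>v e'))\<^sup>2"
        unfolding x_def by (rule mat_sqrt_defect[OF e'])
      have 2: "Re (g * (y \<bullet>c x)) = Re (g * (e \<bullet>c e')) - Re (g * ((A *\<^sub>v e) \<bullet>c (B *\<^sub>v e')))"
        using mobius_mat_cross[OF e e' y Dy] unfolding x_def by (simp add: right_diff_distrib)
      have "- Re (g * (y \<bullet>c x)) \<le> cmod g * cmod (y \<bullet>c x)"
        using abs_Re_le_cmod[of "g * (y \<bullet>c x)"] by (simp add: norm_mult)
      also have "\<dots> \<le> cmod g * (l2_norm y * l2_norm x)"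
        by (intro mult_left_mono cinner_Cauchy_Schwarz[OF y x]) auto
      finally have "- Re (g * (y \<bullet>c x)) \<le> cmod g * (l2_norm y * l2_norm x)" .
      \<comment> \<open>Completing the square: the mixed term is at least
        \<open>- 2 |g| |y| |x|\<close>, so the part of the form involving \<open>x\<close> is at
        least \<open>- |g|\<^sup>2 |y|\<^sup>2\<close>.\<close>
      moreover have "0 \<le> (cmod g * l2_norm y - l2_norm x)\<^sup>2" by simp
      ultimately have 3: "0 \<le> (cmod g)\<^sup>2 * (l2_norm y)\<^sup>2 + (l2_norm x)\<^sup>2 + 2 * Re (g * (y \<bullet>c x))"
        by (simp add: power2_diff power_mult_distrib)
      have "(l2_norm (C *\<^sub>v y))\<^sup>2 \<le> (1 - (cmod g)\<^sup>2) * (l2_norm y)\<^sup>2" using R y by blast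
      with 1 2 3 mobius_mat_defect[OF e y Dy]
      show "(l2_norm (A *\<^sub>v e))\<^sup>2 + (l2_norm (B *\<^sub>v e'))\<^sup>2 + 2 * Re (g * ((A *\<^sub>v e) \<bullet>c (B *\<^sub>v e')))
          \<le> (l2_norm e)\<^sup>2 + (l2_norm e')\<^sup>2 + 2 * Re (g * (e \<bullet>c e'))"
        by (simp add: algebra_simps)
    qed
  }
qed

end

section \<open>Holomorphic matrix functions and the Moebius distance\<close>

lemma holomorphic_several_const [simp]: "holomorphic_several (\<lambda>_. c) S"
  unfolding holomorphic_several_def by (auto intro!: exI[of _ "\<lambda>_. 0"])

lemma holomorphic_several_add:
  assumes "holomorphic_several f S" "holomorphic_several g S"
  shows "holomorphic_several (\<lambda>z. f z + g z) S"
  unfolding holomorphic_several_def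
proof
  fix z assume "z \<in> S"
  then obtain f' g' where "(f has_derivative f') (at z)" "\<forall>c h. f' (c *s h) = c * f' h"
    "(g has_derivative g') (at z)" "\<forall>c h. g' (c *s h) = c * g' h"
    using assms unfolding holomorphic_several_def by blast
  then show "\<exists>k. ((\<lambda>z. f z + g z) has_derivative k) (at z) \<and> (\<forall>c h. k (c *s h) = c * k h)"
    by (intro exI[of _ "\<lambda>h. f' h + g' h"]) (auto intro!: has_derivative_add simp: distrib_left)
qed

lemma holomorphic_several_mult:
  assumes "holomorphic_several f S" "holomorphic_several g S"
  shows "holomorphic_several (\<lambda>z. f z * g z) S"
  unfolding holomorphic_several_def
proof
  fix z assume "z \<in> S"
  then obtain f' g' where "(f has_derivative f') (at z)" "\<forall>c h. f' (c *s h) = c * f' h"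
    "(g has_derivative g') (at z)" "\<forall>c h. g' (c *s h) = c * g' h"
    using assms unfolding holomorphic_several_def by blast
  then show "\<exists>k. ((\<lambda>z. f z * g z) has_derivative k) (at z) \<and> (\<forall>c h. k (c *s h) = c * k h)"
    by (intro exI[of _ "\<lambda>h. f z * g' h + f' h * g z"])
       (auto intro!: has_derivative_mult simp: distrib_left)
qed

lemma holomorphic_several_inverse:
  assumes "holomorphic_several f S" "\<And>z. z \<in> S \<Longrightarrow> f z \<noteq> 0"
  shows "holomorphic_several (\<lambda>z. inverse (f z)) S"
  unfolding holomorphic_several_def
proof
  fix z assume z: "z \<in> S"
  then obtain f' where "(f has_derivative f') (at z)" "\<forall>c h. f' (c *s h) = c * f' h"
    using assms unfolding holomorphic_several_def by blast
  then show "\<exists>k. ((\<lambda>z. inverse (f z)) has_derivative k) (at z) \<and> (\<forall>c h. k (c *s h) = c * k h)"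
    using assms(2)[OF z]
    by (intro exI[of _ "\<lambda>h. - (inverse (f z) * f' h * inverse (f z))"])
       (auto intro!: has_derivative_inverse)
qed

lemma holomorphic_several_sum:
  assumes "\<And>i. i \<in> I \<Longrightarrow> holomorphic_several (f i) S"
  shows "holomorphic_several (\<lambda>z. \<Sum>i\<in>I. f i z) S"
  using assms by (induction I rule: infinite_finite_induct) (auto intro!: holomorphic_several_add)

lemma holomorphic_several_prod:
  assumes "\<And>i. i \<in> I \<Longrightarrow> holomorphic_several (f i) S"
  shows "holomorphic_several (\<lambda>z. \<Prod>i\<in>I. f i z) S"
  using assms by (induction I rule: infinite_finite_induct) (auto intro!: holomorphic_several_mult)

text \<open>The sizes of the matrices \<open>F z\<close> are known only for \<open>z\<close> in
  \<open>S\<close>, so entry formulas hold only there. Openness of \<open>S\<close> makes agreement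
  on \<open>S\<close> enough for the full derivative \<open>at z\<close>.\<close>

lemma holomorphic_several_cong:
  assumes "open S" "holomorphic_several f S" "\<And>z. z \<in> S \<Longrightarrow> f z = g z"
  shows "holomorphic_several g S"
  unfolding holomorphic_several_def
proof
  fix z assume z: "z \<in> S"
  then obtain f' where "(f has_derivative f') (at z)" "\<forall>c h. f' (c *s h) = c * f' h"
    using assms unfolding holomorphic_several_def by blast
  moreover from this(1) have "(g has_derivative f') (at z)"
    by (rule has_derivative_transform_within_open[OF _ assms(1) z]) (rule assms(3))
  ultimately show "\<exists>k. (g has_derivative k) (at z) \<and> (\<forall>c h. k (c *s h) = c * k h)" by blast
qed

section \<open>Closure properties of holomorphic matrix functions, including inversion\<close>

lemma holomorphic_matD:
  assumes "holomorphic_mat m n F S"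
  shows "z \<in> S \<Longrightarrow> F z \<in> carrier_mat m n"
    and "i < m \<Longrightarrow> j < n \<Longrightarrow> holomorphic_several (\<lambda>z. F z $$ (i, j)) S"
  using assms by (auto simp: holomorphic_mat_def)

lemma holomorphic_mat_const: "A \<in> carrier_mat m n \<Longrightarrow> holomorphic_mat m n (\<lambda>_. A) S"
  by (simp add: holomorphic_mat_def)

lemma holomorphic_mat_smult:
  assumes "open S" "holomorphic_mat m n F S"
  shows "holomorphic_mat m n (\<lambda>z. c \<cdot>\<^sub>m F z) S"
  unfolding holomorphic_mat_def
proof (intro conjI ballI allI impI)
  fix i j assume ij: "i < m" "j < n"
  show "holomorphic_several (\<lambda>z. (c \<cdot>\<^sub>m F z) $$ (i, j)) S"
  proof (rule holomorphic_several_cong[OF assms(1)])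
    show "holomorphic_several (\<lambda>z. c * F z $$ (i, j)) S"
      by (intro holomorphic_several_mult holomorphic_several_const holomorphic_matD(2)[OF assms(2) ij])
    fix z assume "z \<in> S"
    from holomorphic_matD(1)[OF assms(2) this]
    show "c * F z $$ (i, j) = (c \<cdot>\<^sub>m F z) $$ (i, j)" using ij by simp
  qed
qed (use holomorphic_matD(1)[OF assms(2)] in auto)

lemma holomorphic_mat_minus:
  assumes "open S" "holomorphic_mat m n F S" "holomorphic_mat m n G S"
  shows "holomorphic_mat m n (\<lambda>z. F z - G z) S"
  unfolding holomorphic_mat_def
proof (intro conjI ballI allI impI)
  fix i j assume ij: "i < m" "j < n"
  show "holomorphic_several (\<lambda>z. (F z - G z) $$ (i, j)) S"
  proof (rule holomorphic_several_cong[OF assms(1)])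
    show "holomorphic_several (\<lambda>z. F z $$ (i, j) + (- 1) * G z $$ (i, j)) S"
      using holomorphic_matD(2)[OF assms(2)] holomorphic_matD(2)[OF assms(3)] ij
      by (intro holomorphic_several_add holomorphic_several_mult holomorphic_several_const)
    fix z assume "z \<in> S"
    from holomorphic_matD(1)[OF assms(2) this] holomorphic_matD(1)[OF assms(3) this]
    show "F z $$ (i, j) + (- 1) * G z $$ (i, j) = (F z - G z) $$ (i, j)" using ij by simp
  qed
qed (use holomorphic_matD(1)[OF assms(3)] minus_carrier_mat in blast)

lemma holomorphic_mat_mult:
  assumes "open S" "holomorphic_mat m n F S" "holomorphic_mat n p G S"
  shows "holomorphic_mat m p (\<lambda>z. F z * G z) S"
  unfolding holomorphic_mat_def
proof (intro conjI ballI allI impI)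
  fix i j assume ij: "i < m" "j < p"
  show "holomorphic_several (\<lambda>z. (F z * G z) $$ (i, j)) S"
  proof (rule holomorphic_several_cong[OF assms(1)])
    show "holomorphic_several (\<lambda>z. \<Sum>k<n. F z $$ (i, k) * G z $$ (k, j)) S"
      using holomorphic_matD(2)[OF assms(2)] holomorphic_matD(2)[OF assms(3)] ij
      by (intro holomorphic_several_sum holomorphic_several_mult) auto
    fix z assume "z \<in> S"
    from mult_mat_index_sum[OF holomorphic_matD(1)[OF assms(2) this] holomorphic_matD(1)[OF assms(3) this] ij]
    show "(\<Sum>k<n. F z $$ (i, k) * G z $$ (k, j)) = (F z * G z) $$ (i, j)" by simp
  qed
qed (use holomorphic_matD(1)[OF assms(2)] holomorphic_matD(1)[OF assms(3)] mult_carrier_mat in blast)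

lemma holomorphic_several_det:
  assumes "open S" "holomorphic_mat n n F S"
  shows "holomorphic_several (\<lambda>z. det (F z)) S"
proof (rule holomorphic_several_cong[OF assms(1)])
  show "holomorphic_several (\<lambda>z. \<Sum>p\<in>{p. p permutes {0..<n}}. signof p * (\<Prod>i = 0..<n. F z $$ (i, p i))) S"
  proof (intro holomorphic_several_sum holomorphic_several_mult holomorphic_several_const holomorphic_several_prod)
    fix p i assume "p \<in> {p. p permutes {0..<n}}" "i \<in> {0..<n}"
    then show "holomorphic_several (\<lambda>z. F z $$ (i, p i)) S"
      by (intro holomorphic_matD(2)[OF assms(2)]) (auto simp: permutes_in_image)
  qed
qed (simp add: det_def'[OF holomorphic_matD(1)[OF assms(2)]])

lemma holomorphic_several_cofactor:
  assumes "open S" "holomorphic_mat n n F S" "i < n" "j < n"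
  shows "holomorphic_several (\<lambda>z. cofactor (F z) i j) S"
proof -
  have "holomorphic_mat (n - 1) (n - 1) (\<lambda>z. mat_delete (F z) i j) S"
    unfolding holomorphic_mat_def
  proof (intro conjI ballI allI impI)
    fix z assume "z \<in> S"
    then show "mat_delete (F z) i j \<in> carrier_mat (n - 1) (n - 1)"
      using holomorphic_matD(1)[OF assms(2)] by (intro mat_delete_carrier) auto
  next
    fix k l assume kl: "k < n - 1" "l < n - 1"
    let ?k = "if k < i then k else Suc k" and ?l = "if l < j then l else Suc l"
    show "holomorphic_several (\<lambda>z. mat_delete (F z) i j $$ (k, l)) S"
    proof (rule holomorphic_several_cong[OF assms(1)])
      show "holomorphic_several (\<lambda>z. F z $$ (?k, ?l)) S"
        by (rule holomorphic_matD(2)[OF assms(2)]) (use kl in auto)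
      fix z assume "z \<in> S"
      from holomorphic_matD(1)[OF assms(2) this]
      show "F z $$ (?k, ?l) = mat_delete (F z) i j $$ (k, l)"
        using kl by (simp add: mat_delete_def)
    qed
  qed
  from holomorphic_several_det[OF assms(1) this] show ?thesis
    unfolding cofactor_def by (intro holomorphic_several_mult holomorphic_several_const)
qed

text \<open>Cramer's rule: applying \<open>J\<close> to \<open>A * adj_mat A\<close>, the scalar
  matrix of \<open>det A\<close>, gives \<open>adj_mat A = det A \<cdot>\<^sub>m J\<close>. Entries
  of the inverse thereby become quotients of polynomials in the entries of \<open>A\<close>.\<close>

lemma left_inverse_entry:
  fixes A :: "complex mat"
  assumes A: "A \<in> carrier_mat n n" and J: "J \<in> carrier_mat n n" "J * A = 1\<^sub>m n" and ij: "i < n" "j < n"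
  shows "det A \<noteq> 0" "J $$ (i, j) = inverse (det A) * cofactor A j i"
proof -
  have "det J * det A = 1" using det_mult[OF J(1) A] J(2) by simp
  then show 0: "det A \<noteq> 0" by auto
  have "adj_mat A = (J * A) * adj_mat A" using adj_mat(1)[OF A] J(2) by simp
  also have "\<dots> = J * (A * adj_mat A)" by (rule assoc_mult_mat[OF J(1) A adj_mat(1)[OF A]])
  also have "\<dots> = det A \<cdot>\<^sub>m J" unfolding adj_mat(2)[OF A]
    using J(1) by (simp add: mult_smult_distrib[OF J(1) one_carrier_mat])
  finally have "adj_mat A $$ (i, j) = (det A \<cdot>\<^sub>m J) $$ (i, j)" by simp
  then have "cofactor A j i = det A * J $$ (i, j)"
    using ij A J(1) by (simp add: adj_mat_def)
  then show "J $$ (i, j) = inverse (det A) * cofactor A j i" using 0 by simp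
qed

lemma holomorphic_mat_left_inverse:
  assumes S: "open S" and F: "holomorphic_mat n n F S"
    and J: "\<And>z. z \<in> S \<Longrightarrow> J z \<in> carrier_mat n n" "\<And>z. z \<in> S \<Longrightarrow> J z * F z = 1\<^sub>m n"
  shows "holomorphic_mat n n J S"
  unfolding holomorphic_mat_def
proof (intro conjI ballI allI impI J(1))
  fix i j assume ij: "i < n" "j < n"
  note entry = left_inverse_entry[OF holomorphic_matD(1)[OF F] J ij]
  show "holomorphic_several (\<lambda>z. J z $$ (i, j)) S"
    by (rule holomorphic_several_cong[OF S, of "\<lambda>z. inverse (det (F z)) * cofactor (F z) j i"])
       (use entry ij in \<open>auto intro!: holomorphic_several_mult holomorphic_several_inverse
          holomorphic_several_det[OF S F] holomorphic_several_cofactor[OF S F]\<close>)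
qed

lemma holomorphic_mobius_mat:
  assumes S: "open S" and F: "holomorphic_mat s r F S" and lt: "\<And>z. z \<in> S \<Longrightarrow> op_norm (F z) < 1"
    and B: "B \<in> carrier_mat s r" "op_norm B < 1"
  shows "holomorphic_mat s r (\<lambda>z. mobius_mat s r (F z) B) S"
proof -
  have B': "mat_adjoint B \<in> carrier_mat r s" "op_norm (mat_adjoint B) < 1"
    using B op_norm_adjoint_lt_1 by auto
  have BB: "mat_adjoint B * B \<in> carrier_mat r r" "mat_adjoint (mat_adjoint B * B) = mat_adjoint B * B"
    "op_norm (mat_adjoint B * B) < 1"
    "B * mat_adjoint B \<in> carrier_mat s s" "mat_adjoint (B * mat_adjoint B) = B * mat_adjoint B"
    "op_norm (B * mat_adjoint B) < 1"
    using B B' op_norm_mult_lt_1[OF B'(1) B(1)] op_norm_mult_lt_1[OF B(1) B'(1)]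
    by (auto simp: mat_adjoint_mult[OF B'(1) B(1)] mat_adjoint_mult[OF B(1) B'(1)])
  have H: "holomorphic_mat r r (\<lambda>z. 1\<^sub>m r - mat_adjoint B * F z) S"
    by (intro holomorphic_mat_minus holomorphic_mat_mult[OF S _ F] holomorphic_mat_const S B'(1)) simp
  have K: "holomorphic_mat r r (\<lambda>z. mat_inv (1\<^sub>m r - mat_adjoint B * F z)) S"
  proof (rule holomorphic_mat_left_inverse[OF S H])
    fix z assume z: "z \<in> S"
    have "mat_adjoint B * F z \<in> carrier_mat r r" "op_norm (mat_adjoint B * F z) < 1"
      using B'(1) holomorphic_matD(1)[OF F z] op_norm_mult_lt_1[OF B'(1) _ B'(2) lt[OF z]] by auto
    from one_minus_inv[OF this]
    show "mat_inv (1\<^sub>m r - mat_adjoint B * F z) \<in> carrier_mat r r"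
      "mat_inv (1\<^sub>m r - mat_adjoint B * F z) * (1\<^sub>m r - mat_adjoint B * F z) = 1\<^sub>m r" by blast+
  qed
  show ?thesis
    unfolding mobius_mat_def
    by (rule holomorphic_mat_mult[OF S holomorphic_mat_mult[OF S holomorphic_mat_mult[OF S
          holomorphic_mat_const[OF mat_sqrt_inv(1)[OF BB(4-6)]]
          holomorphic_mat_minus[OF S F holomorphic_mat_const[OF B(1)]]] K]
          holomorphic_mat_const[OF mat_sqrt_one_minus(1)[OF BB(1-3)]]])
qed

text \<open>Rests on \<open>|1 - cnj \<beta> \<alpha>|\<^sup>2 - |\<alpha> - \<beta>|\<^sup>2 = (1 -
  |\<alpha>|\<^sup>2) (1 - |\<beta>|\<^sup>2)\<close>. The bound makes the real supremum in
  \<open>mobius_dist\<close> meaningful.\<close>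

lemma disk_dist_le_1:
  assumes "cmod \<alpha> < 1" "cmod \<beta> < 1"
  shows "disk_dist \<alpha> \<beta> \<le> 1"
proof -
  have "(cmod (1 - cnj \<beta> * \<alpha>))\<^sup>2 - (cmod (\<alpha> - \<beta>))\<^sup>2 = (1 - (cmod \<alpha>)\<^sup>2) * (1 - (cmod \<beta>)\<^sup>2)"
    unfolding cmod_power2 minus_complex.sel one_complex.sel times_complex.sel cnj.sel
    by (simp only: power2_eq_square) (simp add: algebra_simps)
  moreover have "0 \<le> (1 - (cmod \<alpha>)\<^sup>2) * (1 - (cmod \<beta>)\<^sup>2)"
    using power_le_one[of "cmod \<alpha>" 2] power_le_one[of "cmod \<beta>" 2] assms
    by (intro mult_nonneg_nonneg) simp_all
  ultimately have "(cmod (\<alpha> - \<beta>))\<^sup>2 \<le> (cmod (1 - cnj \<beta> * \<alpha>))\<^sup>2" by linarith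
  then have "cmod (\<alpha> - \<beta>) \<le> cmod (1 - cnj \<beta> * \<alpha>)" by (rule power2_le_imp_le) simp
  then show ?thesis
    unfolding disk_dist_def norm_divide by (simp add: divide_le_eq_1)
qed

lemma mobius_dist_upper:
  assumes "z \<in> \<Omega>" "w \<in> \<Omega>" "holomorphic_several f \<Omega>" "f ` \<Omega> \<subseteq> ball 0 1"
  shows "disk_dist (f z) (f w) \<le> mobius_dist \<Omega> z w"
  unfolding mobius_dist_def
proof (rule cSup_upper)
  show "bdd_above {disk_dist (f z) (f w) |f. holomorphic_several f \<Omega> \<and> f ` \<Omega> \<subseteq> ball 0 1}"
    using assms(1,2) by (intro bdd_aboveI[of _ 1]) (auto simp: image_subset_iff intro!: disk_dist_le_1)
qed (use assms in auto)

lemma mobius_dist_nonneg: "z \<in> \<Omega> \<Longrightarrow> w \<in> \<Omega> \<Longrightarrow> 0 \<le> mobius_dist \<Omega> z w"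
  using mobius_dist_upper[of z \<Omega> w "\<lambda>_. 0"] by (simp add: disk_dist_def image_subset_iff)

lemma op_norm_leI_unit:
  assumes A: "A \<in> carrier_mat m n" and c: "0 \<le> c"
    and le: "\<And>x. x \<in> carrier_vec n \<Longrightarrow> l2_norm x = 1 \<Longrightarrow> l2_norm (A *\<^sub>v x) \<le> c"
  shows "op_norm A \<le> c"
proof (rule op_norm_leI[OF A c])
  fix x :: "complex Matrix.vec" assume x: "x \<in> carrier_vec n"
  show "l2_norm (A *\<^sub>v x) \<le> c * l2_norm x"
  proof (cases "l2_norm x = 0")
    case True
    then have "x = 0\<^sub>v n" using x l2_norm_eq_0 by blast
    then show ?thesis using mult_mat_vec_zero[OF A] by simp
  next
    case False
    define t where "t = complex_of_real (1 / l2_norm x)"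
    have pos: "0 < l2_norm x" using False l2_norm_nonneg[of x] by linarith
    have t: "cmod t = 1 / l2_norm x" using pos by (simp add: t_def norm_divide)
    have "l2_norm (A *\<^sub>v (t \<cdot>\<^sub>v x)) \<le> c"
      by (rule le) (use x t pos in \<open>auto simp: l2_norm_smult\<close>)
    then show ?thesis
      unfolding mult_mat_vec[OF A x] l2_norm_smult t using pos by (simp add: divide_le_eq)
  qed
qed

text \<open>
  Pairing the matrix Moebius transform of \<open>F\<close> with unit vectors gives scalar competitors for the
  Moebius distance that vanish at \<open>w\<close>.
\<close>

lemma op_norm_mobius_mat_le:
  assumes S: "open S" and F: "holomorphic_mat s r F S" and lt: "\<And>\<zeta>. \<zeta> \<in> S \<Longrightarrow> op_norm (F \<zeta>) < 1"
    and zw: "z \<in> S" "w \<in> S"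
  shows "op_norm (mobius_mat s r (F z) (F w)) \<le> mobius_dist S z w"
proof (rule op_norm_leI_unit)
  note Fc = holomorphic_matD(1)[OF F]
  note C = mobius_mat_carrier[OF Fc lt Fc[OF zw(2)] lt[OF zw(2)]]
  show "mobius_mat s r (F z) (F w) \<in> carrier_mat s r" using C zw(1) by blast
  show "0 \<le> mobius_dist S z w" using zw by (rule mobius_dist_nonneg)
  fix x assume x: "x \<in> carrier_vec r" "l2_norm x = 1"
  define C where "C \<zeta> = mobius_mat s r (F \<zeta>) (F w)" for \<zeta>
  have Cc: "C \<zeta> \<in> carrier_mat s r" if "\<zeta> \<in> S" for \<zeta> using C that by (simp add: C_def)
  have Cx: "C \<zeta> *\<^sub>v x \<in> carrier_vec s" if "\<zeta> \<in> S" for \<zeta> using Cc[OF that] x by auto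
  have Clt: "l2_norm (C \<zeta> *\<^sub>v x) < 1" if "\<zeta> \<in> S" for \<zeta>
    unfolding C_def by (rule mobius_mat_contractive) (use that zw Fc lt x in auto)
  have "l2_norm (C z *\<^sub>v x) \<le> mobius_dist S z w"
  proof (cases "l2_norm (C z *\<^sub>v x) = 0")
    case True
    then show ?thesis using zw mobius_dist_nonneg[of z S w] by simp
  next
    case False
    define n where "n = l2_norm (C z *\<^sub>v x)"
    have n: "0 < n" using False l2_norm_nonneg[of "C z *\<^sub>v x"] unfolding n_def by linarith
    \<comment> \<open>The unit vector in the direction of \<open>C z x\<close>, where Cauchy-Schwarz
      is sharp: it gives \<open>\<phi> z = n\<close>. The case \<open>C z x = 0\<close> was split
      off to permit this normalization.\<close>
    define y where "y = complex_of_real (1 / n) \<cdot>\<^sub>v (C z *\<^sub>v x)"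
    have y: "y \<in> carrier_vec s" "l2_norm y = 1"
      using Cx[OF zw(1)] n by (auto simp: y_def l2_norm_smult norm_divide n_def[symmetric])
    define \<phi> where "\<phi> \<zeta> = (C \<zeta> *\<^sub>v x) \<bullet>c y" for \<zeta>
    have \<phi>_hol: "holomorphic_several \<phi> S"
    proof (rule holomorphic_several_cong[OF S])
      have H: "holomorphic_mat s r C S"
        unfolding C_def by (rule holomorphic_mobius_mat[OF S F lt]) (use zw Fc lt in auto)
      show "holomorphic_several (\<lambda>\<zeta>. \<Sum>i<s. (\<Sum>j<r. C \<zeta> $$ (i, j) * x $ j) * cnj (y $ i)) S"
        using holomorphic_matD(2)[OF H]
        by (intro holomorphic_several_sum holomorphic_several_mult holomorphic_several_const) auto
      fix \<zeta> assume \<zeta>: "\<zeta> \<in> S"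
      have "\<phi> \<zeta> = (\<Sum>i<s. (C \<zeta> *\<^sub>v x) $ i * cnj (y $ i))"
        unfolding \<phi>_def by (rule cinner_sum[OF Cx[OF \<zeta>] y(1)])
      also have "\<dots> = (\<Sum>i<s. (\<Sum>j<r. C \<zeta> $$ (i, j) * x $ j) * cnj (y $ i))"
        by (rule sum.cong[OF refl]) (simp add: mult_mat_vec_sum[OF Cc[OF \<zeta>] x(1)] del: index_mult_mat_vec)
      finally show "(\<Sum>i<s. (\<Sum>j<r. C \<zeta> $$ (i, j) * x $ j) * cnj (y $ i)) = \<phi> \<zeta>" ..
    qed
    have \<phi>_disk: "\<phi> ` S \<subseteq> ball 0 1"
    proof safe
      fix \<zeta> assume \<zeta>: "\<zeta> \<in> S"
      have "cmod (\<phi> \<zeta>) \<le> l2_norm (C \<zeta> *\<^sub>v x) * l2_norm y"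
        unfolding \<phi>_def by (rule cinner_Cauchy_Schwarz[OF Cx[OF \<zeta>] y(1)])
      with Clt[OF \<zeta>] y(2) show "\<phi> \<zeta> \<in> ball 0 1" by simp
    qed
    \<comment> \<open>At \<open>w\<close> the factor \<open>F w - F w\<close> vanishes. Then
      \<open>\<phi> w = 0\<close>, and the disk distance reduces to
      \<open>cmod (\<phi> z)\<close>.\<close>
    have "C w *\<^sub>v x = 0\<^sub>v s"
    proof -
      note Fw = Fc[OF zw(2)] lt[OF zw(2)]
      have B': "mat_adjoint (F w) \<in> carrier_mat r s" "op_norm (mat_adjoint (F w)) < 1"
        using Fw op_norm_adjoint_lt_1 by auto
      have X: "F w * mat_adjoint (F w) \<in> carrier_mat s s"
        "mat_adjoint (F w * mat_adjoint (F w)) = F w * mat_adjoint (F w)"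
        "op_norm (F w * mat_adjoint (F w)) < 1"
        using Fw B' op_norm_mult_lt_1[OF Fw(1) B'(1)] by (auto simp: mat_adjoint_mult[OF Fw(1) B'(1)])
      have 0: "F w - F w = 0\<^sub>m s r" using Fw(1) by (intro eq_matI) auto
      have K: "mat_inv (1\<^sub>m r - mat_adjoint (F w) * F w) \<in> carrier_mat r r"
        "mat_sqrt (1\<^sub>m r - mat_adjoint (F w) * F w) \<in> carrier_mat r r"
        using one_minus_inv(1)[of "mat_adjoint (F w) * F w" r] mat_sqrt_one_minus(1)[of "mat_adjoint (F w) * F w" r]
          Fw B' op_norm_mult_lt_1[OF B'(1) Fw(1)] by (auto simp: mat_adjoint_mult[OF B'(1) Fw(1)])
      have v: "mat_inv (1\<^sub>m r - mat_adjoint (F w) * F w) *\<^sub>v (mat_sqrt (1\<^sub>m r - mat_adjoint (F w) * F w) *\<^sub>v x) \<in> carrier_vec r"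
        (is "?v \<in> _")
        by (rule mult_mat_vec_carrier[OF K(1) mult_mat_vec_carrier[OF K(2) x(1)]])
      have "(F w - F w) *\<^sub>v ?v = 0\<^sub>v s" unfolding 0 using v by (intro eq_vecI) auto
      then show ?thesis
        unfolding C_def mobius_mat_mult_vec[OF Fw Fw x(1)] using mult_mat_vec_zero[OF mat_sqrt_inv(1)[OF X]] by simp
    qed
    then have \<phi>w: "\<phi> w = 0" using y(1) by (simp add: \<phi>_def)
    have "\<phi> z = complex_of_real n"
    proof -
      have "\<phi> z = complex_of_real (1 / n) * ((C z *\<^sub>v x) \<bullet>c (C z *\<^sub>v x))"
        unfolding \<phi>_def y_def cinner_smult_right[OF Cx[OF zw(1)] Cx[OF zw(1)]] by simp
      also have "\<dots> = complex_of_real (1 / n * n\<^sup>2)"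
        unfolding cinner_self n_def[symmetric] of_real_mult ..
      also have "1 / n * n\<^sup>2 = n" using n by (simp add: power2_eq_square)
      finally show ?thesis .
    qed
    then have "disk_dist (\<phi> z) (\<phi> w) = n" using n \<phi>w by (simp add: disk_dist_def)
    then show ?thesis using mobius_dist_upper[OF zw \<phi>_hol \<phi>_disk] by (simp add: n_def)
  qed
  then show "l2_norm (mobius_mat s r (F z) (F w) *\<^sub>v x) \<le> mobius_dist S z w" by (simp add: C_def)
qed

text \<open>The entries of \<open>\<Delta>\<close> are continuous and their differences dominate the
  operator norm of the change, so near a point \<open>x\<close> of the set the norm cannot use up
  the margin \<open>1 - op_norm (\<Delta> x)\<close>.\<close>

lemma open_B_Delta:
  assumes E: "open E" and F: "holomorphic_mat s r \<Delta> E"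
  shows "open (B_Delta E \<Delta>)"
proof (subst open_subopen, intro ballI)
  fix x assume "x \<in> B_Delta E \<Delta>"
  then have x: "x \<in> E" "op_norm (\<Delta> x) < 1" by (auto simp: B_Delta_def)
  note Fc = holomorphic_matD(1)[OF F]
  have lim: "((\<lambda>\<zeta>. \<Delta> \<zeta> $$ (i, j)) \<longlongrightarrow> \<Delta> x $$ (i, j)) (nhds x)" if ij: "i < s" "j < r" for i j
  proof -
    obtain f' where "((\<lambda>\<zeta>. \<Delta> \<zeta> $$ (i, j)) has_derivative f') (at x)"
      using holomorphic_matD(2)[OF F ij] x(1) unfolding holomorphic_several_def by blast
    then have "isCont (\<lambda>\<zeta>. \<Delta> \<zeta> $$ (i, j)) x" by (rule has_derivative_continuous)
    then show ?thesis
      unfolding isCont_def tendsto_at_iff_tendsto_nhds[of "\<lambda>\<zeta>. \<Delta> \<zeta> $$ (i, j)" x] .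
  qed
  have "((\<lambda>\<zeta>. \<Sum>i<s. \<Sum>j<r. cmod (\<Delta> \<zeta> $$ (i, j) - \<Delta> x $$ (i, j))) \<longlongrightarrow>
      (\<Sum>i<s. \<Sum>j<r. cmod (\<Delta> x $$ (i, j) - \<Delta> x $$ (i, j)))) (nhds x)"
    by (intro tendsto_sum tendsto_norm tendsto_diff lim tendsto_const) auto
  then have "((\<lambda>\<zeta>. \<Sum>i<s. \<Sum>j<r. cmod (\<Delta> \<zeta> $$ (i, j) - \<Delta> x $$ (i, j))) \<longlongrightarrow> 0) (nhds x)" by simp
  then have "\<forall>\<^sub>F \<zeta> in nhds x. (\<Sum>i<s. \<Sum>j<r. cmod (\<Delta> \<zeta> $$ (i, j) - \<Delta> x $$ (i, j))) < 1 - op_norm (\<Delta> x)"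
    by (rule order_tendstoD) (use x in simp)
  moreover have "\<forall>\<^sub>F \<zeta> in nhds x. \<zeta> \<in> E" using E x(1) by (rule eventually_nhds_in_open)
  ultimately have "\<forall>\<^sub>F \<zeta> in nhds x. \<zeta> \<in> B_Delta E \<Delta>"
  proof eventually_elim
    case (elim \<zeta>)
    note c = Fc[OF x(1)] Fc[OF elim(2)]
    have "\<Delta> \<zeta> = \<Delta> x + (\<Delta> \<zeta> - \<Delta> x)" using c by (intro eq_matI) auto
    then have "op_norm (\<Delta> \<zeta>) \<le> op_norm (\<Delta> x) + op_norm (\<Delta> \<zeta> - \<Delta> x)"
      using op_norm_triangle[OF c(1) minus_carrier_mat[OF c(1)], of "\<Delta> \<zeta>"] by metis
    also have "op_norm (\<Delta> \<zeta> - \<Delta> x) \<le> (\<Sum>i<s. \<Sum>j<r. cmod (\<Delta> \<zeta> $$ (i, j) - \<Delta> x $$ (i, j)))"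
      using op_norm_le_sum_entries[of "\<Delta> \<zeta> - \<Delta> x"] c by simp
    finally show ?case using elim by (simp add: B_Delta_def)
  qed
  then show "\<exists>T. open T \<and> x \<in> T \<and> T \<subseteq> B_Delta E \<Delta>" by (auto simp: eventually_nhds)
qed

section \<open>The functional calculus\<close>

lemma dim_tensor_vec [simp]: "dim_vec (tensor_vec e v) = dim_vec e * dim_vec v"
  by (simp add: tensor_vec_def)

lemma tensor_vec_carrier [simp]: "e \<in> carrier_vec n \<Longrightarrow> v \<in> carrier_vec m \<Longrightarrow> tensor_vec e v \<in> carrier_vec (n * m)"
  by (rule carrier_vecI) simp

lemma tensor_vec_index:
  "e \<in> carrier_vec n \<Longrightarrow> v \<in> carrier_vec 2 \<Longrightarrow> k < n * 2 \<Longrightarrow>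
    tensor_vec e v $ k = e $ (k div 2) * v $ (k mod 2)"
  by (simp add: tensor_vec_def)

lemma div2_less: "k < n * 2 \<Longrightarrow> k div 2 < (n::nat)"
  by linarith

lemma sum_pairs: "(\<Sum>k<n * 2. f k) = (\<Sum>i<n. f (i * 2) + f (Suc (i * 2)))" for f :: "nat \<Rightarrow> complex"
  by (simp add: sum.nat_group[symmetric])

lemma Suc_double_mod_2 [simp]: "Suc (i * 2) mod 2 = Suc 0"
  by presburger

lemma tensor_vec_cinner:
  assumes "e \<in> carrier_vec n" "e' \<in> carrier_vec n" "v \<in> carrier_vec 2" "v' \<in> carrier_vec 2"
  shows "tensor_vec e v \<bullet>c tensor_vec e' v' = (e \<bullet>c e') * (v \<bullet>c v')"
proof -
  have "tensor_vec e v \<bullet>c tensor_vec e' v' = (\<Sum>k<n * 2. tensor_vec e v $ k * cnj (tensor_vec e' v' $ k))"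
    using assms by (intro cinner_sum) auto
  also have "\<dots> = (\<Sum>k<n * 2. e $ (k div 2) * v $ (k mod 2) * cnj (e' $ (k div 2) * v' $ (k mod 2)))"
    by (rule sum.cong) (use assms in \<open>auto simp: tensor_vec_index\<close>)
  also have "\<dots> = (\<Sum>i<n. e $ i * cnj (e' $ i) * (v $ 0 * cnj (v' $ 0) + v $ 1 * cnj (v' $ 1)))"
    unfolding sum_pairs by (rule sum.cong) (auto simp: algebra_simps)
  also have "\<dots> = (e \<bullet>c e') * (v \<bullet>c v')"
    unfolding cinner_sum[OF assms(1,2)] cinner_sum[OF assms(3,4)] sum_distrib_right
    by (simp add: numeral_2_eq_2)
  finally show ?thesis .
qed

lemma tensor_vec_lincomb_right:
  assumes "e \<in> carrier_vec n" "v \<in> carrier_vec 2" "v' \<in> carrier_vec 2"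
  shows "tensor_vec e (a \<cdot>\<^sub>v v + b \<cdot>\<^sub>v v') = a \<cdot>\<^sub>v tensor_vec e v + b \<cdot>\<^sub>v tensor_vec e v'"
proof (rule eq_vecI)
  fix k assume "k < dim_vec (a \<cdot>\<^sub>v tensor_vec e v + b \<cdot>\<^sub>v tensor_vec e v')"
  then have k: "k < n * 2" using assms by simp
  have "(k mod 2) < 2" by simp
  then show "tensor_vec e (a \<cdot>\<^sub>v v + b \<cdot>\<^sub>v v') $ k = (a \<cdot>\<^sub>v tensor_vec e v + b \<cdot>\<^sub>v tensor_vec e v') $ k"
    using assms k by (simp add: tensor_vec_index[of _ n] algebra_simps del: mod_less_divisor)
qed (use assms in auto)

text \<open>The determinant of the matrix with columns \<open>v\<^sub>1\<close>,
  \<open>v\<^sub>2\<close>. If it vanished, the coefficient pairs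
  \<open>(v\<^sub>2 $ 1, - v\<^sub>1 $ 1)\<close> and
  \<open>(v\<^sub>2 $ 0, - v\<^sub>1 $ 0)\<close> would give linear relations, so both vectors would
  be zero.\<close>

lemma joint_eigenbasis_wronskian:
  assumes "joint_eigenbasis T v\<^sub>1 v\<^sub>2 z\<^sub>1 z\<^sub>2"
  shows "v\<^sub>1 $ 0 * v\<^sub>2 $ 1 - v\<^sub>1 $ 1 * v\<^sub>2 $ 0 \<noteq> 0"
proof
  assume 0: "v\<^sub>1 $ 0 * v\<^sub>2 $ 1 - v\<^sub>1 $ 1 * v\<^sub>2 $ 0 = 0"
  have v: "v\<^sub>1 \<in> carrier_vec 2" "v\<^sub>2 \<in> carrier_vec 2"
    and ind: "\<And>a b. a \<cdot>\<^sub>v v\<^sub>1 + b \<cdot>\<^sub>v v\<^sub>2 = 0\<^sub>v 2 \<Longrightarrow> a = 0 \<and> b = 0"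
    using assms by (auto simp: joint_eigenbasis_def joint_eigenvector_def)
  have ind': "a = 0 \<and> b = 0"
    if "a * v\<^sub>1 $ 0 + b * v\<^sub>2 $ 0 = 0" "a * v\<^sub>1 $ 1 + b * v\<^sub>2 $ 1 = 0" for a b
    by (rule ind, rule eq_vecI) (use v that in \<open>auto simp: less_2_cases_iff\<close>)
  have "v\<^sub>2 $ 1 = 0 \<and> - v\<^sub>1 $ 1 = 0" by (rule ind') (use 0 in \<open>simp_all add: algebra_simps\<close>)
  moreover have "v\<^sub>2 $ 0 = 0 \<and> - v\<^sub>1 $ 0 = 0" by (rule ind') (use 0 in \<open>simp_all add: algebra_simps\<close>)
  ultimately show False using ind'[of 1 0] by simp
qed

text \<open>Cramer's rule in each block \<open>(x $ (2 i), x $ (2 i + 1))\<close>, which is a vector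
  of the second tensor factor.\<close>

lemma joint_eigenbasis_span:
  assumes "joint_eigenbasis T v\<^sub>1 v\<^sub>2 z\<^sub>1 z\<^sub>2" and x: "x \<in> carrier_vec (n * 2)"
  obtains e\<^sub>1 e\<^sub>2 where "e\<^sub>1 \<in> carrier_vec n" "e\<^sub>2 \<in> carrier_vec n" "x = tensor_vec e\<^sub>1 v\<^sub>1 + tensor_vec e\<^sub>2 v\<^sub>2"
proof -
  have v: "v\<^sub>1 \<in> carrier_vec 2" "v\<^sub>2 \<in> carrier_vec 2"
    using assms by (auto simp: joint_eigenbasis_def joint_eigenvector_def)
  define d where "d = v\<^sub>1 $ 0 * v\<^sub>2 $ 1 - v\<^sub>1 $ 1 * v\<^sub>2 $ 0"
  have d: "d \<noteq> 0" using joint_eigenbasis_wronskian[OF assms(1)] by (simp add: d_def)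
  define e\<^sub>1 where "e\<^sub>1 = Matrix.vec n (\<lambda>i. (x $ (2 * i) * v\<^sub>2 $ 1 - x $ (2 * i + 1) * v\<^sub>2 $ 0) / d)"
  define e\<^sub>2 where "e\<^sub>2 = Matrix.vec n (\<lambda>i. (x $ (2 * i + 1) * v\<^sub>1 $ 0 - x $ (2 * i) * v\<^sub>1 $ 1) / d)"
  have e: "e\<^sub>1 \<in> carrier_vec n" "e\<^sub>2 \<in> carrier_vec n" by (simp_all add: e\<^sub>1_def e\<^sub>2_def)
  have "x = tensor_vec e\<^sub>1 v\<^sub>1 + tensor_vec e\<^sub>2 v\<^sub>2"
  proof (rule eq_vecI)
    fix k assume "k < dim_vec (tensor_vec e\<^sub>1 v\<^sub>1 + tensor_vec e\<^sub>2 v\<^sub>2)"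
    then have k: "k < n * 2" using e v by simp
    let ?i = "k div 2"
    have i: "?i < n" using k by (rule div2_less)
    have "(tensor_vec e\<^sub>1 v\<^sub>1 + tensor_vec e\<^sub>2 v\<^sub>2) $ k = e\<^sub>1 $ ?i * v\<^sub>1 $ (k mod 2) + e\<^sub>2 $ ?i * v\<^sub>2 $ (k mod 2)"
      using e v k by (simp add: tensor_vec_index[of _ n])
    also have "\<dots> = ((x $ (2 * ?i) * v\<^sub>2 $ 1 - x $ (2 * ?i + 1) * v\<^sub>2 $ 0) * v\<^sub>1 $ (k mod 2)
        + (x $ (2 * ?i + 1) * v\<^sub>1 $ 0 - x $ (2 * ?i) * v\<^sub>1 $ 1) * v\<^sub>2 $ (k mod 2)) / d"
      using i by (simp add: e\<^sub>1_def e\<^sub>2_def add_divide_distrib)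
    also have "\<dots> = x $ k * d / d"
    proof (cases "even k")
      case True
      then have "k mod 2 = 0" "2 * ?i = k" by auto
      then show ?thesis by (simp add: d_def algebra_simps)
    next
      case False
      then have "k mod 2 = 1" "2 * ?i + 1 = k" by (auto simp: odd_iff_mod_2_eq_one)
      then show ?thesis by (simp add: d_def algebra_simps)
    qed
    finally show "x $ k = (tensor_vec e\<^sub>1 v\<^sub>1 + tensor_vec e\<^sub>2 v\<^sub>2) $ k" using d by simp
  qed (use e v x in auto)
  with e that show thesis by blast
qed

text \<open>\<open>M\<close> is the Kronecker product of \<open>G\<close> with the rank one matrix
  that sends \<open>v\<close> to \<open>(a 0 * v $ 0 + a 1 * v $ 1)\<close> times
  \<open>p\<close>.\<close>

lemma kronecker_rank_one_apply:
  fixes G :: "complex mat" and p a :: "nat \<Rightarrow> complex"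
  assumes G: "G \<in> carrier_mat m n" and e: "e \<in> carrier_vec n" and v: "v \<in> carrier_vec 2"
  defines "M \<equiv> mat (m * 2) (n * 2) (\<lambda>(k, l). G $$ (k div 2, l div 2) * p (k mod 2) * a (l mod 2))"
  assumes k: "k < m * 2"
  shows "(M *\<^sub>v tensor_vec e v) $ k = (G *\<^sub>v e) $ (k div 2) * p (k mod 2) * (a 0 * v $ 0 + a 1 * v $ 1)"
proof -
  have M: "M \<in> carrier_mat (m * 2) (n * 2)" by (simp add: M_def)
  have i: "k div 2 < m" using k by (rule div2_less)
  have "(M *\<^sub>v tensor_vec e v) $ k = (\<Sum>l<n * 2. M $$ (k, l) * tensor_vec e v $ l)"
    using e v k by (intro mult_mat_vec_sum[OF M]) auto
  also have "\<dots> = (\<Sum>l<n * 2. G $$ (k div 2, l div 2) * p (k mod 2) * a (l mod 2) * (e $ (l div 2) * v $ (l mod 2)))"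
    by (rule sum.cong) (use e v k in \<open>auto simp: tensor_vec_index M_def\<close>)
  also have "\<dots> = (\<Sum>j<n. G $$ (k div 2, j) * e $ j * (p (k mod 2) * (a 0 * v $ 0 + a 1 * v $ 1)))"
    unfolding sum_pairs by (rule sum.cong) (auto simp: algebra_simps)
  also have "\<dots> = (G *\<^sub>v e) $ (k div 2) * (p (k mod 2) * (a 0 * v $ 0 + a 1 * v $ 1))"
    unfolding mult_mat_vec_sum[OF G e i] sum_distrib_right ..
  finally show ?thesis by (simp add: mult.assoc)
qed

lemma fun_calc_exists:
  assumes eb: "joint_eigenbasis T v\<^sub>1 v\<^sub>2 z\<^sub>1 z\<^sub>2" and G: "G z\<^sub>1 \<in> carrier_mat m n" "G z\<^sub>2 \<in> carrier_mat m n"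
  shows "\<exists>M \<in> carrier_mat (m * 2) (n * 2). \<forall>e \<in> carrier_vec n.
      M *\<^sub>v tensor_vec e v\<^sub>1 = tensor_vec (G z\<^sub>1 *\<^sub>v e) v\<^sub>1 \<and> M *\<^sub>v tensor_vec e v\<^sub>2 = tensor_vec (G z\<^sub>2 *\<^sub>v e) v\<^sub>2"
proof -
  have v: "v\<^sub>1 \<in> carrier_vec 2" "v\<^sub>2 \<in> carrier_vec 2"
    using assms by (auto simp: joint_eigenbasis_def joint_eigenvector_def)
  define d where "d = v\<^sub>1 $ 0 * v\<^sub>2 $ 1 - v\<^sub>1 $ 1 * v\<^sub>2 $ 0"
  have d: "d \<noteq> 0" using joint_eigenbasis_wronskian[OF eb] by (simp add: d_def)
  \<comment> \<open>\<open>a\<close> and \<open>b\<close> are the basis dual to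
    \<open>v\<^sub>1\<close>, \<open>v\<^sub>2\<close>. Hence \<open>M\<^sub>1\<close> and
    \<open>M\<^sub>2\<close> are \<open>G z\<^sub>1\<close> and \<open>G z\<^sub>2\<close> tensored
    with the projections along the eigenbasis.\<close>
  define a where "a l = (if l = 0 then v\<^sub>2 $ 1 / d else - v\<^sub>2 $ 0 / d)" for l :: nat
  define b where "b l = (if l = 0 then - v\<^sub>1 $ 1 / d else v\<^sub>1 $ 0 / d)" for l :: nat
  define M\<^sub>1 where "M\<^sub>1 = mat (m * 2) (n * 2) (\<lambda>(k, l). G z\<^sub>1 $$ (k div 2, l div 2) * v\<^sub>1 $ (k mod 2) * a (l mod 2))"
  define M\<^sub>2 where "M\<^sub>2 = mat (m * 2) (n * 2) (\<lambda>(k, l). G z\<^sub>2 $$ (k div 2, l div 2) * v\<^sub>2 $ (k mod 2) * b (l mod 2))"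
  have M: "M\<^sub>1 \<in> carrier_mat (m * 2) (n * 2)" "M\<^sub>2 \<in> carrier_mat (m * 2) (n * 2)"
    by (simp_all add: M\<^sub>1_def M\<^sub>2_def)
  have dual: "a 0 * v\<^sub>1 $ 0 + a 1 * v\<^sub>1 $ 1 = 1" "a 0 * v\<^sub>2 $ 0 + a 1 * v\<^sub>2 $ 1 = 0"
    "b 0 * v\<^sub>1 $ 0 + b 1 * v\<^sub>1 $ 1 = 0" "b 0 * v\<^sub>2 $ 0 + b 1 * v\<^sub>2 $ 1 = 1"
    using d by (simp_all add: a_def b_def field_simps) (simp_all add: d_def algebra_simps)
  have app: "((M\<^sub>1 + M\<^sub>2) *\<^sub>v tensor_vec e v) $ k =
      (G z\<^sub>1 *\<^sub>v e) $ (k div 2) * v\<^sub>1 $ (k mod 2) * (a 0 * v $ 0 + a 1 * v $ 1) +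
      (G z\<^sub>2 *\<^sub>v e) $ (k div 2) * v\<^sub>2 $ (k mod 2) * (b 0 * v $ 0 + b 1 * v $ 1)"
    if "e \<in> carrier_vec n" "v \<in> carrier_vec 2" "k < m * 2" for e v k
  proof -
    have t: "tensor_vec e v \<in> carrier_vec (n * 2)" using that by simp
    have "((M\<^sub>1 + M\<^sub>2) *\<^sub>v tensor_vec e v) $ k = (M\<^sub>1 *\<^sub>v tensor_vec e v) $ k + (M\<^sub>2 *\<^sub>v tensor_vec e v) $ k"
      unfolding add_mult_distrib_mat_vec[OF M t] using M that(3) by (intro index_add_vec) auto
    then show ?thesis
      using kronecker_rank_one_apply[OF G(1) that(1,2), of k "\<lambda>i. v\<^sub>1 $ i" a, folded M\<^sub>1_def]
        kronecker_rank_one_apply[OF G(2) that(1,2), of k "\<lambda>i. v\<^sub>2 $ i" b, folded M\<^sub>2_def] that(3)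
      by simp
  qed
  show ?thesis
  proof (intro bexI ballI conjI)
    show Mc: "M\<^sub>1 + M\<^sub>2 \<in> carrier_mat (m * 2) (n * 2)" using M by simp
    fix e :: "complex Matrix.vec" assume e: "e \<in> carrier_vec n"
    have Ge: "G z\<^sub>1 *\<^sub>v e \<in> carrier_vec m" "G z\<^sub>2 *\<^sub>v e \<in> carrier_vec m" using G e by auto
    show "(M\<^sub>1 + M\<^sub>2) *\<^sub>v tensor_vec e v\<^sub>1 = tensor_vec (G z\<^sub>1 *\<^sub>v e) v\<^sub>1"
    proof (rule eq_vecI)
      fix k assume "k < dim_vec (tensor_vec (G z\<^sub>1 *\<^sub>v e) v\<^sub>1)"
      then have "k < m * 2" using Ge v G by simp
      then show "((M\<^sub>1 + M\<^sub>2) *\<^sub>v tensor_vec e v\<^sub>1) $ k = tensor_vec (G z\<^sub>1 *\<^sub>v e) v\<^sub>1 $ k"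
        unfolding app[OF e v(1) \<open>k < m * 2\<close>] tensor_vec_index[OF Ge(1) v(1) \<open>k < m * 2\<close>] dual
        by (simp only: mult_1_right mult_zero_right add_0_right)
    qed (use M Ge v G in auto)
    show "(M\<^sub>1 + M\<^sub>2) *\<^sub>v tensor_vec e v\<^sub>2 = tensor_vec (G z\<^sub>2 *\<^sub>v e) v\<^sub>2"
    proof (rule eq_vecI)
      fix k assume "k < dim_vec (tensor_vec (G z\<^sub>2 *\<^sub>v e) v\<^sub>2)"
      then have "k < m * 2" using Ge v G by simp
      then show "((M\<^sub>1 + M\<^sub>2) *\<^sub>v tensor_vec e v\<^sub>2) $ k = tensor_vec (G z\<^sub>2 *\<^sub>v e) v\<^sub>2 $ k"
        unfolding app[OF e v(2) \<open>k < m * 2\<close>] tensor_vec_index[OF Ge(2) v(2) \<open>k < m * 2\<close>] dual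
        by (simp only: mult_1_right mult_zero_right add_0_left)
    qed (use M Ge v G in auto)
  qed
qed

section \<open>Independence of the joint eigenbasis\<close>

lemma joint_eigenbasis_swap: "joint_eigenbasis T v\<^sub>1 v\<^sub>2 z\<^sub>1 z\<^sub>2 \<Longrightarrow> joint_eigenbasis T v\<^sub>2 v\<^sub>1 z\<^sub>2 z\<^sub>1"
proof -
  assume eb: "joint_eigenbasis T v\<^sub>1 v\<^sub>2 z\<^sub>1 z\<^sub>2"
  then have "v\<^sub>1 \<in> carrier_vec 2" "v\<^sub>2 \<in> carrier_vec 2"
    by (auto simp: joint_eigenbasis_def joint_eigenvector_def)
  then have "a \<cdot>\<^sub>v v\<^sub>2 + b \<cdot>\<^sub>v v\<^sub>1 = b \<cdot>\<^sub>v v\<^sub>1 + a \<cdot>\<^sub>v v\<^sub>2" for a b by (intro comm_add_vec) auto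
  then show ?thesis using eb unfolding joint_eigenbasis_def by metis
qed

lemma joint_eigenbasis_nonzero:
  assumes "joint_eigenbasis T v\<^sub>1 v\<^sub>2 z\<^sub>1 z\<^sub>2" shows "v\<^sub>1 \<noteq> 0\<^sub>v 2" "v\<^sub>2 \<noteq> 0\<^sub>v 2"
  using joint_eigenbasis_wronskian[OF assms] by auto

text \<open>Expanding \<open>T k v = z k v\<close> in the basis and comparing coefficients gives
  \<open>a (z k - z\<^sub>1 k) = 0\<close> and \<open>b (z k - z\<^sub>2 k) = 0\<close> for all
  \<open>k\<close>. The disjunctive form also covers \<open>z\<^sub>1 = z\<^sub>2\<close>, where
  \<open>v\<close> may mix both basis vectors.\<close>

lemma joint_eigenvector_decompose:
  assumes T: "\<And>k. T k \<in> carrier_mat 2 2" and eb: "joint_eigenbasis T v\<^sub>1 v\<^sub>2 z\<^sub>1 z\<^sub>2"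
    and ev: "joint_eigenvector T v z"
  obtains a b where "v = a \<cdot>\<^sub>v v\<^sub>1 + b \<cdot>\<^sub>v v\<^sub>2" "a = 0 \<or> z = z\<^sub>1" "b = 0 \<or> z = z\<^sub>2"
proof -
  have v: "v\<^sub>1 \<in> carrier_vec 2" "v\<^sub>2 \<in> carrier_vec 2" "v \<in> carrier_vec 2"
    and Tv: "\<And>k. T k *\<^sub>v v\<^sub>1 = vec_nth z\<^sub>1 k \<cdot>\<^sub>v v\<^sub>1" "\<And>k. T k *\<^sub>v v\<^sub>2 = vec_nth z\<^sub>2 k \<cdot>\<^sub>v v\<^sub>2"
      "\<And>k. T k *\<^sub>v v = vec_nth z k \<cdot>\<^sub>v v"
    and ind: "\<And>a b. a \<cdot>\<^sub>v v\<^sub>1 + b \<cdot>\<^sub>v v\<^sub>2 = 0\<^sub>v 2 \<Longrightarrow> a = 0 \<and> b = 0"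
    using eb ev by (auto simp: joint_eigenbasis_def joint_eigenvector_def)
  define d where "d = v\<^sub>1 $ 0 * v\<^sub>2 $ 1 - v\<^sub>1 $ 1 * v\<^sub>2 $ 0"
  have d: "d \<noteq> 0" using joint_eigenbasis_wronskian[OF eb] by (simp add: d_def)
  define a where "a = (v $ 0 * v\<^sub>2 $ 1 - v $ 1 * v\<^sub>2 $ 0) / d"
  define b where "b = (v $ 1 * v\<^sub>1 $ 0 - v $ 0 * v\<^sub>1 $ 1) / d"
  have v_eq: "v = a \<cdot>\<^sub>v v\<^sub>1 + b \<cdot>\<^sub>v v\<^sub>2"
  proof (rule eq_vecI)
    fix i assume "i < dim_vec (a \<cdot>\<^sub>v v\<^sub>1 + b \<cdot>\<^sub>v v\<^sub>2)"
    then have i: "i < 2" using v by simp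
    have "a * v\<^sub>1 $ i + b * v\<^sub>2 $ i = v $ i * d / d"
      using i[unfolded less_2_cases_iff]
      by (auto simp: a_def b_def add_divide_distrib[symmetric] d_def algebra_simps)
    then show "v $ i = (a \<cdot>\<^sub>v v\<^sub>1 + b \<cdot>\<^sub>v v\<^sub>2) $ i" using i v d by simp
  qed (use v in auto)
  have "a * (vec_nth z k - vec_nth z\<^sub>1 k) = 0 \<and> b * (vec_nth z k - vec_nth z\<^sub>2 k) = 0" for k
  proof (rule ind, rule eq_vecI)
    have 1: "T k *\<^sub>v v = a \<cdot>\<^sub>v (vec_nth z\<^sub>1 k \<cdot>\<^sub>v v\<^sub>1) + b \<cdot>\<^sub>v (vec_nth z\<^sub>2 k \<cdot>\<^sub>v v\<^sub>2)"
      unfolding v_eq Tv(1,2)[symmetric]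
      using mult_add_distrib_mat_vec[OF T[of k], of "a \<cdot>\<^sub>v v\<^sub>1" "b \<cdot>\<^sub>v v\<^sub>2"]
        mult_mat_vec[OF T[of k] v(1)] mult_mat_vec[OF T[of k] v(2)] v by simp
    fix i assume "i < dim_vec (0\<^sub>v 2 :: complex Matrix.vec)"
    then have i: "i < 2" by simp
    have "vec_nth z k * v $ i = a * vec_nth z\<^sub>1 k * v\<^sub>1 $ i + b * vec_nth z\<^sub>2 k * v\<^sub>2 $ i"
      using arg_cong[OF 1[unfolded Tv(3)], of "\<lambda>x. x $ i"] i v by simp
    moreover have "v $ i = a * v\<^sub>1 $ i + b * v\<^sub>2 $ i"
      using arg_cong[OF v_eq, of "\<lambda>x. x $ i"] i v by simp
    ultimately show "((a * (vec_nth z k - vec_nth z\<^sub>1 k)) \<cdot>\<^sub>v v\<^sub>1 + (b * (vec_nth z k - vec_nth z\<^sub>2 k)) \<cdot>\<^sub>v v\<^sub>2) $ i = 0\<^sub>v 2 $ i"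
      using i v by (simp add: algebra_simps)
  qed (use v in auto)
  then have "a = 0 \<or> z = z\<^sub>1" "b = 0 \<or> z = z\<^sub>2"
    by (auto simp: Finite_Cartesian_Product.vec_eq_iff)
  with v_eq that show thesis by blast
qed

lemma joint_eigenvalue_in_spectrum:
  assumes "\<And>k. T k \<in> carrier_mat 2 2" "joint_eigenbasis T v\<^sub>1 v\<^sub>2 z\<^sub>1 z\<^sub>2" "joint_eigenvector T v z" "v \<noteq> 0\<^sub>v 2"
  shows "z \<in> {z\<^sub>1, z\<^sub>2}"
proof -
  obtain a b where ab: "v = a \<cdot>\<^sub>v v\<^sub>1 + b \<cdot>\<^sub>v v\<^sub>2" "a = 0 \<or> z = z\<^sub>1" "b = 0 \<or> z = z\<^sub>2"
    using joint_eigenvector_decompose[OF assms(1-3)] .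
  have "v\<^sub>1 \<in> carrier_vec 2" "v\<^sub>2 \<in> carrier_vec 2"
    using assms(2) by (auto simp: joint_eigenbasis_def joint_eigenvector_def)
  then have "0 \<cdot>\<^sub>v v\<^sub>1 + 0 \<cdot>\<^sub>v v\<^sub>2 = 0\<^sub>v 2" by (intro eq_vecI) auto
  then show ?thesis using ab assms(4) by auto
qed

lemma joint_eigenvalues_unique:
  assumes T: "\<And>k. T k \<in> carrier_mat 2 2"
    and eb: "joint_eigenbasis T v\<^sub>1 v\<^sub>2 z\<^sub>1 z\<^sub>2" "joint_eigenbasis T u\<^sub>1 u\<^sub>2 y\<^sub>1 y\<^sub>2"
  shows "{y\<^sub>1, y\<^sub>2} = {z\<^sub>1, z\<^sub>2}"
proof -
  have sub: "{b\<^sub>1, b\<^sub>2} \<subseteq> {a\<^sub>1, a\<^sub>2}"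
    if "joint_eigenbasis T p\<^sub>1 p\<^sub>2 a\<^sub>1 a\<^sub>2" "joint_eigenbasis T q\<^sub>1 q\<^sub>2 b\<^sub>1 b\<^sub>2" for p\<^sub>1 p\<^sub>2 q\<^sub>1 q\<^sub>2 a\<^sub>1 a\<^sub>2 b\<^sub>1 b\<^sub>2
    using joint_eigenvalue_in_spectrum[OF T that(1)] joint_eigenbasis_nonzero[OF that(2)] that(2)
    unfolding joint_eigenbasis_def by blast
  show ?thesis using sub[OF eb] sub[OF eb(2,1)] by (rule equalityI)
qed

lemma joint_spectrum_eq:
  assumes "\<And>k. T k \<in> carrier_mat 2 2" "joint_eigenbasis T v\<^sub>1 v\<^sub>2 z\<^sub>1 z\<^sub>2"
  shows "joint_spectrum T = {z\<^sub>1, z\<^sub>2}"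
  unfolding joint_spectrum_def
proof (rule the_equality)
  show "\<exists>u\<^sub>1 u\<^sub>2 y\<^sub>1 y\<^sub>2. joint_eigenbasis T u\<^sub>1 u\<^sub>2 y\<^sub>1 y\<^sub>2 \<and> {z\<^sub>1, z\<^sub>2} = {y\<^sub>1, y\<^sub>2}"
    using assms(2) by blast
  show "S = {z\<^sub>1, z\<^sub>2}" if "\<exists>u\<^sub>1 u\<^sub>2 y\<^sub>1 y\<^sub>2. joint_eigenbasis T u\<^sub>1 u\<^sub>2 y\<^sub>1 y\<^sub>2 \<and> S = {y\<^sub>1, y\<^sub>2}" for S
    using that joint_eigenvalues_unique[OF assms] by metis
qed

text \<open>An operator specified on one eigenbasis behaves as the calculus should on every joint
  eigenvector: in the expansion, \<open>G z\<^sub>1\<close> and \<open>G z\<^sub>2\<close> may be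
  replaced by \<open>G z\<close>, since a term with a different point has coefficient 0.\<close>

lemma fun_calc_joint_eigenvector:
  assumes T: "\<And>k. T k \<in> carrier_mat 2 2" and eb: "joint_eigenbasis T v\<^sub>1 v\<^sub>2 z\<^sub>1 z\<^sub>2"
    and M: "M \<in> carrier_mat (m * 2) (n * 2)"
    and G: "G z\<^sub>1 \<in> carrier_mat m n" "G z\<^sub>2 \<in> carrier_mat m n" "G z \<in> carrier_mat m n"
    and Me: "\<And>e. e \<in> carrier_vec n \<Longrightarrow> M *\<^sub>v tensor_vec e v\<^sub>1 = tensor_vec (G z\<^sub>1 *\<^sub>v e) v\<^sub>1"
      "\<And>e. e \<in> carrier_vec n \<Longrightarrow> M *\<^sub>v tensor_vec e v\<^sub>2 = tensor_vec (G z\<^sub>2 *\<^sub>v e) v\<^sub>2"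
    and ev: "joint_eigenvector T v z" and e: "e \<in> carrier_vec n"
  shows "M *\<^sub>v tensor_vec e v = tensor_vec (G z *\<^sub>v e) v"
proof -
  obtain a b where ab: "v = a \<cdot>\<^sub>v v\<^sub>1 + b \<cdot>\<^sub>v v\<^sub>2" "a = 0 \<or> z = z\<^sub>1" "b = 0 \<or> z = z\<^sub>2"
    using joint_eigenvector_decompose[OF T eb ev] .
  have v: "v\<^sub>1 \<in> carrier_vec 2" "v\<^sub>2 \<in> carrier_vec 2"
    using eb by (auto simp: joint_eigenbasis_def joint_eigenvector_def)
  have t: "tensor_vec e v\<^sub>1 \<in> carrier_vec (n * 2)" "tensor_vec e v\<^sub>2 \<in> carrier_vec (n * 2)"
    using e v by auto
  have Ge: "G z\<^sub>1 *\<^sub>v e \<in> carrier_vec m" "G z\<^sub>2 *\<^sub>v e \<in> carrier_vec m" "G z *\<^sub>v e \<in> carrier_vec m"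
    using G e by auto
  have "M *\<^sub>v tensor_vec e v = M *\<^sub>v (a \<cdot>\<^sub>v tensor_vec e v\<^sub>1 + b \<cdot>\<^sub>v tensor_vec e v\<^sub>2)"
    unfolding ab(1) tensor_vec_lincomb_right[OF e v] ..
  also have "\<dots> = a \<cdot>\<^sub>v (M *\<^sub>v tensor_vec e v\<^sub>1) + b \<cdot>\<^sub>v (M *\<^sub>v tensor_vec e v\<^sub>2)"
    using mult_add_distrib_mat_vec[OF M, of "a \<cdot>\<^sub>v tensor_vec e v\<^sub>1" "b \<cdot>\<^sub>v tensor_vec e v\<^sub>2"]
      mult_mat_vec[OF M t(1)] mult_mat_vec[OF M t(2)] t by simp
  also have "a \<cdot>\<^sub>v (M *\<^sub>v tensor_vec e v\<^sub>1) = a \<cdot>\<^sub>v tensor_vec (G z *\<^sub>v e) v\<^sub>1"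
    unfolding Me(1)[OF e] by (rule eq_vecI) (use ab(2) Ge v G in auto)
  also have "b \<cdot>\<^sub>v (M *\<^sub>v tensor_vec e v\<^sub>2) = b \<cdot>\<^sub>v tensor_vec (G z *\<^sub>v e) v\<^sub>2"
    unfolding Me(2)[OF e] by (rule eq_vecI) (use ab(3) Ge v G in auto)
  finally show ?thesis unfolding ab(1) tensor_vec_lincomb_right[OF Ge(3) v] .
qed

text \<open>Evaluates the definite description on a basis of choice. A competitor \<open>N\<close>
  may come from another eigenbasis, but by \<open>fun_calc_joint_eigenvector\<close> it agrees with
  \<open>M\<close> on the tensors with \<open>v\<^sub>1\<close> and \<open>v\<^sub>2\<close>, which
  span.\<close>

lemma mat_fun_calc:
  assumes T: "\<And>k. T k \<in> carrier_mat 2 2" and eb: "joint_eigenbasis T v\<^sub>1 v\<^sub>2 z\<^sub>1 z\<^sub>2"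
    and G: "G z\<^sub>1 \<in> carrier_mat m n" "G z\<^sub>2 \<in> carrier_mat m n"
  shows "mat_fun_calc m n G T \<in> carrier_mat (m * 2) (n * 2)"
    and "e \<in> carrier_vec n \<Longrightarrow> mat_fun_calc m n G T *\<^sub>v tensor_vec e v\<^sub>1 = tensor_vec (G z\<^sub>1 *\<^sub>v e) v\<^sub>1"
    and "e \<in> carrier_vec n \<Longrightarrow> mat_fun_calc m n G T *\<^sub>v tensor_vec e v\<^sub>2 = tensor_vec (G z\<^sub>2 *\<^sub>v e) v\<^sub>2"
proof -
  have ev: "joint_eigenvector T v\<^sub>1 z\<^sub>1" "joint_eigenvector T v\<^sub>2 z\<^sub>2"
    and v: "v\<^sub>1 \<in> carrier_vec 2" "v\<^sub>2 \<in> carrier_vec 2"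
    using eb by (auto simp: joint_eigenbasis_def joint_eigenvector_def)
  obtain M where M: "M \<in> carrier_mat (m * 2) (n * 2)"
    "\<And>e. e \<in> carrier_vec n \<Longrightarrow> M *\<^sub>v tensor_vec e v\<^sub>1 = tensor_vec (G z\<^sub>1 *\<^sub>v e) v\<^sub>1"
    "\<And>e. e \<in> carrier_vec n \<Longrightarrow> M *\<^sub>v tensor_vec e v\<^sub>2 = tensor_vec (G z\<^sub>2 *\<^sub>v e) v\<^sub>2"
    using fun_calc_exists[OF eb G] by blast
  have "mat_fun_calc m n G T = M"
    unfolding mat_fun_calc_def
  proof (rule the_equality)
    show "M \<in> carrier_mat (m * 2) (n * 2) \<and>
        (\<exists>v\<^sub>1 v\<^sub>2 z\<^sub>1 z\<^sub>2. joint_eigenbasis T v\<^sub>1 v\<^sub>2 z\<^sub>1 z\<^sub>2 \<and>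
           (\<forall>e \<in> carrier_vec n.
              M *\<^sub>v tensor_vec e v\<^sub>1 = tensor_vec (G z\<^sub>1 *\<^sub>v e) v\<^sub>1 \<and>
              M *\<^sub>v tensor_vec e v\<^sub>2 = tensor_vec (G z\<^sub>2 *\<^sub>v e) v\<^sub>2))"
      using M eb by blast
    fix N assume "N \<in> carrier_mat (m * 2) (n * 2) \<and>
        (\<exists>v\<^sub>1 v\<^sub>2 z\<^sub>1 z\<^sub>2. joint_eigenbasis T v\<^sub>1 v\<^sub>2 z\<^sub>1 z\<^sub>2 \<and>
           (\<forall>e \<in> carrier_vec n.
              N *\<^sub>v tensor_vec e v\<^sub>1 = tensor_vec (G z\<^sub>1 *\<^sub>v e) v\<^sub>1 \<and>
              N *\<^sub>v tensor_vec e v\<^sub>2 = tensor_vec (G z\<^sub>2 *\<^sub>v e) v\<^sub>2))"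
    then obtain u\<^sub>1 u\<^sub>2 y\<^sub>1 y\<^sub>2 where N: "N \<in> carrier_mat (m * 2) (n * 2)" and ub: "joint_eigenbasis T u\<^sub>1 u\<^sub>2 y\<^sub>1 y\<^sub>2"
      and Ne: "\<And>e. e \<in> carrier_vec n \<Longrightarrow> N *\<^sub>v tensor_vec e u\<^sub>1 = tensor_vec (G y\<^sub>1 *\<^sub>v e) u\<^sub>1"
        "\<And>e. e \<in> carrier_vec n \<Longrightarrow> N *\<^sub>v tensor_vec e u\<^sub>2 = tensor_vec (G y\<^sub>2 *\<^sub>v e) u\<^sub>2"
      by blast
    have "y\<^sub>1 \<in> {z\<^sub>1, z\<^sub>2}" "y\<^sub>2 \<in> {z\<^sub>1, z\<^sub>2}" using joint_eigenvalues_unique[OF T eb ub] by auto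
    then have Gy: "G y\<^sub>1 \<in> carrier_mat m n" "G y\<^sub>2 \<in> carrier_mat m n" using G by auto
    show "N = M"
    proof (rule mat_eqI_vec[OF N M(1)])
      fix x :: "complex Matrix.vec" assume "x \<in> carrier_vec (n * 2)"
      then obtain e\<^sub>1 e\<^sub>2 where e: "e\<^sub>1 \<in> carrier_vec n" "e\<^sub>2 \<in> carrier_vec n"
        and x: "x = tensor_vec e\<^sub>1 v\<^sub>1 + tensor_vec e\<^sub>2 v\<^sub>2" using joint_eigenbasis_span[OF eb] by blast
      have t: "tensor_vec e\<^sub>1 v\<^sub>1 \<in> carrier_vec (n * 2)" "tensor_vec e\<^sub>2 v\<^sub>2 \<in> carrier_vec (n * 2)"
        using e v by auto
      have "N *\<^sub>v tensor_vec e\<^sub>1 v\<^sub>1 = M *\<^sub>v tensor_vec e\<^sub>1 v\<^sub>1"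
        unfolding M(2)[OF e(1)] by (rule fun_calc_joint_eigenvector[OF T ub N Gy G(1) Ne ev(1) e(1)])
      moreover have "N *\<^sub>v tensor_vec e\<^sub>2 v\<^sub>2 = M *\<^sub>v tensor_vec e\<^sub>2 v\<^sub>2"
        unfolding M(3)[OF e(2)] by (rule fun_calc_joint_eigenvector[OF T ub N Gy G(2) Ne ev(2) e(2)])
      ultimately show "N *\<^sub>v x = M *\<^sub>v x"
        unfolding x mult_add_distrib_mat_vec[OF N t] mult_add_distrib_mat_vec[OF M(1) t] by simp
    qed
  qed
  with M show "mat_fun_calc m n G T \<in> carrier_mat (m * 2) (n * 2)"
    "e \<in> carrier_vec n \<Longrightarrow> mat_fun_calc m n G T *\<^sub>v tensor_vec e v\<^sub>1 = tensor_vec (G z\<^sub>1 *\<^sub>v e) v\<^sub>1"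
    "e \<in> carrier_vec n \<Longrightarrow> mat_fun_calc m n G T *\<^sub>v tensor_vec e v\<^sub>2 = tensor_vec (G z\<^sub>2 *\<^sub>v e) v\<^sub>2"
    by simp_all
qed

text \<open>The spectrum is an unordered set, so a given eigenbasis may have to be swapped to match
  \<open>z\<close> and \<open>w\<close>; rescaling then makes the eigenvectors unit vectors.\<close>

lemma normalized_joint_eigenbasis:
  assumes T: "diagonalizable_tuple T" and spec: "joint_spectrum T = {z, w}"
  obtains v\<^sub>1 v\<^sub>2 where "joint_eigenbasis T v\<^sub>1 v\<^sub>2 z w" "l2_norm v\<^sub>1 = 1" "l2_norm v\<^sub>2 = 1"
proof -
  have Tc: "\<And>k. T k \<in> carrier_mat 2 2" using T by (simp add: diagonalizable_tuple_def commuting_tuple_def)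
  obtain u\<^sub>1 u\<^sub>2 y\<^sub>1 y\<^sub>2 where "joint_eigenbasis T u\<^sub>1 u\<^sub>2 y\<^sub>1 y\<^sub>2" using T by (auto simp: diagonalizable_tuple_def)
  moreover from joint_spectrum_eq[OF Tc this] spec have "(y\<^sub>1 = z \<and> y\<^sub>2 = w) \<or> (y\<^sub>1 = w \<and> y\<^sub>2 = z)"
    by (auto simp: doubleton_eq_iff)
  ultimately obtain v\<^sub>1 v\<^sub>2 where eb: "joint_eigenbasis T v\<^sub>1 v\<^sub>2 z w" using joint_eigenbasis_swap by metis
  have v: "v\<^sub>1 \<in> carrier_vec 2" "v\<^sub>2 \<in> carrier_vec 2"
    using eb by (auto simp: joint_eigenbasis_def joint_eigenvector_def)
  define c\<^sub>1 where "c\<^sub>1 = complex_of_real (1 / l2_norm v\<^sub>1)"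
  define c\<^sub>2 where "c\<^sub>2 = complex_of_real (1 / l2_norm v\<^sub>2)"
  have n: "l2_norm v\<^sub>1 \<noteq> 0" "l2_norm v\<^sub>2 \<noteq> 0"
    using joint_eigenbasis_nonzero[OF eb] v l2_norm_eq_0 by blast+
  then have c: "c\<^sub>1 \<noteq> 0" "c\<^sub>2 \<noteq> 0" by (simp_all add: c\<^sub>1_def c\<^sub>2_def)
  have scale: "joint_eigenvector T (c \<cdot>\<^sub>v x) y" if "joint_eigenvector T x y" for c x y
    using that mult_mat_vec[OF Tc] by (auto simp: joint_eigenvector_def smult_smult_assoc mult.commute)
  have "joint_eigenbasis T (c\<^sub>1 \<cdot>\<^sub>v v\<^sub>1) (c\<^sub>2 \<cdot>\<^sub>v v\<^sub>2) z w"
    unfolding joint_eigenbasis_def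
  proof (intro conjI allI impI)
    show "joint_eigenvector T (c\<^sub>1 \<cdot>\<^sub>v v\<^sub>1) z" "joint_eigenvector T (c\<^sub>2 \<cdot>\<^sub>v v\<^sub>2) w"
      using eb scale by (auto simp: joint_eigenbasis_def)
    fix a b assume "a \<cdot>\<^sub>v (c\<^sub>1 \<cdot>\<^sub>v v\<^sub>1) + b \<cdot>\<^sub>v (c\<^sub>2 \<cdot>\<^sub>v v\<^sub>2) = 0\<^sub>v 2"
    then have "(a * c\<^sub>1) \<cdot>\<^sub>v v\<^sub>1 + (b * c\<^sub>2) \<cdot>\<^sub>v v\<^sub>2 = 0\<^sub>v 2" by (simp add: smult_smult_assoc)
    then have "a * c\<^sub>1 = 0 \<and> b * c\<^sub>2 = 0"
      using eb unfolding joint_eigenbasis_def by blast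
    then show "a = 0" "b = 0" using c by auto
  qed
  moreover have "l2_norm (c\<^sub>1 \<cdot>\<^sub>v v\<^sub>1) = 1" "l2_norm (c\<^sub>2 \<cdot>\<^sub>v v\<^sub>2) = 1"
    using n by (simp_all add: l2_norm_smult c\<^sub>1_def c\<^sub>2_def norm_divide)
  ultimately show thesis using that by blast
qed

text \<open>Inner products of tensors factor, so unit vectors give pure squares and the only trace
  of the eigenvectors is their inner product.\<close>

lemma l2_norm_tensor_sum:
  assumes v: "v\<^sub>1 \<in> carrier_vec 2" "v\<^sub>2 \<in> carrier_vec 2" "l2_norm v\<^sub>1 = 1" "l2_norm v\<^sub>2 = 1"
    and e: "e \<in> carrier_vec n" "e' \<in> carrier_vec n"
  shows "(l2_norm (tensor_vec e v\<^sub>1 + tensor_vec e' v\<^sub>2))\<^sup>2 =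
    (l2_norm e)\<^sup>2 + (l2_norm e')\<^sup>2 + 2 * Re ((v\<^sub>1 \<bullet>c v\<^sub>2) * (e \<bullet>c e'))"
proof -
  let ?p = "tensor_vec e v\<^sub>1" and ?q = "tensor_vec e' v\<^sub>2"
  have t: "?p \<in> carrier_vec (n * 2)" "?q \<in> carrier_vec (n * 2)" using e v by auto
  have "(?p + ?q) \<bullet>c (?p + ?q) = ?p \<bullet>c ?p + ?q \<bullet>c ?q + (?p \<bullet>c ?q + ?q \<bullet>c ?p)"
    unfolding cinner_add_left[OF t add_carrier_vec[OF t]] cinner_add_right[OF t t(1)] cinner_add_right[OF t t(2)]
    by simp
  also have "?q \<bullet>c ?p = cnj (?p \<bullet>c ?q)" using cnj_cinner[OF t] by simp
  also have "?p \<bullet>c ?p = complex_of_real ((l2_norm e)\<^sup>2)"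
    unfolding tensor_vec_cinner[OF e(1) e(1) v(1) v(1)] unfolding cinner_self v by simp
  also have "?q \<bullet>c ?q = complex_of_real ((l2_norm e')\<^sup>2)"
    unfolding tensor_vec_cinner[OF e(2) e(2) v(2) v(2)] unfolding cinner_self v by simp
  also have "?p \<bullet>c ?q = (v\<^sub>1 \<bullet>c v\<^sub>2) * (e \<bullet>c e')"
    unfolding tensor_vec_cinner[OF e v(1,2)] by simp
  finally show ?thesis unfolding l2_norm_sq_Re[of "?p + ?q"] by simp
qed

text \<open>Testing the norm on \<open>tensor_vec e v\<^sub>1 + tensor_vec e' v\<^sub>2\<close>
  reaches every vector. A general \<open>t\<close> is kept because the main proof scales: it uses
  \<open>t = 1\<close> for the normalized function and a larger or smaller bound for the original
  one.\<close>

lemma op_norm_mat_fun_calc_le_iff: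
  assumes T: "\<And>k. T k \<in> carrier_mat 2 2" and eb: "joint_eigenbasis T v\<^sub>1 v\<^sub>2 z\<^sub>1 z\<^sub>2"
    and unit: "l2_norm v\<^sub>1 = 1" "l2_norm v\<^sub>2 = 1"
    and G: "G z\<^sub>1 \<in> carrier_mat m n" "G z\<^sub>2 \<in> carrier_mat m n" and t: "0 \<le> t"
  shows "op_norm (mat_fun_calc m n G T) \<le> t \<longleftrightarrow>
    (\<forall>e \<in> carrier_vec n. \<forall>e' \<in> carrier_vec n.
      (l2_norm (G z\<^sub>1 *\<^sub>v e))\<^sup>2 + (l2_norm (G z\<^sub>2 *\<^sub>v e'))\<^sup>2 + 2 * Re ((v\<^sub>1 \<bullet>c v\<^sub>2) * ((G z\<^sub>1 *\<^sub>v e) \<bullet>c (G z\<^sub>2 *\<^sub>v e')))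
      \<le> t\<^sup>2 * ((l2_norm e)\<^sup>2 + (l2_norm e')\<^sup>2 + 2 * Re ((v\<^sub>1 \<bullet>c v\<^sub>2) * (e \<bullet>c e'))))"
    (is "?L \<longleftrightarrow> (\<forall>e \<in> _. \<forall>e' \<in> _. ?out e e' \<le> t\<^sup>2 * ?inp e e')")
proof -
  let ?M = "mat_fun_calc m n G T"
  have v: "v\<^sub>1 \<in> carrier_vec 2" "v\<^sub>2 \<in> carrier_vec 2"
    using eb by (auto simp: joint_eigenbasis_def joint_eigenvector_def)
  note calc = mat_fun_calc[where G = G, OF T eb G]
  have inp: "?inp e e' = (l2_norm (tensor_vec e v\<^sub>1 + tensor_vec e' v\<^sub>2))\<^sup>2"
    and out: "?out e e' = (l2_norm (?M *\<^sub>v (tensor_vec e v\<^sub>1 + tensor_vec e' v\<^sub>2)))\<^sup>2"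
    if e: "e \<in> carrier_vec n" "e' \<in> carrier_vec n" for e e'
  proof -
    show "?inp e e' = (l2_norm (tensor_vec e v\<^sub>1 + tensor_vec e' v\<^sub>2))\<^sup>2"
      by (rule l2_norm_tensor_sum[OF v unit e, symmetric])
    have t: "tensor_vec e v\<^sub>1 \<in> carrier_vec (n * 2)" "tensor_vec e' v\<^sub>2 \<in> carrier_vec (n * 2)"
      using e v by auto
    have Ge: "G z\<^sub>1 *\<^sub>v e \<in> carrier_vec m" "G z\<^sub>2 *\<^sub>v e' \<in> carrier_vec m" using G e by auto
    show "?out e e' = (l2_norm (?M *\<^sub>v (tensor_vec e v\<^sub>1 + tensor_vec e' v\<^sub>2)))\<^sup>2"
      unfolding mult_add_distrib_mat_vec[OF calc(1) t] calc(2)[OF e(1)] calc(3)[OF e(2)]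
      by (rule l2_norm_tensor_sum[OF v unit Ge, symmetric])
  qed
  have sq: "l2_norm x \<le> t * l2_norm y \<longleftrightarrow> (l2_norm x)\<^sup>2 \<le> t\<^sup>2 * (l2_norm y)\<^sup>2" for x y
    using t by (simp add: power_mult_distrib[symmetric] power2_le_iff_abs_le abs_le_iff)
  show ?thesis
  proof
    assume L: ?L
    show "\<forall>e \<in> carrier_vec n. \<forall>e' \<in> carrier_vec n. ?out e e' \<le> t\<^sup>2 * ?inp e e'"
    proof (intro ballI)
      fix e e' :: "complex Matrix.vec" assume e: "e \<in> carrier_vec n" "e' \<in> carrier_vec n"
      let ?x = "tensor_vec e v\<^sub>1 + tensor_vec e' v\<^sub>2"
      have x: "?x \<in> carrier_vec (n * 2)" using e v by auto
      have "l2_norm (?M *\<^sub>v ?x) \<le> op_norm ?M * l2_norm ?x" by (rule op_norm_bound[OF calc(1) x])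
      also have "\<dots> \<le> t * l2_norm ?x" using L by (intro mult_right_mono) auto
      finally show "?out e e' \<le> t\<^sup>2 * ?inp e e'" unfolding inp[OF e] out[OF e] sq .
    qed
  next
    assume R: "\<forall>e \<in> carrier_vec n. \<forall>e' \<in> carrier_vec n. ?out e e' \<le> t\<^sup>2 * ?inp e e'"
    show ?L
    proof (rule op_norm_leI[OF calc(1) t])
      fix x :: "complex Matrix.vec" assume "x \<in> carrier_vec (n * 2)"
      then obtain e e' where e: "e \<in> carrier_vec n" "e' \<in> carrier_vec n"
        and x: "x = tensor_vec e v\<^sub>1 + tensor_vec e' v\<^sub>2" using joint_eigenbasis_span[OF eb] by blast
      from R e have "?out e e' \<le> t\<^sup>2 * ?inp e e'" by blast
      then show "l2_norm (?M *\<^sub>v x) \<le> t * l2_norm x" unfolding inp[OF e] out[OF e] sq x .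
    qed
  qed
qed

section \<open>The spectral inequality\<close>

lemma op_norm_le_sqrt_iff:
  assumes "C \<in> carrier_mat m n" "0 \<le> c"
  shows "op_norm C \<le> sqrt c \<longleftrightarrow> (\<forall>y \<in> carrier_vec n. (l2_norm (C *\<^sub>v y))\<^sup>2 \<le> c * (l2_norm y)\<^sup>2)"
proof
  assume L: "op_norm C \<le> sqrt c"
  show "\<forall>y \<in> carrier_vec n. (l2_norm (C *\<^sub>v y))\<^sup>2 \<le> c * (l2_norm y)\<^sup>2"
  proof
    fix y :: "complex Matrix.vec" assume "y \<in> carrier_vec n"
    from op_norm_bound[OF assms(1) this] have "l2_norm (C *\<^sub>v y) \<le> sqrt c * l2_norm y"
      using L by (meson l2_norm_nonneg mult_right_mono order_trans)
    then have "(l2_norm (C *\<^sub>v y))\<^sup>2 \<le> (sqrt c * l2_norm y)\<^sup>2" by (rule power_mono) simp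
    then show "(l2_norm (C *\<^sub>v y))\<^sup>2 \<le> c * (l2_norm y)\<^sup>2" using assms(2) by (simp add: power_mult_distrib)
  qed
next
  assume R: "\<forall>y \<in> carrier_vec n. (l2_norm (C *\<^sub>v y))\<^sup>2 \<le> c * (l2_norm y)\<^sup>2"
  show "op_norm C \<le> sqrt c"
  proof (rule op_norm_leI[OF assms(1)])
    show "0 \<le> sqrt c" using assms(2) by simp
    fix y :: "complex Matrix.vec" assume "y \<in> carrier_vec n"
    then have "(l2_norm (C *\<^sub>v y))\<^sup>2 \<le> (sqrt c * l2_norm y)\<^sup>2"
      using R assms(2) by (simp add: power_mult_distrib)
    then show "l2_norm (C *\<^sub>v y) \<le> sqrt c * l2_norm y"
      by (rule power2_le_imp_le) (simp add: assms(2))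
  qed
qed

text \<open>The bridge used in both directions: the threshold on the right depends on the
  eigenvectors alone, so it is the same for \<open>\<Delta>\<close> and for every other
  \<open>G\<close>. Cauchy-Schwarz keeps the radicand nonnegative.\<close>

lemma op_norm_mat_fun_calc_le_1_iff:
  assumes T: "\<And>k. T k \<in> carrier_mat 2 2" and eb: "joint_eigenbasis T v\<^sub>1 v\<^sub>2 z w"
    and unit: "l2_norm v\<^sub>1 = 1" "l2_norm v\<^sub>2 = 1"
    and G: "G z \<in> carrier_mat m n" "op_norm (G z) < 1" "G w \<in> carrier_mat m n" "op_norm (G w) < 1"
  shows "op_norm (mat_fun_calc m n G T) \<le> 1 \<longleftrightarrow>
    op_norm (mobius_mat m n (G z) (G w)) \<le> sqrt (1 - (cmod (v\<^sub>1 \<bullet>c v\<^sub>2))\<^sup>2)"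
proof -
  have v: "v\<^sub>1 \<in> carrier_vec 2" "v\<^sub>2 \<in> carrier_vec 2"
    using eb by (auto simp: joint_eigenbasis_def joint_eigenvector_def)
  have "cmod (v\<^sub>1 \<bullet>c v\<^sub>2) \<le> 1" using cinner_Cauchy_Schwarz[OF v] unit by simp
  then have "0 \<le> 1 - (cmod (v\<^sub>1 \<bullet>c v\<^sub>2))\<^sup>2" by (simp add: power_le_one)
  then show ?thesis
    unfolding op_norm_le_sqrt_iff[OF mobius_mat_carrier[OF G] \<open>0 \<le> 1 - _\<close>]
      op_norm_mat_fun_calc_le_iff[where G = G, OF T eb unit G(1,3) zero_le_one] two_point_iff[OF G, symmetric]
    by simp
qed

theorem theorem1p1:
  fixes E :: "(complex ^ 'd) set"
    and \<Delta> :: "complex ^ 'd \<Rightarrow> complex mat"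
    and T :: "'d::finite \<Rightarrow> complex mat"
    and z w :: "complex ^ 'd"
    and s r :: nat
  assumes "0 < s" and "0 < r"
    and "open E"
    and "holomorphic_mat s r \<Delta> E"
    and "connected (B_Delta E \<Delta>)"
    and "\<exists>a \<in> B_Delta E \<Delta>. \<exists>b \<in> B_Delta E \<Delta>. a \<noteq> b"
    and "diagonalizable_tuple T"
    and "joint_spectrum T = {z, w}"
    and "{z, w} \<subseteq> B_Delta E \<Delta>"
    and "op_norm (mat_fun_calc s r \<Delta> T) \<le> 1"
    and "delta_dist s r \<Delta> z w = mobius_dist (B_Delta E \<Delta>) z w"
  shows "complete_spectral_domain (B_Delta E \<Delta>) T"
proof -
  let ?\<Omega> = "B_Delta E \<Delta>"
  have op: "open ?\<Omega>" using assms(3,4) by (rule open_B_Delta)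
  have zw: "z \<in> ?\<Omega>" "w \<in> ?\<Omega>" using assms(9) by auto
  have T: "\<And>k. T k \<in> carrier_mat 2 2" using assms(7) by (simp add: diagonalizable_tuple_def commuting_tuple_def)
  obtain v\<^sub>1 v\<^sub>2 where eb: "joint_eigenbasis T v\<^sub>1 v\<^sub>2 z w" and unit: "l2_norm v\<^sub>1 = 1" "l2_norm v\<^sub>2 = 1"
    using normalized_joint_eigenbasis[OF assms(7,8)] .
  define c where "c = sqrt (1 - (cmod (v\<^sub>1 \<bullet>c v\<^sub>2))\<^sup>2)"
  have D: "\<Delta> z \<in> carrier_mat s r" "op_norm (\<Delta> z) < 1" "\<Delta> w \<in> carrier_mat s r" "op_norm (\<Delta> w) < 1"
    using zw holomorphic_matD(1)[OF assms(4)] by (auto simp: B_Delta_def)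
  have "delta_dist s r \<Delta> z w \<le> c"
    using op_norm_mat_fun_calc_le_1_iff[where G = \<Delta>, OF T eb unit D] assms(10)
    by (simp add: delta_dist_def mobius_mat_def c_def)
  \<comment> \<open>The passage from \<open>\<Delta>\<close> to the domain: the bound now concerns a
    quantity that dominates the Moebius image of every strictly contractive holomorphic matrix
    function.\<close>
  then have dist: "mobius_dist ?\<Omega> z w \<le> c" using assms(11) by simp
  \<comment> \<open>A bound \<open>t\<close> strictly above all norms makes \<open>f / t\<close>
    strictly contractive on the whole domain, as its Moebius transform demands.\<close>
  have bound: "op_norm (mat_fun_calc n n f T) \<le> t"
    if f: "holomorphic_mat n n f ?\<Omega>" and t: "0 < t" and lt: "\<And>\<zeta>. \<zeta> \<in> ?\<Omega> \<Longrightarrow> op_norm (f \<zeta>) < t" for n f t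
  proof -
    define g where "g \<zeta> = complex_of_real (1 / t) \<cdot>\<^sub>m f \<zeta>" for \<zeta>
    have g: "holomorphic_mat n n g ?\<Omega>" unfolding g_def using op f by (rule holomorphic_mat_smult)
    have g_lt: "op_norm (g \<zeta>) < 1" if "\<zeta> \<in> ?\<Omega>" for \<zeta>
    proof -
      have "op_norm (g \<zeta>) \<le> 1 / t * op_norm (f \<zeta>)"
        using op_norm_smult_le[of "complex_of_real (1 / t)" "f \<zeta>"] t by (simp add: g_def norm_divide)
      also have "\<dots> < 1" using lt[OF that] t by simp
      finally show ?thesis .
    qed
    note gc = holomorphic_matD(1)[OF g zw(1)] g_lt[OF zw(1)] holomorphic_matD(1)[OF g zw(2)] g_lt[OF zw(2)]
    have "op_norm (mobius_mat n n (g z) (g w)) \<le> c"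
      using op_norm_mobius_mat_le[OF op g g_lt zw] dist by linarith
    then have "op_norm (mat_fun_calc n n g T) \<le> 1"
      using op_norm_mat_fun_calc_le_1_iff[where G = g, OF T eb unit gc] by (simp add: c_def)
    note g_form = this[unfolded op_norm_mat_fun_calc_le_iff[where G = g, OF T eb unit gc(1,3) zero_le_one]]
    note fc = holomorphic_matD(1)[OF f zw(1)] holomorphic_matD(1)[OF f zw(2)]
    \<comment> \<open>The scaling is undone in the quadratic inequality, whose left side is
      homogeneous of degree 2 in the function; hence the factor \<open>t\<^sup>2\<close>.\<close>
    have fg: "f \<zeta> *\<^sub>v e = complex_of_real t \<cdot>\<^sub>v (g \<zeta> *\<^sub>v e)" if "f \<zeta> \<in> carrier_mat n n" "e \<in> carrier_vec n" for \<zeta> e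
    proof (rule eq_vecI)
      fix i assume "i < dim_vec (complex_of_real t \<cdot>\<^sub>v (g \<zeta> *\<^sub>v e))"
      then have "i < n" using that by (simp add: g_def)
      then show "(f \<zeta> *\<^sub>v e) $ i = (complex_of_real t \<cdot>\<^sub>v (g \<zeta> *\<^sub>v e)) $ i"
        using that t by (simp add: g_def)
    qed (use that in \<open>simp add: g_def\<close>)
    show ?thesis
      unfolding op_norm_mat_fun_calc_le_iff[where G = f, OF T eb unit fc less_imp_le[OF t]]
    proof (intro ballI)
      fix e e' :: "complex Matrix.vec" assume e: "e \<in> carrier_vec n" "e' \<in> carrier_vec n"
      have ge: "g z *\<^sub>v e \<in> carrier_vec n" "g w *\<^sub>v e' \<in> carrier_vec n" using gc(1,3) e by auto
      have cross: "(complex_of_real t \<cdot>\<^sub>v (g z *\<^sub>v e)) \<bullet>c (complex_of_real t \<cdot>\<^sub>v (g w *\<^sub>v e')) =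
          complex_of_real (t\<^sup>2) * ((g z *\<^sub>v e) \<bullet>c (g w *\<^sub>v e'))"
        using cinner_smult_left[OF ge(1), of "complex_of_real t \<cdot>\<^sub>v (g w *\<^sub>v e')"] cinner_smult_right[OF ge(2,1)] ge
        by (simp add: power2_eq_square)
      have "(l2_norm (f z *\<^sub>v e))\<^sup>2 + (l2_norm (f w *\<^sub>v e'))\<^sup>2 + 2 * Re ((v\<^sub>1 \<bullet>c v\<^sub>2) * ((f z *\<^sub>v e) \<bullet>c (f w *\<^sub>v e')))
        = t\<^sup>2 * ((l2_norm (g z *\<^sub>v e))\<^sup>2 + (l2_norm (g w *\<^sub>v e'))\<^sup>2 + 2 * Re ((v\<^sub>1 \<bullet>c v\<^sub>2) * ((g z *\<^sub>v e) \<bullet>c (g w *\<^sub>v e'))))"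
        unfolding fg[OF fc(1) e(1)] fg[OF fc(2) e(2)] cross l2_norm_smult
        by (simp add: power_mult_distrib algebra_simps del: of_real_power)
      also have "\<dots> \<le> t\<^sup>2 * ((l2_norm e)\<^sup>2 + (l2_norm e')\<^sup>2 + 2 * Re ((v\<^sub>1 \<bullet>c v\<^sub>2) * (e \<bullet>c e')))"
        using g_form e by (intro mult_left_mono) auto
      finally show "(l2_norm (f z *\<^sub>v e))\<^sup>2 + (l2_norm (f w *\<^sub>v e'))\<^sup>2 + 2 * Re ((v\<^sub>1 \<bullet>c v\<^sub>2) * ((f z *\<^sub>v e) \<bullet>c (f w *\<^sub>v e')))
        \<le> t\<^sup>2 * ((l2_norm e)\<^sup>2 + (l2_norm e')\<^sup>2 + 2 * Re ((v\<^sub>1 \<bullet>c v\<^sub>2) * (e \<bullet>c e')))" .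
    qed
  qed
  show ?thesis
    unfolding complete_spectral_domain_def is_domain_def
  proof (intro conjI allI impI)
    fix n f assume nf: "0 < n \<and> holomorphic_mat n n f ?\<Omega>"
    let ?S = "SUP \<zeta>\<in>?\<Omega>. ereal (op_norm (f \<zeta>))"
    have up: "ereal (op_norm (f \<zeta>)) \<le> ?S" if "\<zeta> \<in> ?\<Omega>" for \<zeta> using that by (rule SUP_upper)
    \<comment> \<open>An infinite supremum is trivial, and minus infinity is impossible because
      \<open>?S\<close> dominates the finite value at \<open>z\<close>. A finite \<open>R\<close>
      may be attained or be 0, so \<open>bound\<close> is applied to \<open>R + \<epsilon>\<close>,
      which is strictly larger and positive.\<close>
    show "ereal (op_norm (mat_fun_calc n n f T)) \<le> ?S"
    proof (cases ?S)
      case (real R)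
      have le: "op_norm (f \<zeta>) \<le> R" if "\<zeta> \<in> ?\<Omega>" for \<zeta> using up[OF that] real by simp
      have "0 \<le> R" using le[OF zw(1)] op_norm_nonneg[of "f z"] by linarith
      have "op_norm (mat_fun_calc n n f T) \<le> R"
      proof (rule field_le_epsilon)
        fix \<epsilon> :: real assume "0 < \<epsilon>"
        then have "op_norm (f \<zeta>) < R + \<epsilon>" if "\<zeta> \<in> ?\<Omega>" for \<zeta> using le[OF that] by linarith
        then show "op_norm (mat_fun_calc n n f T) \<le> R + \<epsilon>"
          using nf \<open>0 \<le> R\<close> \<open>0 < \<epsilon>\<close> by (intro bound) auto
      qed
      then show ?thesis using real by simp
    next
      case PInf then show ?thesis by simp
    next
      case MInf then show ?thesis using up[OF zw(1)] by simp
    qed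
  qed (use op assms(5,8,9) zw in auto)
qed

end
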